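(* Let $n\ge2$ and let $u\in H^1(\mathbb{R};H^1((0,\infty);H^2(\mathbb{R}^n)))$, $u=u(t,\tau,x)$, be a nontrivial solution of $$\partial_tu+\partial_\tau u-\Delta u=0,$$ where $\Delta$ is the Laplacian in $x\in\mathbb{R}^n$. Let $T,R_1>0$ and let $t_0,\tau_0,\hat\tau>0$ be such that $t_0<T$ and $\tau_0<\hat\tau/2$. Assume that $u(t,\tau,x)=0$ in $\{(t,\tau,x):|x|<R_1,\ 0<\tau<\hat\tau,\ |t|<T\}$. Then $u(t,\tau,x)=0$ in $\{(t,\tau,x):x\in\mathbb{R}^n,\ 0<\tau<\hat\tau,\ |t|<T\}$.
   Context: Here $t\in\mathbb{R}$ and $\tau\in(0,\infty)$ are two independent time-like variables and $x\in\mathbb{R}^n$. *)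

theory Defs
  imports "HOL-Analysis.Analysis" "HOL-Library.Function_Algebras"
begin

text \<open>
  Lebesgue, Sobolev and Bochner spaces are represented by their functions, not by equivalence
  classes: a space is a carrier of functions together with a seminorm whose kernel consists of the
  functions that vanish almost everywhere. Functions with values in such a space are curried, so a
  function of \<open>(t, \<tau>, x)\<close> viewed as an element of \<open>H\<^sup>1(\<real>; H\<^sup>1((0,\<infinity>); H\<^sup>2(\<real>\<^sup>n)))\<close> has the type
  \<open>real \<Rightarrow> real \<Rightarrow> real ^ 'n \<Rightarrow> real\<close>. For each \<open>t\<close> and \<open>\<tau>\<close> the representative may be changed on a
  null set, so it need not be jointly measurable, and "almost everywhere" is read
  iteratively: for almost every \<open>t\<close>, for almost every \<open>\<tau>\<close>, for almost every \<open>x\<close>.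
\<close>

instantiation "fun" :: (type, real_vector) real_vector
begin

definition scaleR_fun :: "real \<Rightarrow> ('a \<Rightarrow> 'b) \<Rightarrow> 'a \<Rightarrow> 'b"
  where "scaleR_fun c f = (\<lambda>x. c *\<^sub>R f x)"

instance
  by standard (simp_all add: scaleR_fun_def fun_eq_iff scaleR_add_right scaleR_add_left)

end

record 'v seminormed =
  vecs :: "'v set"
  snorm :: "'v \<Rightarrow> real"


section \<open>Test functions\<close>

primrec Ck :: "nat \<Rightarrow> ('a::euclidean_space \<Rightarrow> real) \<Rightarrow> bool" where
  "Ck 0 f \<longleftrightarrow> continuous_on UNIV f"
| "Ck (Suc k) f \<longleftrightarrow> (\<forall>x. f differentiable (at x)) \<and>
     (\<forall>b\<in>Basis. Ck k (\<lambda>x. frechet_derivative f (at x) b))"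

definition test_functions :: "'a::euclidean_space set \<Rightarrow> ('a \<Rightarrow> real) set" where
  "test_functions \<Omega> = {\<phi>. (\<forall>k. Ck k \<phi>) \<and>
     compact (closure {x. \<phi> x \<noteq> 0}) \<and> closure {x. \<phi> x \<noteq> 0} \<subseteq> \<Omega>}"


section \<open>Sobolev spaces \<open>H\<^sup>k\<close> on Euclidean space\<close>

definition L2 :: "('a::euclidean_space \<Rightarrow> real) set" where
  "L2 = {f \<in> borel_measurable lebesgue. integrable lebesgue (\<lambda>x. (f x)\<^sup>2)}"

definition L2_norm :: "('a::euclidean_space \<Rightarrow> real) \<Rightarrow> real" where
  "L2_norm f = sqrt (LINT x|lebesgue. (f x)\<^sup>2)"

definition has_weak_partial ::
    "'a::euclidean_space \<Rightarrow> ('a \<Rightarrow> real) \<Rightarrow> ('a \<Rightarrow> real) \<Rightarrow> bool" where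
  "has_weak_partial b f g \<longleftrightarrow> (\<forall>\<phi>\<in>test_functions UNIV.
     (LINT x|lebesgue. f x * frechet_derivative \<phi> (at x) b) = - (LINT x|lebesgue. g x * \<phi> x))"

text \<open>The choice is among functions that are equal almost everywhere.\<close>

definition weak_partial :: "'a::euclidean_space \<Rightarrow> ('a \<Rightarrow> real) \<Rightarrow> 'a \<Rightarrow> real" where
  "weak_partial b f = (SOME g. g \<in> L2 \<and> has_weak_partial b f g)"

primrec sobolev_set :: "nat \<Rightarrow> ('a::euclidean_space \<Rightarrow> real) set" where
  "sobolev_set 0 = L2"
| "sobolev_set (Suc k) =
     {f \<in> L2. \<forall>b\<in>Basis. \<exists>g\<in>sobolev_set k. has_weak_partial b f g}"

text \<open>
  Mixed derivatives are counted once for each order of differentiation. This only replaces the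
  norm that sums over multi-indices by an equivalent one.
\<close>

primrec sobolev_norm :: "nat \<Rightarrow> ('a::euclidean_space \<Rightarrow> real) \<Rightarrow> real" where
  "sobolev_norm 0 f = L2_norm f"
| "sobolev_norm (Suc k) f =
     sqrt ((L2_norm f)\<^sup>2 + (\<Sum>b\<in>Basis. (sobolev_norm k (weak_partial b f))\<^sup>2))"

definition sobolev :: "nat \<Rightarrow> ('a::euclidean_space \<Rightarrow> real) seminormed" where
  "sobolev k = \<lparr> vecs = sobolev_set k, snorm = sobolev_norm k \<rparr>"

definition weak_laplacian :: "('a::euclidean_space \<Rightarrow> real) \<Rightarrow> 'a \<Rightarrow> real" where
  "weak_laplacian f x = (\<Sum>b\<in>Basis. weak_partial b (weak_partial b f) x)"


section \<open>Bochner spaces\<close>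

definition strongly_measurable ::
    "'t measure \<Rightarrow> 'v::real_vector seminormed \<Rightarrow> ('t \<Rightarrow> 'v) \<Rightarrow> bool" where
  "strongly_measurable M X f \<longleftrightarrow>
     (AE t in M. f t \<in> vecs X) \<and>
     (\<exists>s. (\<forall>i. simple_function M (s i) \<and> s i ` space M \<subseteq> vecs X) \<and>
          (AE t in M. (\<lambda>i. snorm X (f t - s i t)) \<longlonglongrightarrow> 0))"

text \<open>
  The library's \<^const>\<open>has_bochner_integral\<close> with the norm replaced by the seminorm of
  the space; the value is determined up to a vector of seminorm zero.
\<close>

definition has_bochner_integral_in ::
    "'t measure \<Rightarrow> 'v::real_vector seminormed \<Rightarrow> ('t \<Rightarrow> 'v) \<Rightarrow> 'v \<Rightarrow> bool" where
  "has_bochner_integral_in M X f v \<longleftrightarrow>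
     strongly_measurable M X f \<and> v \<in> vecs X \<and>
     (\<exists>s. (\<forall>i. Bochner_Integration.simple_bochner_integrable M (s i) \<and> s i ` space M \<subseteq> vecs X) \<and>
          (\<lambda>i. \<integral>\<^sup>+ t. ennreal (snorm X (f t - s i t)) \<partial>M) \<longlonglongrightarrow> 0 \<and>
          (\<lambda>i. snorm X (Bochner_Integration.simple_bochner_integral M (s i) - v)) \<longlonglongrightarrow> 0)"

definition bochner_L2 ::
    "real set \<Rightarrow> 'v::real_vector seminormed \<Rightarrow> (real \<Rightarrow> 'v) seminormed" where
  "bochner_L2 I X =
     \<lparr> vecs = {f. strongly_measurable (lebesgue_on I) X f \<and>
                  (\<integral>\<^sup>+ t. ennreal ((snorm X (f t))\<^sup>2) \<partial>lebesgue_on I) < \<infinity>},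
       snorm = (\<lambda>f. sqrt (enn2real (\<integral>\<^sup>+ t. ennreal ((snorm X (f t))\<^sup>2) \<partial>lebesgue_on I))) \<rparr>"

definition has_weak_deriv ::
    "real set \<Rightarrow> 'v::real_vector seminormed \<Rightarrow> (real \<Rightarrow> 'v) \<Rightarrow> (real \<Rightarrow> 'v) \<Rightarrow> bool" where
  "has_weak_deriv I X f g \<longleftrightarrow> (\<forall>\<phi>\<in>test_functions I. \<exists>v.
     has_bochner_integral_in (lebesgue_on I) X (\<lambda>t. deriv \<phi> t *\<^sub>R f t) v \<and>
     has_bochner_integral_in (lebesgue_on I) X (\<lambda>t. \<phi> t *\<^sub>R g t) (- v))"

text \<open>The choice is among functions \<open>g\<close>, \<open>h\<close> with \<open>snorm X (g t - h t) = 0\<close> for a.e. \<open>t\<close> in \<open>I\<close>.\<close>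

definition weak_deriv ::
    "real set \<Rightarrow> 'v::real_vector seminormed \<Rightarrow> (real \<Rightarrow> 'v) \<Rightarrow> real \<Rightarrow> 'v" where
  "weak_deriv I X f = (SOME g. g \<in> vecs (bochner_L2 I X) \<and> has_weak_deriv I X f g)"

definition bochner_H1 ::
    "real set \<Rightarrow> 'v::real_vector seminormed \<Rightarrow> (real \<Rightarrow> 'v) seminormed" where
  "bochner_H1 I X =
     \<lparr> vecs = {f \<in> vecs (bochner_L2 I X). \<exists>g\<in>vecs (bochner_L2 I X). has_weak_deriv I X f g},
       snorm = (\<lambda>f. sqrt ((snorm (bochner_L2 I X) f)\<^sup>2 +
                          (snorm (bochner_L2 I X) (weak_deriv I X f))\<^sup>2)) \<rparr>"


section \<open>The equation with two time variables\<close>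

abbreviation H2_space :: "(real ^ 'n \<Rightarrow> real) seminormed" where
  "H2_space \<equiv> sobolev 2"

abbreviation H1_H2_space :: "(real \<Rightarrow> real ^ 'n \<Rightarrow> real) seminormed" where
  "H1_H2_space \<equiv> bochner_H1 {0<..} H2_space"

abbreviation H1_H1_H2_space :: "(real \<Rightarrow> real \<Rightarrow> real ^ 'n \<Rightarrow> real) seminormed" where
  "H1_H1_H2_space \<equiv> bochner_H1 UNIV H1_H2_space"

definition solves_equation :: "(real \<Rightarrow> real \<Rightarrow> real ^ 'n \<Rightarrow> real) \<Rightarrow> bool" where
  "solves_equation u \<longleftrightarrow>
     (AE t in lebesgue. AE \<tau> in lebesgue_on {0<..}. AE x in lebesgue.
        weak_deriv UNIV H1_H2_space u t \<tau> x + weak_deriv {0<..} H2_space (u t) \<tau> x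
          - weak_laplacian (u t \<tau>) x = 0)"

definition vanishes_on ::
    "(real \<Rightarrow> real \<Rightarrow> real ^ 'n \<Rightarrow> real) \<Rightarrow> (real \<times> real \<times> (real ^ 'n)) set \<Rightarrow> bool" where
  "vanishes_on u S \<longleftrightarrow>
     (AE t in lebesgue. AE \<tau> in lebesgue_on {0<..}. AE x in lebesgue.
        (t, \<tau>, x) \<in> S \<longrightarrow> u t \<tau> x = 0)"

end

(*
Along the characteristics (t + s, tau + s) a solution satisfies the heat equation in s, and a solution of
the heat equation that vanishes near x = 0 during a time interval vanishes identically in that interval.

Both steps are done on the integrals of u against products phi(t) psi(tau) w(x), which are trilinear and
bounded in the L2 norms of phi, psi and w; no joint measurability of u is needed. Let w_s be the backward
heat kernel (c - s)^(-n/2) exp(- |x - y|^2 / (4 (c - s))) with |y| < R1. The weak form of the equation says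
that the integral of u against phi(t - s) psi(tau - s) w_s(x) does not depend on s < c. As s tends to c the
kernel concentrates at y, near which u vanishes, so the integral is 0. At s = 0 this shows that
phi(t) psi(tau) exp(- a |x - y|^2) integrates to 0 against u for all large a and all |y| < R1. Products of
such Gaussian functions are again Gaussian functions of this kind, up to a constant, so by the
Stone-Weierstrass theorem they can be replaced by arbitrary test functions in x.
*)
theory Submission
  imports Defs "HOL-Real_Asymp.Real_Asymp" "HOL-Probability.Distributions"
begin

section \<open>Square integrable functions\<close>

text \<open>The values of \<open>u\<close> may be changed on null sets separately for each
  \<open>t\<close> and \<open>\<tau>\<close>, so \<open>u\<close> itself cannot be differentiated
  along a characteristic line. The shift is put on the test functions instead: their supports move
  forward by \<open>s\<close>, and the dependence on \<open>s\<close> is controlled by the trilinear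
  bound. Moving forward keeps the support in \<open>\<tau>\<close> away from 0, so no initial values
  enter, but it must not pass \<open>T\<close> or \<open>\<tau>hat\<close>. This limits
  \<open>c\<close>, which is why only large rates a = 1/(4c) are reached. The kernel is not
  compactly supported. On the rest |x - y| is at least d = R1 - |y|, and with q = 1/(c - s) that
  part has L2 norm at most a constant times q^(n/2) exp(- q d^2 / 8). For the density argument one
  admissible Gaussian is split off as a fixed weight. The other factors may then have any rate a >=
  0, including the constant 1, so they span an algebra with unit; and multiplication by the weight
  turns a uniform error on the whole space into an error in L2.\<close>

definition sq_int :: "'a measure \<Rightarrow> ('a \<Rightarrow> real) \<Rightarrow> bool" where
  "sq_int M f \<longleftrightarrow> f \<in> borel_measurable M \<and> integrable M (\<lambda>x. (f x)\<^sup>2)"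

definition sq_norm :: "'a measure \<Rightarrow> ('a \<Rightarrow> real) \<Rightarrow> real" where
  "sq_norm M f = sqrt (\<integral>x. (f x)\<^sup>2 \<partial>M)"

lemma L2_iff_sq_int: "f \<in> L2 \<longleftrightarrow> sq_int lebesgue f"
  by (simp add: L2_def sq_int_def)

lemma L2_norm_eq_sq_norm: "L2_norm f = sq_norm lebesgue f"
  by (simp add: L2_norm_def sq_norm_def)

lemma sq_intD:
  assumes "sq_int M f"
  shows "f \<in> borel_measurable M" "integrable M (\<lambda>x. (f x)\<^sup>2)"
  using assms by (auto simp: sq_int_def)

lemma sq_norm_nonneg [simp]: "0 \<le> sq_norm M f"
  by (simp add: sq_norm_def)

lemma sq_norm_power2: "(sq_norm M f)\<^sup>2 = (\<integral>x. (f x)\<^sup>2 \<partial>M)"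
  by (simp add: sq_norm_def)

lemma sq_int_zero [simp]: "sq_int M (\<lambda>x. 0)"
  by (simp add: sq_int_def)

lemma sq_int_mult_integrable:
  assumes "sq_int M f" "sq_int M g"
  shows "integrable M (\<lambda>x. f x * g x)"
proof (rule Bochner_Integration.integrable_bound)
  show "integrable M (\<lambda>x. (f x)\<^sup>2 + (g x)\<^sup>2)"
    using assms by (auto simp: sq_int_def)
  show "(\<lambda>x. f x * g x) \<in> borel_measurable M"
    using assms by (auto simp: sq_int_def)
  have "\<bar>a * b\<bar> \<le> a\<^sup>2 + b\<^sup>2" for a b :: real
  proof -
    have "2 * (\<bar>a\<bar> * \<bar>b\<bar>) \<le> a\<^sup>2 + b\<^sup>2"
      using sum_squares_bound[of "\<bar>a\<bar>" "\<bar>b\<bar>"] by (simp add: mult.assoc)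
    moreover have "0 \<le> \<bar>a\<bar> * \<bar>b\<bar>" by simp
    ultimately show ?thesis unfolding abs_mult by linarith
  qed
  then show "AE x in M. norm (f x * g x) \<le> norm ((f x)\<^sup>2 + (g x)\<^sup>2)"
    by (intro AE_I2) (simp add: abs_of_nonneg)
qed

lemma sq_int_bound:
  assumes f: "sq_int M f" and g: "g \<in> borel_measurable M" and le: "AE x in M. \<bar>g x\<bar> \<le> \<bar>f x\<bar>"
  shows "sq_int M g" "sq_norm M g \<le> sq_norm M f"
proof -
  have le': "AE x in M. (g x)\<^sup>2 \<le> (f x)\<^sup>2"
    using le by eventually_elim (simp add: abs_le_square_iff)
  have ig: "integrable M (\<lambda>x. (g x)\<^sup>2)"
    by (rule Bochner_Integration.integrable_bound[OF sq_intD(2)[OF f]]) (use g le' in auto)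
  then show "sq_int M g" using g by (simp add: sq_int_def)
  show "sq_norm M g \<le> sq_norm M f"
    unfolding sq_norm_def real_sqrt_le_iff
    by (rule integral_mono_AE[OF ig sq_intD(2)[OF f] le'])
qed

lemma sq_int_cmult:
  assumes "sq_int M f"
  shows "sq_int M (\<lambda>x. c * f x)" "sq_norm M (\<lambda>x. c * f x) = \<bar>c\<bar> * sq_norm M f"
  using assms by (auto simp: sq_int_def sq_norm_def power_mult_distrib real_sqrt_mult)

lemma sq_int_minus:
  assumes "sq_int M f"
  shows "sq_int M (\<lambda>x. - f x)" "sq_norm M (\<lambda>x. - f x) = sq_norm M f"
  using assms by (auto simp: sq_int_def sq_norm_def)

lemma sq_int_add:
  assumes "sq_int M f" "sq_int M g"
  shows "sq_int M (\<lambda>x. f x + g x)"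
  unfolding sq_int_def
proof
  show "(\<lambda>x. f x + g x) \<in> borel_measurable M" using assms by (auto simp: sq_int_def)
  have "integrable M (\<lambda>x. (f x)\<^sup>2 + (g x)\<^sup>2 + 2 * (f x * g x))"
    using assms sq_int_mult_integrable[OF assms] by (auto simp: sq_int_def)
  then show "integrable M (\<lambda>x. (f x + g x)\<^sup>2)"
    by (simp add: power2_sum mult.assoc)
qed

lemma sq_int_diff:
  assumes "sq_int M f" "sq_int M g"
  shows "sq_int M (\<lambda>x. f x - g x)"
  using sq_int_add[OF assms(1) sq_int_minus(1)[OF assms(2)]] by simp

lemma sq_int_sum:
  assumes "finite A" "\<And>i. i \<in> A \<Longrightarrow> sq_int M (f i)"
  shows "sq_int M (\<lambda>x. \<Sum>i\<in>A. f i x)"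
  using assms by (induction A rule: finite_induct) (auto intro: sq_int_add)

lemma sq_norm_cauchy_schwarz:
  assumes f: "sq_int M f" and g: "sq_int M g"
  shows "\<bar>\<integral>x. f x * g x \<partial>M\<bar> \<le> sq_norm M f * sq_norm M g"
proof -
  define A where "A = (\<integral>x. (f x)\<^sup>2 \<partial>M)"
  define B where "B = (\<integral>x. (g x)\<^sup>2 \<partial>M)"
  define C where "C = (\<integral>x. f x * g x \<partial>M)"
  have q: "0 \<le> A - 2 * r * C + r\<^sup>2 * B" for r
  proof -
    have "0 \<le> (\<integral>x. (f x - r * g x)\<^sup>2 \<partial>M)" by simp
    also have "\<dots> = (\<integral>x. (f x)\<^sup>2 - 2 * r * (f x * g x) + r\<^sup>2 * (g x)\<^sup>2 \<partial>M)"
      by (intro Bochner_Integration.integral_cong) (auto simp: power2_diff power_mult_distrib algebra_simps)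
    also have "\<dots> = A - 2 * r * C + r\<^sup>2 * B"
      using f g sq_int_mult_integrable[OF f g] by (simp add: A_def B_def C_def sq_int_def)
    finally show ?thesis .
  qed
  have B0: "0 \<le> B" and A0: "0 \<le> A" by (simp_all add: A_def B_def)
  have "C\<^sup>2 \<le> A * B"
  proof (cases "B = 0")
    case True
    have "C = 0"
    proof (rule ccontr)
      assume "C \<noteq> 0"
      \<comment> \<open>With \<open>B = 0\<close> the quadratic is affine in \<open>r\<close>, and
        this \<open>r\<close> gives it the value -1.\<close>
      then show False using q[of "(A + 1) / (2 * C)"] True by simp
    qed
    then show ?thesis using True by simp
  next
    case False
    \<comment> \<open>This \<open>r\<close> minimises the quadratic.\<close>
    then show ?thesis using q[of "C / B"] B0
      by (simp add: field_simps power2_eq_square)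
  qed
  then have "sqrt (C\<^sup>2) \<le> sqrt (A * B)" by (rule real_sqrt_le_mono)
  then show ?thesis by (simp add: real_sqrt_mult sq_norm_def A_def B_def C_def)
qed

lemma sq_norm_triangle:
  assumes f: "sq_int M f" and g: "sq_int M g"
  shows "sq_norm M (\<lambda>x. f x + g x) \<le> sq_norm M f + sq_norm M g"
proof (rule power2_le_imp_le)
  have "(sq_norm M (\<lambda>x. f x + g x))\<^sup>2 = (\<integral>x. (f x)\<^sup>2 + (g x)\<^sup>2 + 2 * (f x * g x) \<partial>M)"
    unfolding sq_norm_power2 by (simp add: power2_sum mult.assoc)
  also have "\<dots> = (sq_norm M f)\<^sup>2 + (sq_norm M g)\<^sup>2 + 2 * (\<integral>x. f x * g x \<partial>M)"
    unfolding sq_norm_power2 using f g sq_int_mult_integrable[OF f g] by (simp add: sq_int_def)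
  also have "\<dots> \<le> (sq_norm M f)\<^sup>2 + (sq_norm M g)\<^sup>2 + 2 * (sq_norm M f * sq_norm M g)"
    using sq_norm_cauchy_schwarz[OF f g] by linarith
  also have "\<dots> = (sq_norm M f + sq_norm M g)\<^sup>2" by (simp add: power2_sum)
  finally show "(sq_norm M (\<lambda>x. f x + g x))\<^sup>2 \<le> (sq_norm M f + sq_norm M g)\<^sup>2" .
qed simp

lemma sq_norm_cong_AE:
  assumes "AE x in M. f x = g x" "f \<in> borel_measurable M" "g \<in> borel_measurable M"
  shows "sq_norm M f = sq_norm M g"
  unfolding sq_norm_def by (intro arg_cong[of _ _ sqrt] integral_cong_AE) (use assms in auto)

section \<open>Functions determined almost everywhere by their integrals over boxes\<close>

lemma AE_if_AE_on_boxes: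
  assumes "\<And>k. AE x::'a::euclidean_space in lebesgue. x \<in> box (- (real k *\<^sub>R One)) (real k *\<^sub>R One) \<longrightarrow> P x"
  shows "AE x in lebesgue. P x"
proof -
  have "AE x::'a in lebesgue. \<forall>k. x \<in> box (- (real k *\<^sub>R One)) (real k *\<^sub>R One) \<longrightarrow> P x"
    unfolding AE_all_countable using assms by blast
  then show ?thesis
  proof eventually_elim
    case (elim x)
    have "x \<in> (\<Union>k::nat. box (- (real k *\<^sub>R One)) (real k *\<^sub>R One))"
      unfolding UN_box_eq_UNIV by simp
    then show ?case using elim by auto
  qed
qed

text \<open>Boxes are stable under intersection and generate the Borel sets, so two measures that
  agree and are finite on boxes are equal. The measures used here have the positive and the negative
  part of the function as densities; if these parts agree almost everywhere, both are 0.\<close>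

lemma AE_zero_if_box_integrals_zero:
  fixes F :: "'a::euclidean_space \<Rightarrow> real"
  assumes F: "integrable lebesgue F"
    and box: "\<And>l u. (\<integral>x. indicator (box l u) x * F x \<partial>lebesgue) = 0"
  shows "AE x in lebesgue. F x = 0"
proof -
  \<comment> \<open>\<open>F\<close> is only Lebesgue measurable, whereas a generator of the Borel
    sets says something about Borel functions only.\<close>
  obtain G where G: "G \<in> borel_measurable lborel" and FG: "AE x in lborel. F x = G x"
    using completion_ex_borel_measurable_real[OF borel_measurable_integrable[OF F]] by blast
  have FG': "AE x in lebesgue. F x = G x"
    using FG by (rule AE_completion)
  have "integrable lebesgue G"
    using integrable_cong_AE[OF borel_measurable_integrable[OF F] measurable_completion FG'] F G by blast
  then have iG: "integrable lborel G" using G by (simp add: integrable_completion)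
  have boxG: "(\<integral>x. indicator (box l u) x * G x \<partial>lborel) = 0" for l u
  proof -
    have "(\<integral>x. indicator (box l u) x * G x \<partial>lborel) = (\<integral>x. indicator (box l u) x * G x \<partial>lebesgue)"
      using G by (subst integral_completion) auto
    also have "\<dots> = (\<integral>x. indicator (box l u) x * F x \<partial>lebesgue)"
    proof (rule integral_cong_AE)
      have "G \<in> borel_measurable lebesgue" using G by (simp add: measurable_completion)
      then show "(\<lambda>x. indicator (box l u) x * G x) \<in> borel_measurable lebesgue"
        by (intro borel_measurable_times borel_measurable_indicator) auto
      show "(\<lambda>x. indicator (box l u) x * F x) \<in> borel_measurable lebesgue"
        using borel_measurable_integrable[OF F]
        by (intro borel_measurable_times borel_measurable_indicator) auto
      show "AE x in lebesgue. indicator (box l u) x * G x = indicator (box l u) x * F x"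
        using FG' by eventually_elim simp
    qed
    finally show ?thesis using box by simp
  qed
  \<comment> \<open>\<open>ennreal\<close> sends negative numbers to 0, so the densities of
    \<open>P\<close> and \<open>N\<close> are the positive and the negative part of
    \<open>G\<close>.\<close>
  define P where "P = density lborel (\<lambda>x. ennreal (G x))"
  define N where "N = density lborel (\<lambda>x. ennreal (- G x))"
  have fin: "(\<integral>\<^sup>+x. ennreal (H x) * indicator A x \<partial>lborel) < \<infinity>"
    if "integrable lborel H" for H :: "'a \<Rightarrow> real" and A
  proof -
    have "(\<integral>\<^sup>+x. ennreal (H x) * indicator A x \<partial>lborel) \<le> (\<integral>\<^sup>+x. ennreal (norm (H x)) \<partial>lborel)"
      by (intro nn_integral_mono) (auto simp: indicator_def intro: ennreal_leI)
    also have "\<dots> < \<infinity>" using that by (simp add: integrable_iff_bounded)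
    finally show ?thesis .
  qed
  have "P = N"
  proof (rule measure_eqI_generator_eq)
    let ?E = "range (\<lambda>(a, b). box a b::'a set)"
    show "Int_stable ?E" by (auto simp: Int_stable_def box_Int_box)
    show "?E \<subseteq> Pow UNIV" "sets P = sigma_sets UNIV ?E" "sets N = sigma_sets UNIV ?E"
      by (simp_all add: borel_eq_box P_def N_def)
    let ?A = "\<lambda>n::nat. box (- (real n *\<^sub>R One)) (real n *\<^sub>R One) :: 'a set"
    show "range ?A \<subseteq> ?E" "(\<Union>i. ?A i) = UNIV"
      unfolding UN_box_eq_UNIV by auto
    show "emeasure P (?A i) \<noteq> \<infinity>" for i
      using fin[OF iG, of "?A i"] G by (simp add: P_def emeasure_density)
    show "emeasure P X = emeasure N X" if XE: "X \<in> ?E" for X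
    proof -
      obtain l u where X: "X = box l u" using XE by auto
      define H where "H = (\<lambda>x. indicator X x * G x)"
      have iH: "integrable lborel H"
        unfolding H_def using integrable_mult_indicator[OF _ iG, of X] X by simp
      have eqP: "emeasure P X = (\<integral>\<^sup>+x. ennreal (H x) \<partial>lborel)"
        unfolding P_def H_def using G X
        by (subst emeasure_density) (auto intro!: nn_integral_cong simp: indicator_def)
      have eqN: "emeasure N X = (\<integral>\<^sup>+x. ennreal (- H x) \<partial>lborel)"
        unfolding N_def H_def using G X
        by (subst emeasure_density) (auto intro!: nn_integral_cong simp: indicator_def)
      have f1: "(\<integral>\<^sup>+x. ennreal (H x) \<partial>lborel) < \<infinity>" "(\<integral>\<^sup>+x. ennreal (- H x) \<partial>lborel) < \<infinity>"
        using fin[of H UNIV] fin[of "\<lambda>x. - H x" UNIV] iH by auto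
      have "enn2real (\<integral>\<^sup>+x. ennreal (H x) \<partial>lborel) - enn2real (\<integral>\<^sup>+x. ennreal (- H x) \<partial>lborel) = 0"
        using real_lebesgue_integral_def[OF iH] boxG[of l u] X by (simp add: H_def)
      then show ?thesis unfolding eqP eqN using f1
        by (metis ennreal_enn2real eq_iff_diff_eq_0 infinity_ennreal_def)
    qed
  qed
  then have "AE x in lborel. ennreal (G x) = ennreal (- G x)"
    unfolding P_def N_def using G
    by (intro sigma_finite_measure.density_unique[OF sigma_finite_lborel]) auto
  then have "AE x in lborel. G x = 0"
    by eventually_elim (smt (verit) ennreal_eq_0_iff ennreal_neg)
  then have "AE x in lebesgue. G x = 0" by (rule AE_completion)
  with FG' show ?thesis by eventually_elim simp
qed

section \<open>Smooth functions\<close>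

lemma Ck_continuous: "Ck k f \<Longrightarrow> continuous_on UNIV f"
  by (cases k) (auto simp: differentiable_on_def intro!: differentiable_imp_continuous_on differentiable_at_withinI)

lemma borel_imp_lebesgue_measurable:
  fixes f :: "'a::euclidean_space \<Rightarrow> real"
  shows "f \<in> borel_measurable borel \<Longrightarrow> f \<in> borel_measurable lebesgue"
  by (intro measurable_completion) simp

lemma Ck_measurable: "Ck k f \<Longrightarrow> f \<in> borel_measurable lebesgue"
  by (intro borel_imp_lebesgue_measurable borel_measurable_continuous_onI Ck_continuous)

lemma Ck_SucI:
  assumes "\<And>x. (f has_derivative f' x) (at x)" "\<And>b. b \<in> Basis \<Longrightarrow> Ck k (\<lambda>x. f' x b)"
  shows "Ck (Suc k) f"
proof -
  have "frechet_derivative f (at x) = f' x" for x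
    using frechet_derivative_at[OF assms(1)] by simp
  then show ?thesis using assms by (auto simp: differentiable_def)
qed

lemma Ck_Suc_imp_Ck: "Ck (Suc k) f \<Longrightarrow> Ck k f"
proof (induction k arbitrary: f)
  case 0
  then show ?case using Ck_continuous[of "Suc 0" f] by simp
next
  case (Suc k)
  have "Ck k (\<lambda>x. frechet_derivative f (at x) b)" if "b \<in> Basis" for b
    using Suc.prems that by (intro Suc.IH) simp
  then show ?case using Suc.prems by simp
qed

lemma frechet_derivative_eqI: "(f has_derivative f' ) (at x) \<Longrightarrow> frechet_derivative f (at x) = f'"
  using frechet_derivative_at by metis

lemma Ck_has_derivative: "Ck (Suc k) f \<Longrightarrow> (f has_derivative frechet_derivative f (at x)) (at x)"
  by (simp add: frechet_derivative_works)

lemma Ck_const [simp]: "Ck k (\<lambda>x. c)"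
proof (induction k arbitrary: c)
  case (Suc k)
  show ?case by (rule Ck_SucI[where f' = "\<lambda>x h. 0"]) (use Suc in auto)
qed simp

lemma Ck_bounded_linear:
  assumes "bounded_linear f"
  shows "Ck k f"
proof (cases k)
  case 0 then show ?thesis using assms by (simp add: linear_continuous_on)
next
  case (Suc j)
  have "Ck (Suc j) f"
    by (rule Ck_SucI[where f' = "\<lambda>x. f"]) (use assms in \<open>auto intro: bounded_linear_imp_has_derivative\<close>)
  then show ?thesis using Suc by simp
qed

lemma Ck_add: "Ck k f \<Longrightarrow> Ck k g \<Longrightarrow> Ck k (\<lambda>x. f x + g x)"
proof (induction k arbitrary: f g)
  case 0
  then show ?case by (auto intro: continuous_on_add)
next
  case (Suc k)
  show ?case
    by (rule Ck_SucI[where f' = "\<lambda>x h. frechet_derivative f (at x) h + frechet_derivative g (at x) h"])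
      (use Suc in \<open>auto intro!: has_derivative_add simp: frechet_derivative_works\<close>)
qed

lemma Ck_mult: "Ck k f \<Longrightarrow> Ck k g \<Longrightarrow> Ck k (\<lambda>x. f x * g x)"
proof (induction k arbitrary: f g)
  case 0
  then show ?case by (auto intro: continuous_on_mult)
next
  case (Suc k)
  show ?case
  proof (rule Ck_SucI)
    show "((\<lambda>x. f x * g x) has_derivative
        (\<lambda>h. f x * frechet_derivative g (at x) h + frechet_derivative f (at x) h * g x)) (at x)" for x
      using Suc.prems by (intro has_derivative_mult) (auto simp: frechet_derivative_works)
    show "Ck k (\<lambda>x. f x * frechet_derivative g (at x) b + frechet_derivative f (at x) b * g x)"
      if "b \<in> Basis" for b
      using Suc.prems Ck_Suc_imp_Ck that by (intro Ck_add Suc.IH) auto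
  qed
qed

lemma Ck_cmult: "Ck k f \<Longrightarrow> Ck k (\<lambda>x. c * f x)"
  by (intro Ck_mult Ck_const)

lemma Ck_minus: "Ck k f \<Longrightarrow> Ck k (\<lambda>x. - f x)"
  using Ck_cmult[of k f "-1"] by simp

lemma Ck_diff: "Ck k f \<Longrightarrow> Ck k g \<Longrightarrow> Ck k (\<lambda>x. f x - g x)"
  using Ck_add[of k f "\<lambda>x. - g x"] Ck_minus by auto

lemma Ck_sum: "(\<And>i. i \<in> A \<Longrightarrow> Ck k (f i)) \<Longrightarrow> Ck k (\<lambda>x. \<Sum>i\<in>A. f i x)"
  by (induction A rule: infinite_finite_induct) (auto intro: Ck_add simp del: Ck.simps)

lemma Ck_prod: "(\<And>i. i \<in> A \<Longrightarrow> Ck k (f i)) \<Longrightarrow> Ck k (\<lambda>x. \<Prod>i\<in>A. f i x)"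
  by (induction A rule: infinite_finite_induct) (auto intro: Ck_mult simp del: Ck.simps)

lemma Ck_compose:
  fixes g :: "real \<Rightarrow> real"
  shows "Ck k g \<Longrightarrow> Ck k f \<Longrightarrow> Ck k (\<lambda>x. g (f x))"
proof (induction k arbitrary: f g)
  case 0
  then show ?case by (auto intro: continuous_on_compose2)
next
  case (Suc k)
  show ?case
  proof (rule Ck_SucI)
    show "((\<lambda>x. g (f x)) has_derivative
        (\<lambda>h. frechet_derivative g (at (f x)) (frechet_derivative f (at x) h))) (at x)" for x
      by (rule has_derivative_compose[OF Ck_has_derivative[OF Suc.prems(2)] Ck_has_derivative[OF Suc.prems(1)]])
    fix b :: 'a assume b: "b \<in> Basis"
    \<comment> \<open>A linear map on the reals is multiplication by its value at 1. This turns the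
      chain rule into a product, to which \<open>Ck_mult\<close> and the induction hypothesis
      apply.\<close>
    have lin: "frechet_derivative g (at y) t = frechet_derivative g (at y) 1 * t" for y t
    proof -
      have "bounded_linear (frechet_derivative g (at y))"
        using Suc.prems by (intro has_derivative_bounded_linear) (auto simp: frechet_derivative_works)
      from linear_cmul[OF bounded_linear.linear[OF this], of t 1] show ?thesis by (simp add: mult.commute)
    qed
    have "Ck k (\<lambda>x. frechet_derivative g (at (f x)) 1 * frechet_derivative f (at x) b)"
    proof (rule Ck_mult)
      show "Ck k (\<lambda>x. frechet_derivative g (at (f x)) 1)"
        using Suc.IH[of "\<lambda>y. frechet_derivative g (at y) 1" f] Suc.prems Ck_Suc_imp_Ck[of k f] by auto
      show "Ck k (\<lambda>x. frechet_derivative f (at x) b)" using Suc.prems b by simp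
    qed
    moreover have "(\<lambda>x. frechet_derivative g (at (f x)) (frechet_derivative f (at x) b)) =
       (\<lambda>x. frechet_derivative g (at (f x)) 1 * frechet_derivative f (at x) b)"
      by (rule ext, rule lin)
    ultimately show "Ck k (\<lambda>x. frechet_derivative g (at (f x)) (frechet_derivative f (at x) b))"
      by (simp only:)
  qed
qed

lemma Ck_Suc_realI:
  fixes f :: "real \<Rightarrow> real"
  assumes "\<And>x. (f has_real_derivative f' x) (at x)" "Ck k f'"
  shows "Ck (Suc k) f"
  by (rule Ck_SucI[where f' = "\<lambda>x h. f' x * h"])
    (use assms in \<open>auto simp: has_field_derivative_def\<close>)

lemma Ck_real_deriv:
  fixes f :: "real \<Rightarrow> real"
  assumes "Ck (Suc k) f"
  shows "(f has_real_derivative deriv f x) (at x)" "Ck k (deriv f)"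
    "frechet_derivative f (at x) 1 = deriv f x"
proof -
  have d: "(f has_real_derivative deriv f x) (at x)" for x
    using assms DERIV_deriv_iff_real_differentiable[of f x] by simp
  then show "(f has_real_derivative deriv f x) (at x)" by simp
  have "frechet_derivative f (at x) = (\<lambda>h. deriv f x * h)" for x
    using d[of x] unfolding has_field_derivative_def by (rule frechet_derivative_eqI)
  then have "(\<lambda>x. frechet_derivative f (at x) 1) = deriv f" "frechet_derivative f (at x) 1 = deriv f x" by auto
  then show "Ck k (deriv f)" "frechet_derivative f (at x) 1 = deriv f x" using assms by auto
qed

lemma Ck_exp: "Ck k (exp :: real \<Rightarrow> real)"
proof (induction k)
  case 0 show ?case by (simp add: continuous_on_exp)
next
  case (Suc k) then show ?case by (intro Ck_Suc_realI[where f' = exp]) auto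
qed

section \<open>Smooth bump functions on boxes and their convergence to indicators\<close>

definition bump_profile :: "nat \<Rightarrow> real \<Rightarrow> real" where
  "bump_profile m x = (if x > 0 then exp (- 1 / x) / x ^ m else 0)"

lemma bump_profile_tendsto_0: "(bump_profile m \<longlongrightarrow> 0) (at 0)"
proof -
  have "((\<lambda>x. exp (- 1 / x) / x ^ m) \<longlongrightarrow> 0) (at_right (0::real))"
    by real_asymp
  then have "(bump_profile m \<longlongrightarrow> 0) (at_right 0)"
    by (rule Lim_transform_eventually) (auto simp: bump_profile_def eventually_at_right_field intro: exI[of _ 1])
  moreover have "(bump_profile m \<longlongrightarrow> 0) (at_left 0)"
    by (rule Lim_transform_eventually[OF tendsto_const])
      (auto simp: bump_profile_def eventually_at_left_field intro: exI[of _ "-1"])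
  ultimately show ?thesis by (simp add: filterlim_at_split)
qed

text \<open>This is why the family carries the power \<open>m\<close>: its derivatives are again
  linear combinations of its members, so smoothness of every order follows by induction for all
  \<open>m\<close> at once.\<close>

lemma bump_profile_has_derivative:
  "(bump_profile m has_real_derivative bump_profile (m + 2) x - real m * bump_profile (m + 1) x) (at x)"
proof -
  consider "x > 0" | "x = 0" | "x < 0" by linarith
  then show ?thesis
  proof cases
    case 1
    have "((\<lambda>x. exp (- 1 / x) / x ^ m) has_real_derivative
        (exp (- 1 / x) * (1 / x\<^sup>2) * x ^ m - exp (- 1 / x) * (real m * x ^ (m - 1))) / (x ^ m)\<^sup>2) (at x)"
      using 1 by (auto intro!: derivative_eq_intros simp: power2_eq_square)
    also have "(exp (- 1 / x) * (1 / x\<^sup>2) * x ^ m - exp (- 1 / x) * (real m * x ^ (m - 1))) / (x ^ m)\<^sup>2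
       = bump_profile (m + 2) x - real m * bump_profile (m + 1) x"
      using 1 by (cases m) (auto simp: bump_profile_def field_simps power2_eq_square)
    finally show ?thesis
      by (rule has_field_derivative_transform_within_open[where S = "{0<..}"])
        (use 1 in \<open>auto simp: bump_profile_def\<close>)
  next
    case 2
    \<comment> \<open>The difference quotient of \<open>bump_profile m\<close> at 0 is
      \<open>bump_profile (m + 1)\<close>, which tends to 0.\<close>
    have "((\<lambda>y. (bump_profile m y - bump_profile m 0) / (y - 0)) \<longlongrightarrow> 0) (at 0)"
      by (rule Lim_transform_eventually[OF bump_profile_tendsto_0[of "m + 1"]])
        (auto simp: bump_profile_def eventually_at_filter)
    then show ?thesis using 2 by (simp add: has_field_derivative_iff bump_profile_def)
  next
    case 3
    have "((\<lambda>x. 0) has_real_derivative 0) (at x)" by simp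
    moreover have "bump_profile (m + 2) x - real m * bump_profile (m + 1) x = 0"
      using 3 by (simp add: bump_profile_def)
    ultimately show ?thesis
      by (metis (mono_tags, lifting) 3 has_field_derivative_transform_within_open[where S = "{..<0}"]
         open_lessThan lessThan_iff bump_profile_def not_less_iff_gr_or_eq)
  qed
qed

lemma Ck_bump_profile: "Ck k (bump_profile m)"
proof (induction k arbitrary: m)
  case 0
  have "continuous (at x) (bump_profile m)" for x
    using bump_profile_has_derivative DERIV_isCont by blast
  then show ?case by (simp add: continuous_at_imp_continuous_on)
next
  case (Suc k)
  show ?case
    by (rule Ck_Suc_realI[OF bump_profile_has_derivative]) (intro Ck_diff Ck_cmult Suc)
qed

text \<open>The factor \<open>Suc m\<close> steepens the edges, so that for fixed corners the bumps
  increase to the indicator of the open box as \<open>m\<close> grows, while the set where they are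
  positive stays the same.\<close>

definition bump :: "nat \<Rightarrow> 'a \<Rightarrow> 'a \<Rightarrow> 'a::euclidean_space \<Rightarrow> real" where
  "bump m l u x = (\<Prod>b\<in>Basis. bump_profile 0 (real (Suc m) * (x \<bullet> b - l \<bullet> b)) *
                               bump_profile 0 (real (Suc m) * (u \<bullet> b - x \<bullet> b)))"

lemma bump_profile_bounds: "0 \<le> bump_profile 0 x" "bump_profile 0 x \<le> 1"
  by (auto simp: bump_profile_def)

lemma bump_nonneg: "0 \<le> bump m l u x"
  unfolding bump_def by (intro prod_nonneg mult_nonneg_nonneg bump_profile_bounds ballI)

lemma bump_le_1: "bump m l u x \<le> 1"
  unfolding bump_def by (intro prod_le_1 conjI mult_nonneg_nonneg mult_le_one bump_profile_bounds)

lemma bump_pos_iff: "0 < bump m l u x \<longleftrightarrow> x \<in> box l u"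
proof -
  have "bump_profile 0 y = 0 \<longleftrightarrow> y \<le> 0" for y by (auto simp: bump_profile_def)
  then have "bump m l u x = 0 \<longleftrightarrow> x \<notin> box l u"
    unfolding bump_def by (auto simp: prod_zero_iff mem_box mult_le_0_iff not_less)
  then show ?thesis using bump_nonneg[of m l u x] by linarith
qed

lemma bump_eq_0_iff: "bump m l u x = 0 \<longleftrightarrow> x \<notin> box l u"
  using bump_pos_iff[of m l u x] bump_nonneg[of m l u x] by linarith

lemma Ck_bump: "Ck k (bump m l u)"
proof -
  have "Ck k (\<lambda>x::'a. bump_profile 0 (real (Suc m) * (x \<bullet> b - c)))"
    "Ck k (\<lambda>x::'a. bump_profile 0 (real (Suc m) * (c - x \<bullet> b)))" for b :: 'a and c
    by (intro Ck_compose[OF Ck_bump_profile] Ck_cmult Ck_diff Ck_const Ck_bounded_linear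
        bounded_linear_inner_left)+
  then show ?thesis unfolding bump_def[abs_def] by (intro Ck_prod Ck_mult)
qed

lemma test_functionsI:
  assumes "\<And>k. Ck k \<phi>" "\<And>x. x \<notin> cbox l u \<Longrightarrow> \<phi> x = 0" "cbox l u \<subseteq> \<Omega>"
  shows "\<phi> \<in> test_functions \<Omega>"
proof -
  have sub: "{x. \<phi> x \<noteq> 0} \<subseteq> cbox l u" using assms(2) by auto
  then have c: "closure {x. \<phi> x \<noteq> 0} \<subseteq> cbox l u" by (rule closure_minimal) (rule closed_cbox)
  moreover have "compact (closure {x. \<phi> x \<noteq> 0})"
    using bounded_subset[OF bounded_cbox sub] by (simp add: compact_closure)
  ultimately show ?thesis using assms unfolding test_functions_def by blast
qed

lemma bump_test_function: "cbox l u \<subseteq> \<Omega> \<Longrightarrow> bump m l u \<in> test_functions \<Omega>"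
  by (rule test_functionsI[of _ l u]) (auto simp: Ck_bump bump_eq_0_iff dest: subsetD[OF box_subset_cbox])

text \<open>The small open boxes at the two corners of \<open>box l u\<close> are nonempty and hence
  meet the dense set. For small \<open>k\<close> the box between \<open>L k\<close> and
  \<open>U k\<close> may be empty; the bump on it is then 0, which does no harm in the
  limit.\<close>

lemma box_subset_interior_sequence:
  fixes D :: "'a::euclidean_space set"
  assumes D: "closure D = UNIV" and ne: "box l u \<noteq> {}"
  obtains L U where "\<And>k. L k \<in> D" "\<And>k. U k \<in> D" "L \<longlonglongrightarrow> l" "U \<longlonglongrightarrow> u"
    "\<And>k b. b \<in> Basis \<Longrightarrow> l \<bullet> b < L k \<bullet> b" "\<And>k b. b \<in> Basis \<Longrightarrow> U k \<bullet> b < u \<bullet> b"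
proof -
  have lu: "l \<bullet> b < u \<bullet> b" if "b \<in> Basis" for b using ne that by (auto simp: box_ne_empty)
  have meet: "\<exists>x\<in>D. x \<in> box p q" if "box p q \<noteq> {}" for p q :: 'a
    using that D open_Int_closure_eq_empty[OF open_box, of p q D] by auto
  define e where "e k = (1 / real (Suc k)) *\<^sub>R (One::'a)" for k
  have eb: "e k \<bullet> b = 1 / real (Suc k)" if "b \<in> Basis" for k b
    using that by (simp add: e_def)
  have ne1: "box l (l + e k) \<noteq> {}" and ne2: "box (u - e k) u \<noteq> {}" for k
    by (auto simp: box_ne_empty inner_add_left inner_diff_left eb)
  obtain L where L: "\<And>k. L k \<in> D" "\<And>k. L k \<in> box l (l + e k)" using meet[OF ne1] by metis
  obtain U where U: "\<And>k. U k \<in> D" "\<And>k. U k \<in> box (u - e k) u" using meet[OF ne2] by metis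
  have lim: "(\<lambda>k. 1 / real (Suc k)) \<longlonglongrightarrow> 0" by real_asymp
  have "(\<lambda>k. L k \<bullet> b) \<longlonglongrightarrow> l \<bullet> b" if "b \<in> Basis" for b
  proof (rule tendsto_sandwich)
    show "\<forall>\<^sub>F k in sequentially. l \<bullet> b \<le> L k \<bullet> b" "\<forall>\<^sub>F k in sequentially. L k \<bullet> b \<le> l \<bullet> b + 1 / real (Suc k)"
      using L(2) that by (auto simp: mem_box inner_add_left eb less_imp_le intro!: always_eventually)
    show "(\<lambda>k. l \<bullet> b + 1 / real (Suc k)) \<longlonglongrightarrow> l \<bullet> b" using tendsto_add[OF tendsto_const lim] by simp
  qed simp
  moreover have "(\<lambda>k. U k \<bullet> b) \<longlonglongrightarrow> u \<bullet> b" if "b \<in> Basis" for b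
  proof (rule tendsto_sandwich)
    show "\<forall>\<^sub>F k in sequentially. U k \<bullet> b \<le> u \<bullet> b" "\<forall>\<^sub>F k in sequentially. u \<bullet> b - 1 / real (Suc k) \<le> U k \<bullet> b"
      using U(2) that by (auto simp: mem_box inner_diff_left eb less_imp_le intro!: always_eventually)
    show "(\<lambda>k. u \<bullet> b - 1 / real (Suc k)) \<longlonglongrightarrow> u \<bullet> b" using tendsto_diff[OF tendsto_const lim] by simp
  qed simp
  ultimately have "L \<longlonglongrightarrow> l" "U \<longlonglongrightarrow> u" unfolding tendsto_componentwise_iff[of L] tendsto_componentwise_iff[of U] by blast+
  then show ?thesis by (rule that[OF L(1) U(1)]) (use L(2) U(2) in \<open>auto simp: mem_box\<close>)
qed

text \<open>The edges are steepened while the corners move. At an interior point of the limit box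
  the distances to the faces have positive limits, so after multiplication by \<open>Suc k\<close>
  they tend to infinity, where the profile tends to 1.\<close>

lemma bump_tendsto_1:
  assumes x: "x \<in> box l u" and L: "L \<longlonglongrightarrow> l" and U: "U \<longlonglongrightarrow> u"
  shows "(\<lambda>k. bump k (L k) (U k) x) \<longlonglongrightarrow> 1"
proof -
  have prof: "(\<lambda>k. bump_profile 0 (real (Suc k) * a k)) \<longlonglongrightarrow> 1" if a: "a \<longlonglongrightarrow> c" "0 < c" for a c
  proof -
    have "filterlim (\<lambda>k. real (Suc k)) at_top sequentially" by real_asymp
    then have "filterlim (\<lambda>k. a k * real (Suc k)) at_top sequentially"
      by (rule filterlim_tendsto_pos_mult_at_top[OF a])
    then have top: "filterlim (\<lambda>k. real (Suc k) * a k) at_top sequentially" by (simp add: mult.commute)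
    have "((\<lambda>y::real. exp (- 1 / y)) \<longlongrightarrow> 1) at_top" by real_asymp
    from filterlim_compose[OF this top]
    have "(\<lambda>k. exp (- 1 / (real (Suc k) * a k))) \<longlonglongrightarrow> 1" .
    moreover have "\<forall>\<^sub>F k in sequentially. exp (- 1 / (real (Suc k) * a k)) = bump_profile 0 (real (Suc k) * a k)"
      using filterlim_at_top_dense[THEN iffD1, OF top, rule_format, of 0]
      by eventually_elim (simp add: bump_profile_def)
    ultimately show ?thesis by (rule Lim_transform_eventually)
  qed
  have "(\<lambda>k. \<Prod>b\<in>Basis. bump_profile 0 (real (Suc k) * (x \<bullet> b - L k \<bullet> b)) *
           bump_profile 0 (real (Suc k) * (U k \<bullet> b - x \<bullet> b))) \<longlonglongrightarrow> (\<Prod>b\<in>(Basis::'a set). 1 * 1)"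
  proof (intro tendsto_prod tendsto_mult)
    fix b :: 'a assume b: "b \<in> Basis"
    show "(\<lambda>k. bump_profile 0 (real (Suc k) * (x \<bullet> b - L k \<bullet> b))) \<longlonglongrightarrow> 1"
      by (rule prof[of _ "x \<bullet> b - l \<bullet> b"]) (use x b L in \<open>auto intro!: tendsto_intros simp: mem_box\<close>)
    show "(\<lambda>k. bump_profile 0 (real (Suc k) * (U k \<bullet> b - x \<bullet> b))) \<longlonglongrightarrow> 1"
      by (rule prof[of _ "u \<bullet> b - x \<bullet> b"]) (use x b U in \<open>auto intro!: tendsto_intros simp: mem_box\<close>)
  qed
  then show ?thesis by (simp add: bump_def)
qed

lemma bump_measurable: "bump m l u \<in> borel_measurable lebesgue"
  by (rule Ck_measurable[OF Ck_bump])

lemma sq_int_indicator_box: "sq_int lebesgue (indicator (box l u) :: 'a::euclidean_space \<Rightarrow> real)"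
proof -
  have "integrable lebesgue (indicator (box l u) :: 'a \<Rightarrow> real)"
    using lmeasurable_box[of l u] by (simp add: fmeasurable_def integrable_indicator_iff)
  then show ?thesis
    unfolding sq_int_def power2_eq_square indicator_inter_arith[symmetric]
    by (auto intro: borel_measurable_indicator)
qed

lemma sq_int_bump: "sq_int lebesgue (bump m l u)"
proof (rule sq_int_bound(1)[OF sq_int_indicator_box[of l u] bump_measurable])
  show "AE x in lebesgue. \<bar>bump m l u x\<bar> \<le> \<bar>indicator (box l u) x\<bar>"
    by (intro AE_I2) (use bump_le_1[of m l u] bump_nonneg[of m l u] in
      \<open>auto simp: indicator_def bump_eq_0_iff[THEN iffD2]\<close>)
qed

text \<open>The bumps with corners in a countable dense set suffice, which allows one exceptional null set
  for all of them.\<close>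

lemma AE_zero_if_bump_integrals_zero:
  fixes f :: "'a::euclidean_space \<Rightarrow> real"
  assumes f: "sq_int lebesgue f" and D: "closure D = UNIV"
    and zero: "\<And>m l u. l \<in> D \<Longrightarrow> u \<in> D \<Longrightarrow> cbox l u \<subseteq> box p q \<Longrightarrow> (\<integral>x. f x * bump m l u x \<partial>lebesgue) = 0"
  shows "AE x in lebesgue. x \<in> box p q \<longrightarrow> f x = 0"
proof -
  have int: "integrable lebesgue (\<lambda>x. f x * indicator (box l u) x)" for l u
    by (rule sq_int_mult_integrable[OF f sq_int_indicator_box])
  have box0: "(\<integral>x. f x * indicator (box l u) x \<partial>lebesgue) = 0" if sub: "box l u \<subseteq> box p q" for l u
  proof (cases "box l u = {}")
    case False
    obtain L U where LU: "\<And>k. L k \<in> D" "\<And>k. U k \<in> D" "L \<longlonglongrightarrow> l" "U \<longlonglongrightarrow> u"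
      "\<And>k b. b \<in> Basis \<Longrightarrow> l \<bullet> b < L k \<bullet> b" "\<And>k b. b \<in> Basis \<Longrightarrow> U k \<bullet> b < u \<bullet> b"
      using box_subset_interior_sequence[OF D False] by blast
    have inb: "cbox (L k) (U k) \<subseteq> box l u" for k
    proof
      fix x assume "x \<in> cbox (L k) (U k)"
      then show "x \<in> box l u" unfolding mem_box using LU(5,6) by (meson le_less_trans less_le_trans)
    qed
    have "(\<lambda>k. \<integral>x. f x * bump k (L k) (U k) x \<partial>lebesgue) \<longlonglongrightarrow> (\<integral>x. f x * indicator (box l u) x \<partial>lebesgue)"
    proof (rule integral_dominated_convergence)
      show "integrable lebesgue (\<lambda>x. \<bar>f x * indicator (box l u) x\<bar>)" using int by simp
      show "AE x in lebesgue. (\<lambda>k. f x * bump k (L k) (U k) x) \<longlonglongrightarrow> f x * indicator (box l u) x"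
      proof (rule AE_I2, rule tendsto_mult[OF tendsto_const])
        fix x
        show "(\<lambda>k. bump k (L k) (U k) x) \<longlonglongrightarrow> indicator (box l u) x"
        proof (cases "x \<in> box l u")
          case True then show ?thesis using bump_tendsto_1[OF True LU(3,4)] by simp
        next
          case False
          then have "bump k (L k) (U k) x = 0" for k
            using inb box_subset_cbox by (fastforce simp: bump_eq_0_iff)
          then show ?thesis using False by simp
        qed
      qed
      show "AE x in lebesgue. norm (f x * bump k (L k) (U k) x) \<le> \<bar>f x * indicator (box l u) x\<bar>" for k
      proof (rule AE_I2)
        fix x
        have "bump k (L k) (U k) x \<le> indicator (box l u) x"
          using bump_le_1[of k "L k" "U k" x] inb[of k] box_subset_cbox[of "L k" "U k"]
            bump_eq_0_iff[of k "L k" "U k" x] by (auto simp: indicator_def)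
        then show "norm (f x * bump k (L k) (U k) x) \<le> \<bar>f x * indicator (box l u) x\<bar>"
          using bump_nonneg[of k "L k" "U k" x] by (simp add: abs_mult mult_left_mono)
      qed
    next
      show "(\<lambda>x. f x * bump k (L k) (U k) x) \<in> borel_measurable lebesgue" for k
        by (intro borel_measurable_times bump_measurable sq_intD(1)[OF f])
    qed (rule borel_measurable_integrable[OF int])
    moreover have "(\<integral>x. f x * bump k (L k) (U k) x \<partial>lebesgue) = 0" for k
      by (rule zero[OF LU(1,2)]) (use inb[of k] sub in order)
    ultimately show ?thesis by (simp add: LIMSEQ_const_iff)
  qed auto
  have "AE x in lebesgue. f x * indicator (box p q) x = 0"
  proof (rule AE_zero_if_box_integrals_zero[OF int])
    fix l u
    \<comment> \<open>Only boxes inside \<open>box p q\<close> are covered so far. For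
      \<open>f\<close> cut off to \<open>box p q\<close> an arbitrary box can be replaced by its
      intersection with \<open>box p q\<close>, which is again a box.\<close>
    obtain c d where cd: "box l u \<inter> box p q = box c d" using box_Int_box by blast
    have "(\<integral>x. indicator (box l u) x * (f x * indicator (box p q) x) \<partial>lebesgue)
        = (\<integral>x. f x * indicator (box c d) x \<partial>lebesgue)"
      unfolding cd[symmetric] by (intro Bochner_Integration.integral_cong) (auto simp: indicator_def)
    then show "(\<integral>x. indicator (box l u) x * (f x * indicator (box p q) x) \<partial>lebesgue) = 0"
      using box0[of c d] cd by (metis inf_le2)
  qed
  then show ?thesis by eventually_elim (auto simp: indicator_def split: if_splits)
qed

section \<open>Sobolev spaces\<close>

lemma bounded_if_continuous_compact_support:
  fixes f :: "'a::euclidean_space \<Rightarrow> real"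
  assumes c: "continuous_on UNIV f" and z: "\<And>x. x \<notin> cbox l u \<Longrightarrow> f x = 0"
  obtains M where "0 \<le> M" "\<And>x. \<bar>f x\<bar> \<le> M"
proof -
  have "bounded (f ` cbox l u)"
    by (intro compact_imp_bounded compact_continuous_image continuous_on_subset[OF c]) auto
  then obtain B where B: "\<And>x. x \<in> cbox l u \<Longrightarrow> \<bar>f x\<bar> \<le> B"
    by (auto simp: bounded_iff)
  have "\<bar>f x\<bar> \<le> max B 0" for x
    using B[of x] z[of x] by (cases "x \<in> cbox l u") auto
  then show ?thesis using that[of "max B 0"] by auto
qed

lemma sq_int_continuous_compact_support:
  fixes h :: "'a::euclidean_space \<Rightarrow> real"
  assumes h: "continuous_on UNIV h" "\<And>x. x \<notin> cbox l u \<Longrightarrow> h x = 0"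
  shows "sq_int lebesgue h"
proof -
  obtain M where M: "0 \<le> M" "\<And>x. \<bar>h x\<bar> \<le> M" using bounded_if_continuous_compact_support[OF h] by blast
  have "sq_int lebesgue (indicator (cbox l u) :: 'a \<Rightarrow> real)"
  proof -
    have "integrable lebesgue (indicator (cbox l u) :: 'a \<Rightarrow> real)"
      using lmeasurable_cbox[of l u] by (simp add: fmeasurable_def integrable_indicator_iff)
    then show ?thesis
      unfolding sq_int_def power2_eq_square indicator_inter_arith[symmetric]
      by (auto intro: borel_measurable_indicator)
  qed
  from sq_int_cmult(1)[OF this, of M] show ?thesis
  proof (rule sq_int_bound(1))
    show "h \<in> borel_measurable lebesgue" using h(1)
      by (intro borel_imp_lebesgue_measurable borel_measurable_continuous_onI)
    show "AE x in lebesgue. \<bar>h x\<bar> \<le> \<bar>M * indicator (cbox l u) x\<bar>"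
      using M h(2) by (intro AE_I2) (auto simp: indicator_def)
  qed
qed

lemma frechet_derivative_zero_outside:
  fixes f :: "'a::euclidean_space \<Rightarrow> real"
  assumes "\<And>x. x \<notin> cbox l u \<Longrightarrow> f x = 0" and x: "x \<notin> cbox l u"
  shows "frechet_derivative f (at x) = (\<lambda>h. 0)"
proof (rule frechet_derivative_eqI, rule has_derivative_transform_within_open)
  show "((\<lambda>x. 0) has_derivative (\<lambda>h. 0)) (at x)" by simp
  show "open (- cbox l u)" by (rule open_Compl[OF closed_cbox])
qed (use assms in auto)

lemma Ck_scaleR:
  fixes f :: "'a::euclidean_space \<Rightarrow> real"
  shows "Ck k f \<Longrightarrow> Ck k (\<lambda>x. f (c *\<^sub>R x))"
proof (induction k arbitrary: f)
  case 0
  then show ?case by (auto intro!: continuous_intros intro: continuous_on_compose2)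
next
  case (Suc k)
  show ?case
  proof (rule Ck_SucI)
    show "((\<lambda>x. f (c *\<^sub>R x)) has_derivative (\<lambda>h. frechet_derivative f (at (c *\<^sub>R x)) (c *\<^sub>R h))) (at x)" for x
      by (rule has_derivative_compose[OF _ Ck_has_derivative[OF Suc.prems]]) (auto intro!: derivative_eq_intros)
    fix b :: 'a assume b: "b \<in> Basis"
    have "frechet_derivative f (at y) (c *\<^sub>R b) = c * frechet_derivative f (at y) b" for y
      using linear_cmul[OF has_derivative_linear[OF Ck_has_derivative[OF Suc.prems, of y]], of c b] by simp
    moreover have "Ck k (\<lambda>x. c * frechet_derivative f (at (c *\<^sub>R x)) b)"
      using Suc.prems b by (intro Ck_cmult Suc.IH) simp
    ultimately show "Ck k (\<lambda>x. frechet_derivative f (at (c *\<^sub>R x)) (c *\<^sub>R b))" by simp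
  qed
qed

text \<open>The definition of a weak derivative tests only with compactly supported functions, but
  the Gaussian functions used later have full support. The test function is multiplied by a cutoff
  that is dilated to the whole space, and the limit is taken by dominated convergence; the majorants
  are products of square integrable functions.\<close>

lemma weak_partial_by_parts:
  fixes f :: "'a::euclidean_space \<Rightarrow> real"
  assumes wp: "has_weak_partial b f g" and b: "b \<in> Basis"
    and f: "sq_int lebesgue f" and g: "sq_int lebesgue g"
    and w: "\<And>k. Ck k w" "sq_int lebesgue w" "sq_int lebesgue (\<lambda>x. frechet_derivative w (at x) b)"
  shows "(\<integral>x. f x * frechet_derivative w (at x) b \<partial>lebesgue) = - (\<integral>x. g x * w x \<partial>lebesgue)"
proof -
  define \<beta> where "\<beta> = bump 0 (- One) (One :: 'a)"
  \<comment> \<open>Dividing by the value at 0 makes the dilated cutoffs tend to 1 at every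
    point.\<close>
  define \<eta> where "\<eta> x = \<beta> x / \<beta> 0" for x
  define \<eta>' where "\<eta>' x = frechet_derivative \<eta> (at x) b" for x
  have \<beta>0: "\<beta> 0 > 0" unfolding \<beta>_def bump_pos_iff by (simp add: mem_box)
  have \<eta>: "Ck k \<eta>" for k
    using Ck_cmult[OF Ck_bump[of k 0 "- One" "One :: 'a"], of "1 / \<beta> 0"]
    unfolding \<eta>_def[abs_def] \<beta>_def by simp
  have \<eta>0: "\<eta> 0 = 1" using \<beta>0 by (simp add: \<eta>_def)
  have z: "\<eta> x = 0" if "x \<notin> cbox (- One) One" for x
    using that box_subset_cbox[of "- One" "One :: 'a"] bump_eq_0_iff[of 0 "- One" One x]
    by (auto simp: \<eta>_def \<beta>_def)
  have z': "\<eta>' x = 0" if "x \<notin> cbox (- One) One" for x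
    unfolding \<eta>'_def using frechet_derivative_zero_outside[OF z that] by simp
  have c': "continuous_on UNIV \<eta>'"
    using \<eta>[of "Suc 0"] b unfolding \<eta>'_def[abs_def] by simp
  obtain M where M: "0 \<le> M" "\<And>x. \<bar>\<eta> x\<bar> \<le> M"
    using bounded_if_continuous_compact_support[OF Ck_continuous[OF \<eta>] z] by blast
  obtain M' where M': "0 \<le> M'" "\<And>x. \<bar>\<eta>' x\<bar> \<le> M'"
    using bounded_if_continuous_compact_support[OF c' z'] by blast
  define r where "r k = 1 / real (Suc k)" for k
  have r0: "r \<longlonglongrightarrow> 0" unfolding r_def[abs_def] by real_asymp
  have r1: "0 < r k" "r k \<le> 1" for k by (auto simp: r_def)
  define w' where "w' x = frechet_derivative w (at x) b" for x
  \<comment> \<open>A derivative that falls on the dilated cutoff brings out a factor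
    \<open>r k\<close>, which removes that term in the limit.\<close>
  have der: "frechet_derivative (\<lambda>x. w x * \<eta> (r k *\<^sub>R x)) (at x) b =
      w' x * \<eta> (r k *\<^sub>R x) + r k * (w x * \<eta>' (r k *\<^sub>R x))" for k x
  proof -
    have d1: "((\<lambda>x. \<eta> (r k *\<^sub>R x)) has_derivative (\<lambda>h. frechet_derivative \<eta> (at (r k *\<^sub>R x)) (r k *\<^sub>R h))) (at x)"
      by (rule has_derivative_compose[OF _ Ck_has_derivative[OF \<eta>[of "Suc 0"]]]) (auto intro!: derivative_eq_intros)
    have lin: "frechet_derivative \<eta> (at y) (c *\<^sub>R b) = c * frechet_derivative \<eta> (at y) b" for y c
      using linear_cmul[OF has_derivative_linear[OF Ck_has_derivative[OF \<eta>[of "Suc 0"], of y]], of c b] by simp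
    show ?thesis
      by (subst frechet_derivative_eqI[OF has_derivative_mult[OF Ck_has_derivative[OF w(1)[of "Suc 0"]] d1]])
        (simp add: lin w'_def \<eta>'_def algebra_simps)
  qed
  have mw: "w \<in> borel_measurable lebesgue" "w' \<in> borel_measurable lebesgue"
    using sq_intD(1)[OF w(2)] sq_intD(1)[OF w(3)] by (auto simp: w'_def[abs_def])
  have m\<eta>: "(\<lambda>x. \<eta> (r k *\<^sub>R x)) \<in> borel_measurable lebesgue"
    "(\<lambda>x. \<eta>' (r k *\<^sub>R x)) \<in> borel_measurable lebesgue" for k
    by (intro borel_imp_lebesgue_measurable borel_measurable_continuous_onI continuous_on_compose2[OF c']
        continuous_on_compose2[OF Ck_continuous[OF \<eta>]] continuous_intros; simp)+
  have eq: "(\<integral>x. f x * (w' x * \<eta> (r k *\<^sub>R x) + r k * (w x * \<eta>' (r k *\<^sub>R x))) \<partial>lebesgue)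
     = - (\<integral>x. g x * (w x * \<eta> (r k *\<^sub>R x)) \<partial>lebesgue)" for k
  proof -
    have "(\<lambda>x. w x * \<eta> (r k *\<^sub>R x)) \<in> test_functions UNIV"
    proof (rule test_functionsI)
      show "Ck j (\<lambda>x. w x * \<eta> (r k *\<^sub>R x))" for j
        by (intro Ck_mult w Ck_scaleR \<eta>)
      fix x :: 'a assume x: "x \<notin> cbox (- (real (Suc k) *\<^sub>R One)) (real (Suc k) *\<^sub>R One)"
      have "r k *\<^sub>R x \<notin> cbox (- One) One"
      proof
        assume "r k *\<^sub>R x \<in> cbox (- One) One"
        then have "x \<in> cbox (- (real (Suc k) *\<^sub>R One)) (real (Suc k) *\<^sub>R One)"
          by (auto simp: mem_box r_def field_simps inner_add_left inner_diff_left)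
        with x show False by simp
      qed
      then show "w x * \<eta> (r k *\<^sub>R x) = 0" by (simp add: z)
    qed simp
    from bspec[OF wp[unfolded has_weak_partial_def] this] show ?thesis by (simp only: der)
  qed
  have i1: "integrable lebesgue (\<lambda>x. f x * w' x)" "integrable lebesgue (\<lambda>x. f x * w x)"
    "integrable lebesgue (\<lambda>x. g x * w x)"
    using sq_int_mult_integrable[OF f w(3)] sq_int_mult_integrable[OF f w(2)] sq_int_mult_integrable[OF g w(2)]
    by (auto simp: w'_def)
  have lim\<eta>: "(\<lambda>k. \<eta> (r k *\<^sub>R x)) \<longlonglongrightarrow> 1" for x
  proof -
    have "(\<lambda>k. r k *\<^sub>R x) \<longlonglongrightarrow> 0 *\<^sub>R x" by (intro tendsto_intros r0)
    then have "(\<lambda>k. \<eta> (r k *\<^sub>R x)) \<longlonglongrightarrow> \<eta> 0"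
      using continuous_on_tendsto_compose[OF Ck_continuous[OF \<eta>]] by fastforce
    then show ?thesis by (simp add: \<eta>0)
  qed
  have L: "(\<lambda>k. \<integral>x. f x * (w' x * \<eta> (r k *\<^sub>R x) + r k * (w x * \<eta>' (r k *\<^sub>R x))) \<partial>lebesgue)
      \<longlonglongrightarrow> (\<integral>x. f x * w' x \<partial>lebesgue)"
  \<comment> \<open>Since \<open>r k \<le> 1\<close>, this majorant serves for all
    \<open>k\<close>.\<close>
  proof (rule integral_dominated_convergence[where w = "\<lambda>x. M * \<bar>f x * w' x\<bar> + M' * \<bar>f x * w x\<bar>"])
    show "integrable lebesgue (\<lambda>x. M * \<bar>f x * w' x\<bar> + M' * \<bar>f x * w x\<bar>)" using i1 by auto
    show "AE x in lebesgue. (\<lambda>k. f x * (w' x * \<eta> (r k *\<^sub>R x) + r k * (w x * \<eta>' (r k *\<^sub>R x)))) \<longlonglongrightarrow> f x * w' x"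
    proof (rule AE_I2)
      fix x
      have "(\<lambda>k. r k * (w x * \<eta>' (r k *\<^sub>R x))) \<longlonglongrightarrow> 0"
      proof (rule Lim_null_comparison)
        show "\<forall>\<^sub>F k in sequentially. norm (r k * (w x * \<eta>' (r k *\<^sub>R x))) \<le> r k * (\<bar>w x\<bar> * M')"
          using r1(1) M' by (auto intro!: always_eventually mult_left_mono simp: abs_mult less_imp_le)
        show "(\<lambda>k. r k * (\<bar>w x\<bar> * M')) \<longlonglongrightarrow> 0" using tendsto_mult_left_zero[OF r0] .
      qed
      then have "(\<lambda>k. f x * (w' x * \<eta> (r k *\<^sub>R x) + r k * (w x * \<eta>' (r k *\<^sub>R x)))) \<longlonglongrightarrow> f x * (w' x * 1 + 0)"
        by (intro tendsto_intros lim\<eta>)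
      then show "(\<lambda>k. f x * (w' x * \<eta> (r k *\<^sub>R x) + r k * (w x * \<eta>' (r k *\<^sub>R x)))) \<longlonglongrightarrow> f x * w' x" by simp
    qed
    show "AE x in lebesgue. norm (f x * (w' x * \<eta> (r k *\<^sub>R x) + r k * (w x * \<eta>' (r k *\<^sub>R x))))
        \<le> M * \<bar>f x * w' x\<bar> + M' * \<bar>f x * w x\<bar>" for k
    proof (rule AE_I2)
      fix x
      have 1: "\<bar>f x * w' x\<bar> * \<bar>\<eta> (r k *\<^sub>R x)\<bar> \<le> \<bar>f x * w' x\<bar> * M" by (intro mult_left_mono M) auto
      have "r k * \<bar>\<eta>' (r k *\<^sub>R x)\<bar> \<le> 1 * M'" using r1[of k] M' by (intro mult_mono) auto
      then have 2: "\<bar>f x * w x\<bar> * (r k * \<bar>\<eta>' (r k *\<^sub>R x)\<bar>) \<le> \<bar>f x * w x\<bar> * M'" by (intro mult_left_mono) auto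
      have "f x * (w' x * \<eta> (r k *\<^sub>R x) + r k * (w x * \<eta>' (r k *\<^sub>R x)))
        = f x * w' x * \<eta> (r k *\<^sub>R x) + f x * w x * (r k * \<eta>' (r k *\<^sub>R x))" by (simp add: algebra_simps)
      then have "norm (f x * (w' x * \<eta> (r k *\<^sub>R x) + r k * (w x * \<eta>' (r k *\<^sub>R x))))
        \<le> \<bar>f x * w' x * \<eta> (r k *\<^sub>R x)\<bar> + \<bar>f x * w x * (r k * \<eta>' (r k *\<^sub>R x))\<bar>" by simp
      also have "\<dots> = \<bar>f x * w' x\<bar> * \<bar>\<eta> (r k *\<^sub>R x)\<bar> + \<bar>f x * w x\<bar> * (r k * \<bar>\<eta>' (r k *\<^sub>R x)\<bar>)"
        using r1(1)[of k] by (simp add: abs_mult)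
      finally show "norm (f x * (w' x * \<eta> (r k *\<^sub>R x) + r k * (w x * \<eta>' (r k *\<^sub>R x))))
        \<le> M * \<bar>f x * w' x\<bar> + M' * \<bar>f x * w x\<bar>" using 1 2 by (simp add: mult.commute)
    qed
    show "(\<lambda>x. f x * w' x) \<in> borel_measurable lebesgue" by (rule borel_measurable_integrable[OF i1(1)])
    show "(\<lambda>x. f x * (w' x * \<eta> (r k *\<^sub>R x) + r k * (w x * \<eta>' (r k *\<^sub>R x)))) \<in> borel_measurable lebesgue" for k
      by (intro borel_measurable_times borel_measurable_add borel_measurable_const m\<eta> mw sq_intD(1)[OF f])
  qed
  have R: "(\<lambda>k. \<integral>x. g x * (w x * \<eta> (r k *\<^sub>R x)) \<partial>lebesgue) \<longlonglongrightarrow> (\<integral>x. g x * w x \<partial>lebesgue)"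
  proof (rule integral_dominated_convergence[where w = "\<lambda>x. M * \<bar>g x * w x\<bar>"])
    show "integrable lebesgue (\<lambda>x. M * \<bar>g x * w x\<bar>)" using i1 by auto
    show "AE x in lebesgue. (\<lambda>k. g x * (w x * \<eta> (r k *\<^sub>R x))) \<longlonglongrightarrow> g x * w x"
    proof (rule AE_I2)
      fix x
      have "(\<lambda>k. g x * (w x * \<eta> (r k *\<^sub>R x))) \<longlonglongrightarrow> g x * (w x * 1)" by (intro tendsto_intros lim\<eta>)
      then show "(\<lambda>k. g x * (w x * \<eta> (r k *\<^sub>R x))) \<longlonglongrightarrow> g x * w x" by simp
    qed
    show "AE x in lebesgue. norm (g x * (w x * \<eta> (r k *\<^sub>R x))) \<le> M * \<bar>g x * w x\<bar>" for k
    proof (rule AE_I2)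
      fix x
      have "\<bar>g x * w x\<bar> * \<bar>\<eta> (r k *\<^sub>R x)\<bar> \<le> \<bar>g x * w x\<bar> * M" by (intro mult_left_mono M) auto
      then show "norm (g x * (w x * \<eta> (r k *\<^sub>R x))) \<le> M * \<bar>g x * w x\<bar>" by (simp add: abs_mult mult_ac)
    qed
    show "(\<lambda>x. g x * w x) \<in> borel_measurable lebesgue" by (rule borel_measurable_integrable[OF i1(3)])
    show "(\<lambda>x. g x * (w x * \<eta> (r k *\<^sub>R x))) \<in> borel_measurable lebesgue" for k
      by (intro borel_measurable_times m\<eta> mw sq_intD(1)[OF g])
  qed
  have "(\<integral>x. f x * w' x \<partial>lebesgue) = - (\<integral>x. g x * w x \<partial>lebesgue)"
    using LIMSEQ_unique[OF L[unfolded eq] tendsto_minus[OF R]] .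
  then show ?thesis by (simp add: w'_def)
qed

section \<open>Weak partial derivatives and the Sobolev norms\<close>

lemma sobolev_set_subset_L2: "sobolev_set k \<subseteq> L2"
  by (cases k) auto

lemma has_weak_partial_cong_AE:
  assumes "AE x in lebesgue. f x = f' x" "sq_int lebesgue f" "sq_int lebesgue f'" "b \<in> Basis"
  shows "has_weak_partial b f g = has_weak_partial b f' g"
proof -
  have "(LINT x|lebesgue. f x * frechet_derivative \<phi> (at x) b) = (LINT x|lebesgue. f' x * frechet_derivative \<phi> (at x) b)"
    if "\<phi> \<in> test_functions UNIV" for \<phi>
  proof (rule integral_cong_AE)
    have "Ck (Suc 0) \<phi>" using that by (auto simp: test_functions_def)
    then have "(\<lambda>x. frechet_derivative \<phi> (at x) b) \<in> borel_measurable lebesgue"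
      using assms(4) by (intro Ck_measurable[of 0]) simp
    then show "(\<lambda>x. f x * frechet_derivative \<phi> (at x) b) \<in> borel_measurable lebesgue"
      "(\<lambda>x. f' x * frechet_derivative \<phi> (at x) b) \<in> borel_measurable lebesgue"
      by (intro borel_measurable_times sq_intD(1)[OF assms(2)] sq_intD(1)[OF assms(3)]; assumption)+
    show "AE x in lebesgue. f x * frechet_derivative \<phi> (at x) b = f' x * frechet_derivative \<phi> (at x) b"
      using assms(1) by eventually_elim simp
  qed
  then show ?thesis by (simp add: has_weak_partial_def)
qed

text \<open>Bumps are test functions, and a square integrable function is determined by its
  integrals against them. Hence the choice made in \<open>weak_partial\<close> is immaterial up to
  null sets.\<close>

lemma has_weak_partial_unique:
  assumes "has_weak_partial b f g" "has_weak_partial b f h" and g: "sq_int lebesgue g" and h: "sq_int lebesgue h"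
  shows "AE x in lebesgue. g x = h x"
proof -
  have "AE x in lebesgue. x \<in> box (- (real k *\<^sub>R One)) (real k *\<^sub>R One) \<longrightarrow> g x - h x = 0" for k
  proof (rule AE_zero_if_bump_integrals_zero[OF sq_int_diff[OF g h], of UNIV])
    fix m and l u :: 'a
    have "(\<integral>x. g x * bump m l u x \<partial>lebesgue) = (\<integral>x. h x * bump m l u x \<partial>lebesgue)"
      using assms(1,2) bump_test_function[of l u UNIV m] unfolding has_weak_partial_def by force
    then show "(\<integral>x. (g x - h x) * bump m l u x \<partial>lebesgue) = 0"
      using sq_int_mult_integrable[OF g sq_int_bump[of m l u]] sq_int_mult_integrable[OF h sq_int_bump[of m l u]]
      by (simp add: left_diff_distrib)
  qed simp
  then have "AE x in lebesgue. g x - h x = 0" by (rule AE_if_AE_on_boxes)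
  then show ?thesis by eventually_elim simp
qed

lemma weak_partial_works:
  assumes "f \<in> sobolev_set (Suc k)" "b \<in> Basis"
  shows "sq_int lebesgue (weak_partial b f)" "has_weak_partial b f (weak_partial b f)"
proof -
  have "\<exists>g. g \<in> L2 \<and> has_weak_partial b f g" using assms sobolev_set_subset_L2 by fastforce
  from someI_ex[OF this] show "sq_int lebesgue (weak_partial b f)" "has_weak_partial b f (weak_partial b f)"
    unfolding weak_partial_def[symmetric] by (auto simp: L2_iff_sq_int)
qed

lemma sobolev_set_cong_AE:
  assumes "f \<in> sobolev_set k" "AE x in lebesgue. f x = f' x" "sq_int lebesgue f'"
  shows "f' \<in> sobolev_set k"
proof (cases k)
  case 0 then show ?thesis using assms by (simp add: L2_iff_sq_int)
next
  case (Suc j)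
  then have f: "sq_int lebesgue f" using assms(1) by (simp add: L2_iff_sq_int)
  show ?thesis using assms(1,3) has_weak_partial_cong_AE[OF assms(2) f assms(3)] Suc
    by (simp add: L2_iff_sq_int)
qed

text \<open>\<open>weak_partial\<close> is chosen only among functions in \<open>L2\<close>. Its
  higher regularity is inherited from the witness in the definition of \<open>sobolev_set\<close>,
  to which it is equal almost everywhere.\<close>

lemma weak_partial_in_sobolev_set:
  assumes "f \<in> sobolev_set (Suc k)" "b \<in> Basis"
  shows "weak_partial b f \<in> sobolev_set k"
proof -
  obtain g where g: "g \<in> sobolev_set k" "has_weak_partial b f g" using assms by auto
  then have "sq_int lebesgue g" using sobolev_set_subset_L2 by (auto simp: L2_iff_sq_int[symmetric])
  then have "AE x in lebesgue. g x = weak_partial b f x"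
    using has_weak_partial_unique[OF g(2) weak_partial_works(2)[OF assms] _ weak_partial_works(1)[OF assms]] by blast
  then show ?thesis using sobolev_set_cong_AE[OF g(1)] weak_partial_works(1)[OF assms] by blast
qed

text \<open>The equality holds at every point, because the two choices are made from the same
  predicate.\<close>

lemma weak_partial_cong_AE:
  assumes "AE x in lebesgue. f x = f' x" "sq_int lebesgue f" "sq_int lebesgue f'" "b \<in> Basis"
  shows "weak_partial b f = weak_partial b f'"
  unfolding weak_partial_def has_weak_partial_cong_AE[OF assms] ..

text \<open>The integrals may be split only if the parts are integrable, which holds because a test
  function and its derivatives are square integrable.\<close>

lemma has_weak_partial_linear:
  assumes b: "b \<in> Basis" and "has_weak_partial b f f'" "has_weak_partial b g g'"
    and sq: "sq_int lebesgue f" "sq_int lebesgue g" "sq_int lebesgue f'" "sq_int lebesgue g'"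
  shows "has_weak_partial b (\<lambda>x. c * f x + d * g x) (\<lambda>x. c * f' x + d * g' x)"
  unfolding has_weak_partial_def
proof
  fix \<phi> assume \<phi>: "\<phi> \<in> test_functions (UNIV :: 'a set)"
  then have Ck: "Ck k \<phi>" for k by (auto simp: test_functions_def)
  have "compact (closure {x. \<phi> x \<noteq> 0})" using \<phi> by (auto simp: test_functions_def)
  then have "bounded {x. \<phi> x \<noteq> 0}" using bounded_subset[OF compact_imp_bounded closure_subset] by blast
  then obtain l u where lu: "{x. \<phi> x \<noteq> 0} \<subseteq> cbox l u" by (meson bounded_subset_cbox_symmetric)
  then have z: "\<phi> x = 0" if "x \<notin> cbox l u" for x using that by auto
  have s1: "sq_int lebesgue \<phi>" by (rule sq_int_continuous_compact_support[OF Ck_continuous[OF Ck] z])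
  have s2: "sq_int lebesgue (\<lambda>x. frechet_derivative \<phi> (at x) b)"
  proof (rule sq_int_continuous_compact_support)
    show "continuous_on UNIV (\<lambda>x. frechet_derivative \<phi> (at x) b)" using Ck[of "Suc 0"] b by simp
    show "frechet_derivative \<phi> (at x) b = 0" if "x \<notin> cbox l u" for x
      using frechet_derivative_zero_outside[of l u \<phi>, OF z that] by simp
  qed
  have "(\<integral>x. (c * f x + d * g x) * frechet_derivative \<phi> (at x) b \<partial>lebesgue)
      = c * (\<integral>x. f x * frechet_derivative \<phi> (at x) b \<partial>lebesgue) + d * (\<integral>x. g x * frechet_derivative \<phi> (at x) b \<partial>lebesgue)"
    using sq_int_mult_integrable[OF sq(1) s2] sq_int_mult_integrable[OF sq(2) s2]
    by (simp add: distrib_right mult.assoc)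
  also have "\<dots> = c * - (\<integral>x. f' x * \<phi> x \<partial>lebesgue) + d * - (\<integral>x. g' x * \<phi> x \<partial>lebesgue)"
    using assms(2,3) \<phi> unfolding has_weak_partial_def by auto
  also have "\<dots> = - (\<integral>x. (c * f' x + d * g' x) * \<phi> x \<partial>lebesgue)"
    using sq_int_mult_integrable[OF sq(3) s1] sq_int_mult_integrable[OF sq(4) s1]
    by (simp add: distrib_right mult.assoc)
  finally show "(\<integral>x. (c * f x + d * g x) * frechet_derivative \<phi> (at x) b \<partial>lebesgue)
     = - (\<integral>x. (c * f' x + d * g' x) * \<phi> x \<partial>lebesgue)" .
qed

lemma sobolev_set_linear:
  "f \<in> sobolev_set k \<Longrightarrow> g \<in> sobolev_set k \<Longrightarrow> (\<lambda>x. c * f x + d * g x) \<in> sobolev_set k"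
proof (induction k arbitrary: f g)
  case 0
  then show ?case by (auto simp: L2_iff_sq_int intro!: sq_int_add sq_int_cmult(1))
next
  case (Suc k)
  have sq: "sq_int lebesgue f" "sq_int lebesgue g" using Suc.prems by (auto simp: L2_iff_sq_int)
  have "\<exists>h\<in>sobolev_set k. has_weak_partial b (\<lambda>x. c * f x + d * g x) h" if b: "b \<in> Basis" for b
    using has_weak_partial_linear[OF b weak_partial_works(2)[OF Suc.prems(1) b] weak_partial_works(2)[OF Suc.prems(2) b]
        sq weak_partial_works(1)[OF Suc.prems(1) b] weak_partial_works(1)[OF Suc.prems(2) b]]
      Suc.IH[OF weak_partial_in_sobolev_set[OF Suc.prems(1) b] weak_partial_in_sobolev_set[OF Suc.prems(2) b]]
    by blast
  then show ?case using sq by (auto simp: L2_iff_sq_int intro!: sq_int_add sq_int_cmult(1))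
qed

lemma weak_partial_linear:
  assumes "f \<in> sobolev_set (Suc k)" "g \<in> sobolev_set (Suc k)" "b \<in> Basis"
  shows "AE x in lebesgue. weak_partial b (\<lambda>x. c * f x + d * g x) x = c * weak_partial b f x + d * weak_partial b g x"
proof (rule has_weak_partial_unique)
  have sq: "sq_int lebesgue f" "sq_int lebesgue g" using assms by (auto simp: L2_iff_sq_int)
  note fg = sobolev_set_linear[OF assms(1,2)]
  show "has_weak_partial b (\<lambda>x. c * f x + d * g x) (weak_partial b (\<lambda>x. c * f x + d * g x))"
    "sq_int lebesgue (weak_partial b (\<lambda>x. c * f x + d * g x))"
    using weak_partial_works[OF fg assms(3)] by auto
  show "has_weak_partial b (\<lambda>x. c * f x + d * g x) (\<lambda>x. c * weak_partial b f x + d * weak_partial b g x)"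
    using has_weak_partial_linear[OF assms(3) weak_partial_works(2)[OF assms(1,3)] weak_partial_works(2)[OF assms(2,3)]
        sq weak_partial_works(1)[OF assms(1,3)] weak_partial_works(1)[OF assms(2,3)]] .
  show "sq_int lebesgue (\<lambda>x. c * weak_partial b f x + d * weak_partial b g x)"
    using weak_partial_works(1)[OF assms(1,3)] weak_partial_works(1)[OF assms(2,3)]
    by (intro sq_int_add sq_int_cmult)
qed

lemma sobolev_norm_nonneg: "0 \<le> sobolev_norm k f"
  by (cases k) (auto simp: L2_norm_eq_sq_norm intro!: add_nonneg_nonneg sum_nonneg)

text \<open>In this form the norm is a Euclidean norm of two Euclidean norms, and the triangle
  inequality follows by applying Minkowski's inequality first to the sum over the basis and then to
  the pair.\<close>

lemma sobolev_norm_Suc: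
  "sobolev_norm (Suc k) f = sqrt ((L2_norm f)\<^sup>2 + (L2_set (\<lambda>b. sobolev_norm k (weak_partial b f)) Basis)\<^sup>2)"
  by (simp add: L2_set_def sum_nonneg)

lemma sobolev_norm_cong_AE:
  assumes "AE x in lebesgue. f x = f' x" "sq_int lebesgue f" "sq_int lebesgue f'"
  shows "sobolev_norm k f = sobolev_norm k f'"
proof -
  have "L2_norm f = L2_norm f'"
    unfolding L2_norm_eq_sq_norm using assms by (intro sq_norm_cong_AE) (auto simp: sq_int_def)
  then show ?thesis using weak_partial_cong_AE[OF assms] by (cases k) auto
qed

lemma sobolev_norm_triangle:
  "f \<in> sobolev_set k \<Longrightarrow> g \<in> sobolev_set k \<Longrightarrow>
    sobolev_norm k (\<lambda>x. f x + g x) \<le> sobolev_norm k f + sobolev_norm k g"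
proof (induction k arbitrary: f g)
  case 0
  then show ?case by (auto simp: L2_iff_sq_int L2_norm_eq_sq_norm intro: sq_norm_triangle)
next
  case (Suc k)
  have sq: "sq_int lebesgue f" "sq_int lebesgue g" using Suc.prems by (auto simp: L2_iff_sq_int)
  have fg: "(\<lambda>x. f x + g x) \<in> sobolev_set (Suc k)"
    using sobolev_set_linear[OF Suc.prems, of 1 1] by simp
  have le: "sobolev_norm k (weak_partial b (\<lambda>x. f x + g x))
      \<le> sobolev_norm k (weak_partial b f) + sobolev_norm k (weak_partial b g)" if b: "b \<in> Basis" for b
  proof -
    have AE: "AE x in lebesgue. weak_partial b (\<lambda>x. f x + g x) x = weak_partial b f x + weak_partial b g x"
      using weak_partial_linear[OF Suc.prems b, of 1 1] by simp
    have "sobolev_norm k (weak_partial b (\<lambda>x. f x + g x)) = sobolev_norm k (\<lambda>x. weak_partial b f x + weak_partial b g x)"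
      using weak_partial_works(1)[OF fg b] weak_partial_works(1)[OF Suc.prems(1) b] weak_partial_works(1)[OF Suc.prems(2) b]
      by (intro sobolev_norm_cong_AE[OF AE] sq_int_add)
    also have "\<dots> \<le> sobolev_norm k (weak_partial b f) + sobolev_norm k (weak_partial b g)"
      by (intro Suc.IH weak_partial_in_sobolev_set Suc.prems b)
    finally show ?thesis .
  qed
  have "L2_norm (\<lambda>x. f x + g x) \<le> L2_norm f + L2_norm g"
    unfolding L2_norm_eq_sq_norm by (rule sq_norm_triangle[OF sq])
  moreover have "L2_set (\<lambda>b. sobolev_norm k (weak_partial b (\<lambda>x. f x + g x))) Basis
      \<le> L2_set (\<lambda>b. sobolev_norm k (weak_partial b f)) Basis + L2_set (\<lambda>b. sobolev_norm k (weak_partial b g)) Basis"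
    by (rule order_trans[OF L2_set_mono L2_set_triangle_ineq]) (use le sobolev_norm_nonneg in auto)
  ultimately have "sobolev_norm (Suc k) (\<lambda>x. f x + g x) \<le>
     sqrt ((L2_norm f + L2_norm g)\<^sup>2 + (L2_set (\<lambda>b. sobolev_norm k (weak_partial b f)) Basis
        + L2_set (\<lambda>b. sobolev_norm k (weak_partial b g)) Basis)\<^sup>2)"
    unfolding sobolev_norm_Suc
    by (intro real_sqrt_le_mono add_mono power_mono) (auto simp: L2_norm_eq_sq_norm L2_set_nonneg)
  also have "\<dots> \<le> sobolev_norm (Suc k) f + sobolev_norm (Suc k) g"
    unfolding sobolev_norm_Suc by (rule real_sqrt_sum_squares_triangle_ineq)
  finally show ?case .
qed

lemma sobolev_norm_cmult:
  "f \<in> sobolev_set k \<Longrightarrow> sobolev_norm k (\<lambda>x. c * f x) = \<bar>c\<bar> * sobolev_norm k f"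
proof (induction k arbitrary: f)
  case 0
  then show ?case by (auto simp: L2_iff_sq_int L2_norm_eq_sq_norm sq_int_cmult)
next
  case (Suc k)
  have sq: "sq_int lebesgue f" using Suc.prems by (auto simp: L2_iff_sq_int)
  have cf: "(\<lambda>x. c * f x) \<in> sobolev_set (Suc k)"
    using sobolev_set_linear[OF Suc.prems Suc.prems, of c 0] by simp
  have eq: "sobolev_norm k (weak_partial b (\<lambda>x. c * f x)) = \<bar>c\<bar> * sobolev_norm k (weak_partial b f)"
    if b: "b \<in> Basis" for b
  proof -
    have AE: "AE x in lebesgue. weak_partial b (\<lambda>x. c * f x) x = c * weak_partial b f x"
      using weak_partial_linear[OF Suc.prems Suc.prems b, of c 0] by simp
    have "sobolev_norm k (weak_partial b (\<lambda>x. c * f x)) = sobolev_norm k (\<lambda>x. c * weak_partial b f x)"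
      using weak_partial_works(1)[OF cf b] weak_partial_works(1)[OF Suc.prems b]
      by (intro sobolev_norm_cong_AE[OF AE] sq_int_cmult)
    also have "\<dots> = \<bar>c\<bar> * sobolev_norm k (weak_partial b f)"
      by (intro Suc.IH weak_partial_in_sobolev_set Suc.prems b)
    finally show ?thesis .
  qed
  have "sobolev_norm (Suc k) (\<lambda>x. c * f x) = sqrt (c\<^sup>2 * ((L2_norm f)\<^sup>2 + (\<Sum>b\<in>Basis. (sobolev_norm k (weak_partial b f))\<^sup>2)))"
    by (simp add: L2_norm_eq_sq_norm sq_int_cmult[OF sq] eq power_mult_distrib sum_distrib_left distrib_left)
  then show ?case by (simp add: real_sqrt_mult)
qed

lemma L2_norm_le_sobolev_norm: "L2_norm f \<le> sobolev_norm k f"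
proof (cases k)
  case (Suc j)
  have "sqrt ((L2_norm f)\<^sup>2) \<le> sqrt ((L2_norm f)\<^sup>2 + (\<Sum>b\<in>Basis. (sobolev_norm j (weak_partial b f))\<^sup>2))"
    by (intro real_sqrt_le_mono) (simp add: sum_nonneg)
  then show ?thesis using Suc by (simp add: L2_norm_eq_sq_norm)
qed simp

text \<open>The classical partial derivative, given as a function of the point so that it can be
  iterated.\<close>

definition grad_entry :: "('a::euclidean_space \<Rightarrow> real) \<Rightarrow> 'a \<Rightarrow> 'a \<Rightarrow> real" where
  "grad_entry w b x = frechet_derivative w (at x) b"

text \<open>Two integrations by parts in the same direction, whose signs cancel, move both
  derivatives to the smooth factor.\<close>

lemma weak_laplacian_by_parts:
  fixes f :: "'a::euclidean_space \<Rightarrow> real"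
  assumes f: "f \<in> sobolev_set 2" and w: "\<And>k. Ck k w" "sq_int lebesgue w"
    and w1: "\<And>b. b \<in> Basis \<Longrightarrow> sq_int lebesgue (grad_entry w b)"
    and w2: "\<And>b. b \<in> Basis \<Longrightarrow> sq_int lebesgue (grad_entry (grad_entry w b) b)"
  shows "sq_int lebesgue (weak_laplacian f)"
    "(\<integral>x. weak_laplacian f x * w x \<partial>lebesgue) = (\<integral>x. f x * (\<Sum>b\<in>Basis. grad_entry (grad_entry w b) b x) \<partial>lebesgue)"
proof -
  have f': "f \<in> sobolev_set (Suc (Suc 0))" using f by (simp only: numeral_2_eq_2)
  have sf: "sq_int lebesgue f" using f' by (simp add: L2_iff_sq_int)
  have p1: "weak_partial b f \<in> sobolev_set (Suc 0)" if "b \<in> Basis" for b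
    by (rule weak_partial_in_sobolev_set[OF f' that])
  have s2: "sq_int lebesgue (weak_partial b (weak_partial b f))" if "b \<in> Basis" for b
    by (rule weak_partial_works(1)[OF p1[OF that] that])
  show "sq_int lebesgue (weak_laplacian f)"
    unfolding weak_laplacian_def[abs_def] by (intro sq_int_sum s2) auto
  have Cg: "Ck k (grad_entry w b)" if "b \<in> Basis" for b k
    using w(1)[of "Suc k"] that unfolding grad_entry_def[abs_def] by simp
  have key: "(\<integral>x. weak_partial b (weak_partial b f) x * w x \<partial>lebesgue)
     = (\<integral>x. f x * grad_entry (grad_entry w b) b x \<partial>lebesgue)" if b: "b \<in> Basis" for b
  proof -
    have "(\<integral>x. f x * grad_entry (grad_entry w b) b x \<partial>lebesgue) = - (\<integral>x. weak_partial b f x * grad_entry w b x \<partial>lebesgue)"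
      using weak_partial_by_parts[OF weak_partial_works(2)[OF f' b] b sf weak_partial_works(1)[OF f' b] Cg[OF b] w1[OF b]]
        w2[OF b] by (simp add: grad_entry_def[of "grad_entry w b", abs_def])
    also have "\<dots> = (\<integral>x. weak_partial b (weak_partial b f) x * w x \<partial>lebesgue)"
      using weak_partial_by_parts[OF weak_partial_works(2)[OF p1[OF b] b] b weak_partial_works(1)[OF f' b] s2[OF b] w]
        w1[OF b] by (simp add: grad_entry_def[of w, abs_def])
    finally show ?thesis by simp
  qed
  have "(\<integral>x. weak_laplacian f x * w x \<partial>lebesgue) = (\<Sum>b\<in>Basis. \<integral>x. weak_partial b (weak_partial b f) x * w x \<partial>lebesgue)"
    unfolding weak_laplacian_def sum_distrib_right
    by (intro Bochner_Integration.integral_sum sq_int_mult_integrable s2 w)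
  also have "\<dots> = (\<Sum>b\<in>Basis. \<integral>x. f x * grad_entry (grad_entry w b) b x \<partial>lebesgue)"
    by (intro sum.cong refl key)
  also have "\<dots> = (\<integral>x. f x * (\<Sum>b\<in>Basis. grad_entry (grad_entry w b) b x) \<partial>lebesgue)"
    unfolding sum_distrib_left
    by (intro Bochner_Integration.integral_sum[symmetric] sq_int_mult_integrable sf w2)
  finally show "(\<integral>x. weak_laplacian f x * w x \<partial>lebesgue) = (\<integral>x. f x * (\<Sum>b\<in>Basis. grad_entry (grad_entry w b) b x) \<partial>lebesgue)" .
qed

section \<open>Bochner spaces\<close>

text \<open>Homogeneity and the triangle inequality are restricted to the carrier because outside it
  a Sobolev norm may involve an arbitrary value of the choice operator in
  \<open>weak_partial\<close>.\<close>

definition seminormed_space :: "'v::real_vector seminormed \<Rightarrow> bool" where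
  "seminormed_space X \<longleftrightarrow> subspace (vecs X) \<and> (\<forall>v. 0 \<le> snorm X v) \<and>
     (\<forall>c. \<forall>v\<in>vecs X. snorm X (c *\<^sub>R v) = \<bar>c\<bar> * snorm X v) \<and>
     (\<forall>v\<in>vecs X. \<forall>w\<in>vecs X. snorm X (v + w) \<le> snorm X v + snorm X w)"

text \<open>The nested spaces are accessed through such functionals: they turn vector-valued
  functions into real ones, for which the ordinary integral is available. The bound is part of the
  predicate because it is passed on from one level of nesting to the next.\<close>

definition bdd_functional :: "'v::real_vector seminormed \<Rightarrow> ('v \<Rightarrow> real) \<Rightarrow> real \<Rightarrow> bool" where
  "bdd_functional X l C \<longleftrightarrow> 0 \<le> C \<and>
     (\<forall>v\<in>vecs X. \<forall>w\<in>vecs X. l (v + w) = l v + l w) \<and>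
     (\<forall>c. \<forall>v\<in>vecs X. l (c *\<^sub>R v) = c * l v) \<and>
     (\<forall>v\<in>vecs X. \<bar>l v\<bar> \<le> C * snorm X v)"

lemma seminormed_spaceD:
  assumes "seminormed_space X"
  shows "subspace (vecs X)" "0 \<le> snorm X v"
    "v \<in> vecs X \<Longrightarrow> snorm X (c *\<^sub>R v) = \<bar>c\<bar> * snorm X v"
    "v \<in> vecs X \<Longrightarrow> w \<in> vecs X \<Longrightarrow> snorm X (v + w) \<le> snorm X v + snorm X w"
  using assms by (auto simp: seminormed_space_def)

lemma bdd_functionalD:
  assumes "bdd_functional X l C"
  shows "0 \<le> C" "v \<in> vecs X \<Longrightarrow> w \<in> vecs X \<Longrightarrow> l (v + w) = l v + l w"
    "v \<in> vecs X \<Longrightarrow> l (c *\<^sub>R v) = c * l v"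
    "v \<in> vecs X \<Longrightarrow> \<bar>l v\<bar> \<le> C * snorm X v"
  using assms by (auto simp: bdd_functional_def)

lemma bdd_functional_diff:
  assumes "subspace (vecs X)" "bdd_functional X l C" "v \<in> vecs X" "w \<in> vecs X"
  shows "l (v - w) = l v - l w"
proof -
  have "l (v + (- 1) *\<^sub>R w) = l v + (- 1) * l w"
    using assms by (simp only: bdd_functionalD(2,3)[OF assms(2)] subspace_scale)
  then show ?thesis by simp
qed

lemma bdd_functional_sum:
  assumes "subspace (vecs X)" "bdd_functional X l C" "finite A" "\<And>a. a \<in> A \<Longrightarrow> g a \<in> vecs X"
  shows "l (\<Sum>a\<in>A. c a *\<^sub>R g a) = (\<Sum>a\<in>A. c a * l (g a))"
  using assms(3,4)
proof (induction A rule: finite_induct)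
  case empty
  have "l (0 *\<^sub>R 0) = 0 * l 0" by (rule bdd_functionalD(3)[OF assms(2) subspace_0[OF assms(1)]])
  then show ?case by simp
next
  case (insert a A)
  have "(\<Sum>a\<in>A. c a *\<^sub>R g a) \<in> vecs X"
    using insert by (intro subspace_sum[OF assms(1)] subspace_scale[OF assms(1)]) auto
  then have "l (c a *\<^sub>R g a + (\<Sum>a\<in>A. c a *\<^sub>R g a)) = l (c a *\<^sub>R g a) + l (\<Sum>a\<in>A. c a *\<^sub>R g a)"
    using insert by (intro bdd_functionalD(2)[OF assms(2)] subspace_scale[OF assms(1)]) auto
  then show ?case using insert bdd_functionalD(3)[OF assms(2)] by simp
qed

section \<open>Strong measurability and linearity of the Bochner spaces\<close>

lemma complete_measure_lebesgue_on:
  assumes "I \<in> sets lebesgue"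
  shows "complete_measure (lebesgue_on I)"
proof
  fix A B assume "B \<subseteq> A" "A \<in> null_sets (lebesgue_on I)"
  then have "B \<subseteq> I" "B \<in> null_sets lebesgue"
    using assms completion.complete2[of B A] by (auto simp: null_sets_restrict_space)
  then have "B \<in> null_sets (lebesgue_on I)" using assms by (simp add: null_sets_restrict_space)
  then show "B \<in> sets (lebesgue_on I)" by blast
qed

text \<open>The pointwise limit exists only almost everywhere. \<open>lim\<close> supplies a
  measurable version, and completeness passes measurability to every function equal to it almost
  everywhere.\<close>

lemma (in complete_measure) borel_measurable_AE_limit:
  fixes f :: "'a \<Rightarrow> real"
  assumes s: "\<And>i. s i \<in> borel_measurable M" and lim: "AE x in M. (\<lambda>i. s i x) \<longlonglongrightarrow> f x"
  shows "f \<in> borel_measurable M"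
proof (rule measurableI)
  define g where "g x = lim (\<lambda>i. s i x)" for x
  have g: "g \<in> borel_measurable M" unfolding g_def[abs_def] by (intro borel_measurable_lim_metric s)
  have fg: "AE x in M. g x = f x" using lim by eventually_elim (simp add: g_def limI)
  fix A :: "real set" assume A: "A \<in> sets borel"
  show "f -` A \<inter> space M \<in> sets M"
  proof (rule in_sets_AE)
    show "g -` A \<inter> space M \<in> sets M" by (rule measurable_sets[OF g A])
    show "AE x in M. (x \<in> g -` A \<inter> space M) = (x \<in> f -` A \<inter> space M)"
      using fg by eventually_elim simp
  qed auto
qed simp

text \<open>The functional maps the approximating simple functions to real simple functions, and its
  bound carries the convergence over. Of the space only the subspace property of the carrier is
  assumed, so that the lemma also applies to functions with values in \<open>bochner_H1\<close>, for
  whose seminorm no triangle inequality is established.\<close>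

lemma bdd_functional_measurable:
  assumes M: "complete_measure M" and X: "subspace (vecs X)" and l: "bdd_functional X l C"
    and f: "strongly_measurable M X f"
  shows "(\<lambda>t. l (f t)) \<in> borel_measurable M"
proof -
  obtain s where s: "\<And>i. simple_function M (s i)" "\<And>i. s i ` space M \<subseteq> vecs X"
    and lim: "AE t in M. (\<lambda>i. snorm X (f t - s i t)) \<longlonglongrightarrow> 0" and fX: "AE t in M. f t \<in> vecs X"
    using f unfolding strongly_measurable_def by blast
  have lim': "AE t in M. (\<lambda>i. l (s i t)) \<longlonglongrightarrow> l (f t)"
    using lim fX AE_space
  proof eventually_elim
    case (elim t)
    have sX: "s i t \<in> vecs X" for i using s(2)[of i] elim(3) by auto
    have "\<bar>l (s i t) - l (f t)\<bar> \<le> C * snorm X (f t - s i t)" for i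
    proof -
      have "f t - s i t \<in> vecs X" by (rule subspace_diff[OF X elim(2) sX])
      from bdd_functionalD(4)[OF l this] show ?thesis
        using bdd_functional_diff[OF X l elim(2) sX] by simp
    qed
    then have "\<forall>\<^sub>F i in sequentially. norm (l (s i t) - l (f t)) \<le> C * snorm X (f t - s i t)"
      unfolding real_norm_def by (intro always_eventually allI)
    then have "(\<lambda>i. l (s i t) - l (f t)) \<longlonglongrightarrow> 0"
      by (rule Lim_null_comparison[OF _ tendsto_mult_right_zero[OF elim(1)]])
    then show ?case by (simp add: LIM_zero_iff)
  qed
  have "(\<lambda>t. l (s i t)) \<in> borel_measurable M" for i
    using simple_function_compose[OF s(1)[of i], of l] by (intro borel_measurable_simple_function) (simp add: comp_def)
  from complete_measure.borel_measurable_AE_limit[OF M this lim'] show ?thesis .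
qed

text \<open>As for functionals, but convergence of the seminorms comes from the reverse triangle
  inequality, so here the axioms of the seminorm are needed.\<close>

lemma snorm_measurable:
  assumes M: "complete_measure M" and X: "seminormed_space X" and f: "strongly_measurable M X f"
  shows "(\<lambda>t. snorm X (f t)) \<in> borel_measurable M"
proof -
  note X' = seminormed_spaceD[OF X]
  obtain s where s: "\<And>i. simple_function M (s i)" "\<And>i. s i ` space M \<subseteq> vecs X"
    and lim: "AE t in M. (\<lambda>i. snorm X (f t - s i t)) \<longlonglongrightarrow> 0" and fX: "AE t in M. f t \<in> vecs X"
    using f unfolding strongly_measurable_def by blast
  have lim': "AE t in M. (\<lambda>i. snorm X (s i t)) \<longlonglongrightarrow> snorm X (f t)"
    using lim fX AE_space
  proof eventually_elim
    case (elim t)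
    have sX: "s i t \<in> vecs X" for i using s(2)[of i] elim(3) by auto
    have "\<bar>snorm X (s i t) - snorm X (f t)\<bar> \<le> snorm X (f t - s i t)" for i
    proof -
      have d: "f t - s i t \<in> vecs X" by (rule subspace_diff[OF X'(1) elim(2) sX])
      have m: "snorm X (s i t - f t) = snorm X (f t - s i t)"
        using X'(3)[OF d, of "- 1"] by simp
      have d': "s i t - f t \<in> vecs X" by (rule subspace_diff[OF X'(1) sX elim(2)])
      show ?thesis using X'(4)[OF d sX[of i]] X'(4)[OF d' elim(2)] m by simp
    qed
    then have "\<forall>\<^sub>F i in sequentially. norm (snorm X (s i t) - snorm X (f t)) \<le> snorm X (f t - s i t)"
      unfolding real_norm_def by (intro always_eventually allI)
    then have "(\<lambda>i. snorm X (s i t) - snorm X (f t)) \<longlonglongrightarrow> 0"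
      by (rule Lim_null_comparison[OF _ elim(1)])
    then show ?case by (simp add: LIM_zero_iff)
  qed
  have "(\<lambda>t. snorm X (s i t)) \<in> borel_measurable M" for i
    using simple_function_compose[OF s(1)[of i], of "snorm X"]
    by (intro borel_measurable_simple_function) (simp add: comp_def)
  from complete_measure.borel_measurable_AE_limit[OF M this lim'] show ?thesis .
qed

lemma snorm_linear_le:
  assumes X: "seminormed_space X" and "v \<in> vecs X" "w \<in> vecs X" "v' \<in> vecs X" "w' \<in> vecs X"
  shows "snorm X ((c *\<^sub>R v + d *\<^sub>R w) - (c *\<^sub>R v' + d *\<^sub>R w')) \<le> \<bar>c\<bar> * snorm X (v - v') + \<bar>d\<bar> * snorm X (w - w')"
proof -
  note X' = seminormed_spaceD[OF X]
  have 1: "v - v' \<in> vecs X" "w - w' \<in> vecs X" using assms by (auto intro: subspace_diff[OF X'(1)])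
  have eq: "(c *\<^sub>R v + d *\<^sub>R w) - (c *\<^sub>R v' + d *\<^sub>R w') = c *\<^sub>R (v - v') + d *\<^sub>R (w - w')"
    by (simp add: algebra_simps)
  have "snorm X (c *\<^sub>R (v - v') + d *\<^sub>R (w - w')) \<le> snorm X (c *\<^sub>R (v - v')) + snorm X (d *\<^sub>R (w - w'))"
    by (intro X'(4) subspace_scale[OF X'(1)] 1)
  then show ?thesis unfolding eq by (simp add: X'(3)[OF 1(1)] X'(3)[OF 1(2)])
qed

lemma subspace_lincomb: "subspace S \<Longrightarrow> v \<in> S \<Longrightarrow> w \<in> S \<Longrightarrow> c *\<^sub>R v + d *\<^sub>R w \<in> S"
  by (intro subspace_add subspace_scale)

lemma strongly_measurable_linear:
  assumes X: "seminormed_space X" and f: "strongly_measurable M X f" and g: "strongly_measurable M X g"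
  shows "strongly_measurable M X (\<lambda>t. c *\<^sub>R f t + d *\<^sub>R g t)"
proof -
  note X' = seminormed_spaceD[OF X]
  obtain s where s: "\<And>i. simple_function M (s i)" "\<And>i. s i ` space M \<subseteq> vecs X"
    and slim: "AE t in M. (\<lambda>i. snorm X (f t - s i t)) \<longlonglongrightarrow> 0" and fX: "AE t in M. f t \<in> vecs X"
    using f unfolding strongly_measurable_def by blast
  obtain r where r: "\<And>i. simple_function M (r i)" "\<And>i. r i ` space M \<subseteq> vecs X"
    and rlim: "AE t in M. (\<lambda>i. snorm X (g t - r i t)) \<longlonglongrightarrow> 0" and gX: "AE t in M. g t \<in> vecs X"
    using g unfolding strongly_measurable_def by blast
  show ?thesis unfolding strongly_measurable_def
  proof (intro conjI exI[of _ "\<lambda>i t. c *\<^sub>R s i t + d *\<^sub>R r i t"] allI)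
    show "AE t in M. c *\<^sub>R f t + d *\<^sub>R g t \<in> vecs X"
      using fX gX by eventually_elim (rule subspace_lincomb[OF X'(1)])
    show "simple_function M (\<lambda>t. c *\<^sub>R s i t + d *\<^sub>R r i t)" for i
      by (rule simple_function_compose2[OF s(1) r(1)])
    show "(\<lambda>t. c *\<^sub>R s i t + d *\<^sub>R r i t) ` space M \<subseteq> vecs X" for i
      using s(2)[of i] r(2)[of i] by (auto intro!: subspace_lincomb[OF X'(1)])
    show "AE t in M. (\<lambda>i. snorm X (c *\<^sub>R f t + d *\<^sub>R g t - (c *\<^sub>R s i t + d *\<^sub>R r i t))) \<longlonglongrightarrow> 0"
      using slim rlim fX gX AE_space
    proof eventually_elim
      case (elim t)
      have "s i t \<in> vecs X" "r i t \<in> vecs X" for i using s(2)[of i] r(2)[of i] elim(5) by auto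
      then have le: "norm (snorm X (c *\<^sub>R f t + d *\<^sub>R g t - (c *\<^sub>R s i t + d *\<^sub>R r i t)))
          \<le> \<bar>c\<bar> * snorm X (f t - s i t) + \<bar>d\<bar> * snorm X (g t - r i t)" for i
        using snorm_linear_le[OF X elim(3,4), of "s i t" "r i t"] X'(2) by simp
      have "(\<lambda>i. \<bar>c\<bar> * snorm X (f t - s i t) + \<bar>d\<bar> * snorm X (g t - r i t)) \<longlonglongrightarrow> \<bar>c\<bar> * 0 + \<bar>d\<bar> * 0"
        by (intro tendsto_intros elim)
      then have "(\<lambda>i. \<bar>c\<bar> * snorm X (f t - s i t) + \<bar>d\<bar> * snorm X (g t - r i t)) \<longlonglongrightarrow> 0" by simp
      then show ?case by (rule Lim_null_comparison[OF always_eventually[OF allI[OF le]]])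
    qed
  qed
qed

lemma strongly_measurable_zero:
  assumes "seminormed_space X"
  shows "strongly_measurable M X (\<lambda>t. 0)"
proof -
  note X' = seminormed_spaceD[OF assms]
  have "snorm X 0 = 0" using X'(3)[OF subspace_0[OF X'(1)], of 0] by simp
  then show ?thesis unfolding strongly_measurable_def
    using subspace_0[OF X'(1)] by (intro conjI exI[of _ "\<lambda>i t. 0"]) auto
qed

lemma subspaceI_lincomb:
  assumes "0 \<in> S" "\<And>v w c d. v \<in> S \<Longrightarrow> w \<in> S \<Longrightarrow> c *\<^sub>R v + d *\<^sub>R w \<in> S"
  shows "subspace S"
proof (rule subspaceI)
  show "0 \<in> S" by fact
  show "x + y \<in> S" if "x \<in> S" "y \<in> S" for x y using assms(2)[OF that, of 1 1] by simp
  show "c *\<^sub>R x \<in> S" if "x \<in> S" for c x using assms(2)[OF that that, of c 0] by simp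
qed

lemma vecs_bochner_L2:
  "vecs (bochner_L2 I X) = {f. strongly_measurable (lebesgue_on I) X f \<and>
     (\<integral>\<^sup>+ t. ennreal ((snorm X (f t))\<^sup>2) \<partial>lebesgue_on I) < \<infinity>}"
  by (simp add: bochner_L2_def)

lemma lincomb_fun: "c *\<^sub>R f + d *\<^sub>R g = (\<lambda>t. c *\<^sub>R f t + d *\<^sub>R g t)"
  by (simp add: plus_fun_def scaleR_fun_def)

lemma subspace_bochner_L2:
  assumes X: "seminormed_space X" and I: "I \<in> sets lebesgue"
  shows "subspace (vecs (bochner_L2 I X))"
proof (rule subspaceI_lincomb)
  note X' = seminormed_spaceD[OF X]
  have "snorm X 0 = 0" using X'(3)[OF subspace_0[OF X'(1)], of 0] by simp
  then show "0 \<in> vecs (bochner_L2 I X)"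
    using strongly_measurable_zero[OF X] by (simp add: vecs_bochner_L2 zero_fun_def)
  fix f g :: "real \<Rightarrow> 'a" and c d :: real
  assume "f \<in> vecs (bochner_L2 I X)" "g \<in> vecs (bochner_L2 I X)"
  then have f: "strongly_measurable (lebesgue_on I) X f" "(\<integral>\<^sup>+ t. ennreal ((snorm X (f t))\<^sup>2) \<partial>lebesgue_on I) < \<infinity>"
    and g: "strongly_measurable (lebesgue_on I) X g" "(\<integral>\<^sup>+ t. ennreal ((snorm X (g t))\<^sup>2) \<partial>lebesgue_on I) < \<infinity>"
    by (auto simp: vecs_bochner_L2)
  note fg = strongly_measurable_linear[OF X f(1) g(1)]
  note C = complete_measure_lebesgue_on[OF I]
  have sqf: "sq_int (lebesgue_on I) (\<lambda>t. snorm X (f t))"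
    using snorm_measurable[OF C X f(1)] f(2) by (auto simp: sq_int_def integrable_iff_bounded)
  have sqg: "sq_int (lebesgue_on I) (\<lambda>t. snorm X (g t))"
    using snorm_measurable[OF C X g(1)] g(2) by (auto simp: sq_int_def integrable_iff_bounded)
  have "AE t in lebesgue_on I. \<bar>snorm X (c *\<^sub>R f t + d *\<^sub>R g t)\<bar> \<le> \<bar>\<bar>c\<bar> * snorm X (f t) + \<bar>d\<bar> * snorm X (g t)\<bar>"
  proof -
    have "AE t in lebesgue_on I. f t \<in> vecs X" "AE t in lebesgue_on I. g t \<in> vecs X"
      using f(1) g(1) by (auto simp: strongly_measurable_def)
    then show ?thesis
    proof eventually_elim
      case (elim t)
      then show ?case using snorm_linear_le[OF X elim subspace_0[OF X'(1)] subspace_0[OF X'(1)], of c d] X'(2)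
        by (simp add: abs_of_nonneg)
    qed
  qed
  then have "sq_int (lebesgue_on I) (\<lambda>t. snorm X (c *\<^sub>R f t + d *\<^sub>R g t))"
    by (rule sq_int_bound(1)[OF sq_int_add[OF sq_int_cmult(1)[OF sqf] sq_int_cmult(1)[OF sqg]] snorm_measurable[OF C X fg]])
  then show "c *\<^sub>R f + d *\<^sub>R g \<in> vecs (bochner_L2 I X)"
    using fg by (auto simp: vecs_bochner_L2 sq_int_def lincomb_fun integrable_iff_bounded)
qed

text \<open>The approximating sequences are combined linearly. Both error terms are then controlled
  by \<open>snorm_linear_le\<close>.\<close>

lemma has_bochner_integral_in_linear:
  assumes C: "complete_measure M" and X: "seminormed_space X"
    and f: "has_bochner_integral_in M X f v" and g: "has_bochner_integral_in M X g w"
  shows "has_bochner_integral_in M X (\<lambda>t. c *\<^sub>R f t + d *\<^sub>R g t) (c *\<^sub>R v + d *\<^sub>R w)"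
proof -
  note X' = seminormed_spaceD[OF X]
  let ?I = "Bochner_Integration.simple_bochner_integral M"
  obtain s where s: "\<And>i. Bochner_Integration.simple_bochner_integrable M (s i)" "\<And>i. s i ` space M \<subseteq> vecs X"
    and slim: "(\<lambda>i. \<integral>\<^sup>+ t. ennreal (snorm X (f t - s i t)) \<partial>M) \<longlonglongrightarrow> 0" "(\<lambda>i. snorm X (?I (s i) - v)) \<longlonglongrightarrow> 0"
    and fm: "strongly_measurable M X f" and v: "v \<in> vecs X"
    using f unfolding has_bochner_integral_in_def by blast
  obtain r where r: "\<And>i. Bochner_Integration.simple_bochner_integrable M (r i)" "\<And>i. r i ` space M \<subseteq> vecs X"
    and rlim: "(\<lambda>i. \<integral>\<^sup>+ t. ennreal (snorm X (g t - r i t)) \<partial>M) \<longlonglongrightarrow> 0" "(\<lambda>i. snorm X (?I (r i) - w)) \<longlonglongrightarrow> 0"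
    and gm: "strongly_measurable M X g" and w: "w \<in> vecs X"
    using g unfolding has_bochner_integral_in_def by blast
  have fX: "AE t in M. f t \<in> vecs X" and gX: "AE t in M. g t \<in> vecs X"
    using fm gm by (auto simp: strongly_measurable_def)
  have sm: "strongly_measurable M X h" if h: "simple_function M h" "h ` space M \<subseteq> vecs X" for h
  proof -
    have "snorm X 0 = 0" using X'(3)[OF subspace_0[OF X'(1)], of 0] by simp
    then show ?thesis unfolding strongly_measurable_def
      using h by (intro conjI exI[of _ "\<lambda>i. h"] AE_I2) auto
  qed
  have simp_fun: "simple_function M h" if "Bochner_Integration.simple_bochner_integrable M h" for h :: "'a \<Rightarrow> 'b"
    using that by (auto elim: simple_bochner_integrable.cases)
  \<comment> \<open>The nonnegative integral is additive on measurable integrands; this is where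
    completeness of the measure enters.\<close>
  have dm: "(\<lambda>t. snorm X (f t - s i t)) \<in> borel_measurable M" "(\<lambda>t. snorm X (g t - r i t)) \<in> borel_measurable M" for i
    using snorm_measurable[OF C X strongly_measurable_linear[OF X fm sm[OF simp_fun[OF s(1)] s(2)], of 1 "-1" i]]
      snorm_measurable[OF C X strongly_measurable_linear[OF X gm sm[OF simp_fun[OF r(1)] r(2)], of 1 "-1" i]]
    by simp_all
  have Iin: "?I h \<in> vecs X" if h: "h ` space M \<subseteq> vecs X" for h
    unfolding simple_bochner_integral_def
    using h by (intro subspace_sum[OF X'(1)] subspace_scale[OF X'(1)]) auto
  have sb: "Bochner_Integration.simple_bochner_integrable M (\<lambda>t. c *\<^sub>R s i t + d *\<^sub>R r i t)" for i
    using simple_bochner_integrable_compose2[OF _ s(1) r(1), of "\<lambda>x y. c *\<^sub>R x + d *\<^sub>R y"] by simp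
  have Ilin: "?I (\<lambda>t. c *\<^sub>R s i t + d *\<^sub>R r i t) = c *\<^sub>R ?I (s i) + d *\<^sub>R ?I (r i)" for i
  proof -
    have lin: "linear (\<lambda>x::'b. a *\<^sub>R x)" for a by (simp add: linear_scale_self)
    have "?I (\<lambda>t. c *\<^sub>R s i t + d *\<^sub>R r i t) = ?I (\<lambda>t. c *\<^sub>R s i t) + ?I (\<lambda>t. d *\<^sub>R r i t)"
      by (rule simple_bochner_integral_add)
        (rule simple_bochner_integrable_compose2[OF _ s(1) s(1), of "\<lambda>x y. c *\<^sub>R x"]
          simple_bochner_integrable_compose2[OF _ r(1) r(1), of "\<lambda>x y. d *\<^sub>R x"], simp)+
    then show ?thesis using simple_bochner_integral_linear[OF lin s(1)] simple_bochner_integral_linear[OF lin r(1)] by simp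
  qed
  show ?thesis unfolding has_bochner_integral_in_def
  proof (intro conjI exI[of _ "\<lambda>i t. c *\<^sub>R s i t + d *\<^sub>R r i t"] allI)
    show "strongly_measurable M X (\<lambda>t. c *\<^sub>R f t + d *\<^sub>R g t)" by (rule strongly_measurable_linear[OF X fm gm])
    show "c *\<^sub>R v + d *\<^sub>R w \<in> vecs X" by (rule subspace_lincomb[OF X'(1) v w])
    show "Bochner_Integration.simple_bochner_integrable M (\<lambda>t. c *\<^sub>R s i t + d *\<^sub>R r i t)" for i by (rule sb)
    show "(\<lambda>t. c *\<^sub>R s i t + d *\<^sub>R r i t) ` space M \<subseteq> vecs X" for i
      using s(2)[of i] r(2)[of i] by (auto intro!: subspace_lincomb[OF X'(1)])
    show "(\<lambda>i. \<integral>\<^sup>+ t. ennreal (snorm X (c *\<^sub>R f t + d *\<^sub>R g t - (c *\<^sub>R s i t + d *\<^sub>R r i t))) \<partial>M) \<longlonglongrightarrow> 0"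
    proof (rule tendsto_sandwich[OF always_eventually[OF allI[OF zero_le]] _ tendsto_const])
      show "\<forall>\<^sub>F i in sequentially. (\<integral>\<^sup>+ t. ennreal (snorm X (c *\<^sub>R f t + d *\<^sub>R g t - (c *\<^sub>R s i t + d *\<^sub>R r i t))) \<partial>M)
         \<le> ennreal \<bar>c\<bar> * (\<integral>\<^sup>+ t. ennreal (snorm X (f t - s i t)) \<partial>M) + ennreal \<bar>d\<bar> * (\<integral>\<^sup>+ t. ennreal (snorm X (g t - r i t)) \<partial>M)"
      proof (intro always_eventually allI)
        fix i
        have "(\<integral>\<^sup>+ t. ennreal (snorm X (c *\<^sub>R f t + d *\<^sub>R g t - (c *\<^sub>R s i t + d *\<^sub>R r i t))) \<partial>M)
          \<le> (\<integral>\<^sup>+ t. ennreal \<bar>c\<bar> * ennreal (snorm X (f t - s i t)) + ennreal \<bar>d\<bar> * ennreal (snorm X (g t - r i t)) \<partial>M)"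
        proof (rule nn_integral_mono_AE)
          show "AE t in M. ennreal (snorm X (c *\<^sub>R f t + d *\<^sub>R g t - (c *\<^sub>R s i t + d *\<^sub>R r i t)))
             \<le> ennreal \<bar>c\<bar> * ennreal (snorm X (f t - s i t)) + ennreal \<bar>d\<bar> * ennreal (snorm X (g t - r i t))"
            using fX gX AE_space
          proof eventually_elim
            case (elim t)
            have "s i t \<in> vecs X" "r i t \<in> vecs X" using s(2)[of i] r(2)[of i] elim(3) by auto
            then show ?case using snorm_linear_le[OF X elim(1,2), of "s i t" "r i t" c d] X'(2)
              by (simp add: ennreal_mult[symmetric] ennreal_plus[symmetric] del: ennreal_plus)
          qed
        qed
        also have "\<dots> = ennreal \<bar>c\<bar> * (\<integral>\<^sup>+ t. ennreal (snorm X (f t - s i t)) \<partial>M) + ennreal \<bar>d\<bar> * (\<integral>\<^sup>+ t. ennreal (snorm X (g t - r i t)) \<partial>M)"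
          using dm[of i] by (simp add: nn_integral_add nn_integral_cmult)
        finally show "(\<integral>\<^sup>+ t. ennreal (snorm X (c *\<^sub>R f t + d *\<^sub>R g t - (c *\<^sub>R s i t + d *\<^sub>R r i t))) \<partial>M)
         \<le> ennreal \<bar>c\<bar> * (\<integral>\<^sup>+ t. ennreal (snorm X (f t - s i t)) \<partial>M) + ennreal \<bar>d\<bar> * (\<integral>\<^sup>+ t. ennreal (snorm X (g t - r i t)) \<partial>M)" .
      qed
      have "(\<lambda>i. ennreal \<bar>c\<bar> * (\<integral>\<^sup>+ t. ennreal (snorm X (f t - s i t)) \<partial>M) + ennreal \<bar>d\<bar> * (\<integral>\<^sup>+ t. ennreal (snorm X (g t - r i t)) \<partial>M))
         \<longlonglongrightarrow> ennreal \<bar>c\<bar> * 0 + ennreal \<bar>d\<bar> * 0"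
        by (intro tendsto_add ennreal_tendsto_cmult slim rlim) auto
      then show "(\<lambda>i. ennreal \<bar>c\<bar> * (\<integral>\<^sup>+ t. ennreal (snorm X (f t - s i t)) \<partial>M) + ennreal \<bar>d\<bar> * (\<integral>\<^sup>+ t. ennreal (snorm X (g t - r i t)) \<partial>M)) \<longlonglongrightarrow> 0"
        by simp
    qed
    show "(\<lambda>i. snorm X (?I (\<lambda>t. c *\<^sub>R s i t + d *\<^sub>R r i t) - (c *\<^sub>R v + d *\<^sub>R w))) \<longlonglongrightarrow> 0"
    proof (rule Lim_null_comparison[OF always_eventually])
      show "\<forall>i. norm (snorm X (?I (\<lambda>t. c *\<^sub>R s i t + d *\<^sub>R r i t) - (c *\<^sub>R v + d *\<^sub>R w)))
         \<le> \<bar>c\<bar> * snorm X (?I (s i) - v) + \<bar>d\<bar> * snorm X (?I (r i) - w)"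
        unfolding Ilin using snorm_linear_le[OF X Iin[OF s(2)] Iin[OF r(2)] v w] X'(2) by simp
      have "(\<lambda>i. \<bar>c\<bar> * snorm X (?I (s i) - v) + \<bar>d\<bar> * snorm X (?I (r i) - w)) \<longlonglongrightarrow> \<bar>c\<bar> * 0 + \<bar>d\<bar> * 0"
        by (intro tendsto_intros slim rlim)
      then show "(\<lambda>i. \<bar>c\<bar> * snorm X (?I (s i) - v) + \<bar>d\<bar> * snorm X (?I (r i) - w)) \<longlonglongrightarrow> 0" by simp
    qed
  qed
qed

lemma has_weak_deriv_linear:
  assumes X: "seminormed_space X" and I: "I \<in> sets lebesgue"
    and "has_weak_deriv I X f f'" "has_weak_deriv I X g g'"
  shows "has_weak_deriv I X (\<lambda>t. c *\<^sub>R f t + d *\<^sub>R g t) (\<lambda>t. c *\<^sub>R f' t + d *\<^sub>R g' t)"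
  unfolding has_weak_deriv_def
proof
  note C = complete_measure_lebesgue_on[OF I]
  fix \<phi> assume \<phi>: "\<phi> \<in> test_functions I"
  obtain v where v: "has_bochner_integral_in (lebesgue_on I) X (\<lambda>t. deriv \<phi> t *\<^sub>R f t) v"
     "has_bochner_integral_in (lebesgue_on I) X (\<lambda>t. \<phi> t *\<^sub>R f' t) (- v)"
    using assms(3) \<phi> unfolding has_weak_deriv_def by blast
  obtain w where w: "has_bochner_integral_in (lebesgue_on I) X (\<lambda>t. deriv \<phi> t *\<^sub>R g t) w"
     "has_bochner_integral_in (lebesgue_on I) X (\<lambda>t. \<phi> t *\<^sub>R g' t) (- w)"
    using assms(4) \<phi> unfolding has_weak_deriv_def by blast
  have 1: "c *\<^sub>R (a *\<^sub>R x) + d *\<^sub>R (a *\<^sub>R y) = a *\<^sub>R (c *\<^sub>R x + d *\<^sub>R y)" for a and x y :: 'a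
    by (simp add: algebra_simps)
  have 2: "c *\<^sub>R - v + d *\<^sub>R - w = - (c *\<^sub>R v + d *\<^sub>R w)" by simp
  show "\<exists>v. has_bochner_integral_in (lebesgue_on I) X (\<lambda>t. deriv \<phi> t *\<^sub>R (c *\<^sub>R f t + d *\<^sub>R g t)) v \<and>
     has_bochner_integral_in (lebesgue_on I) X (\<lambda>t. \<phi> t *\<^sub>R (c *\<^sub>R f' t + d *\<^sub>R g' t)) (- v)"
    using has_bochner_integral_in_linear[OF C X v(1) w(1), of c d] has_bochner_integral_in_linear[OF C X v(2) w(2), of c d]
    unfolding 1 2 by blast
qed

lemma vecs_bochner_H1:
  "vecs (bochner_H1 I X) = {f \<in> vecs (bochner_L2 I X). \<exists>g\<in>vecs (bochner_L2 I X). has_weak_deriv I X f g}"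
  by (simp add: bochner_H1_def)

lemma has_bochner_integral_in_zero:
  fixes X :: "'b::real_vector seminormed"
  assumes X: "seminormed_space X"
  shows "has_bochner_integral_in M X (\<lambda>t. 0) 0"
proof -
  note X' = seminormed_spaceD[OF X]
  have "snorm X 0 = 0" using X'(3)[OF subspace_0[OF X'(1)], of 0] by simp
  moreover have "Bochner_Integration.simple_bochner_integrable M (\<lambda>t. 0 :: 'b)"
    by (auto intro: simple_bochner_integrable.intros)
  moreover have "Bochner_Integration.simple_bochner_integral M (\<lambda>t. 0 :: 'b) = 0"
    by (auto simp: simple_bochner_integral_def intro: sum.neutral)
  ultimately show ?thesis unfolding has_bochner_integral_in_def
    using strongly_measurable_zero[OF X] subspace_0[OF X'(1)]
    by (intro conjI exI[of _ "\<lambda>i t. 0"]) auto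
qed

lemma subspace_bochner_H1:
  assumes X: "seminormed_space X" and I: "I \<in> sets lebesgue"
  shows "subspace (vecs (bochner_H1 I X))"
proof (rule subspaceI_lincomb)
  note S = subspace_bochner_L2[OF X I]
  have "has_weak_deriv I X 0 0"
    unfolding has_weak_deriv_def
    by (intro ballI exI[of _ 0]) (simp add: has_bochner_integral_in_zero[OF X])
  then show "0 \<in> vecs (bochner_H1 I X)" using subspace_0[OF S] by (auto simp: vecs_bochner_H1)
  fix f g :: "real \<Rightarrow> 'a" and c d :: real
  assume "f \<in> vecs (bochner_H1 I X)" "g \<in> vecs (bochner_H1 I X)"
  then obtain f' g' where fg: "f \<in> vecs (bochner_L2 I X)" "g \<in> vecs (bochner_L2 I X)"
    "f' \<in> vecs (bochner_L2 I X)" "g' \<in> vecs (bochner_L2 I X)" "has_weak_deriv I X f f'" "has_weak_deriv I X g g'"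
    by (auto simp: vecs_bochner_H1)
  have "has_weak_deriv I X (c *\<^sub>R f + d *\<^sub>R g) (c *\<^sub>R f' + d *\<^sub>R g')"
    using has_weak_deriv_linear[OF X I fg(5,6)] by (simp add: lincomb_fun)
  then show "c *\<^sub>R f + d *\<^sub>R g \<in> vecs (bochner_H1 I X)"
    using subspace_lincomb[OF S fg(1,2)] subspace_lincomb[OF S fg(3,4)] unfolding vecs_bochner_H1 by blast
qed

lemma weak_deriv_works:
  assumes "f \<in> vecs (bochner_H1 I X)"
  shows "weak_deriv I X f \<in> vecs (bochner_L2 I X)" "has_weak_deriv I X f (weak_deriv I X f)"
proof -
  have "\<exists>g. g \<in> vecs (bochner_L2 I X) \<and> has_weak_deriv I X f g" using assms by (auto simp: vecs_bochner_H1)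
  from someI_ex[OF this] show "weak_deriv I X f \<in> vecs (bochner_L2 I X)" "has_weak_deriv I X f (weak_deriv I X f)"
    unfolding weak_deriv_def[symmetric] by auto
qed

section \<open>Functionals on Bochner spaces\<close>

lemma bochner_L2_functional:
  assumes I: "I \<in> sets lebesgue" and X: "subspace (vecs X)" and l: "bdd_functional X l C"
    and f: "f \<in> vecs (bochner_L2 I X)"
  shows "sq_int (lebesgue_on I) (\<lambda>t. l (f t))"
    "sq_norm (lebesgue_on I) (\<lambda>t. l (f t)) \<le> C * snorm (bochner_L2 I X) f"
proof -
  let ?M = "lebesgue_on I"
  have sm: "strongly_measurable ?M X f" and fin: "(\<integral>\<^sup>+ t. ennreal ((snorm X (f t))\<^sup>2) \<partial>?M) < \<infinity>"
    using f by (auto simp: vecs_bochner_L2)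
  have fX: "AE t in ?M. f t \<in> vecs X" using sm by (auto simp: strongly_measurable_def)
  have meas: "(\<lambda>t. l (f t)) \<in> borel_measurable ?M"
    by (rule bdd_functional_measurable[OF complete_measure_lebesgue_on[OF I] X l sm])
  have C: "0 \<le> C" by (rule bdd_functionalD(1)[OF l])
  have "sq_int ?M (\<lambda>t. l (f t)) \<and> sq_norm ?M (\<lambda>t. l (f t)) \<le> C * snorm (bochner_L2 I X) f"
  proof (cases "C = 0")
    case True
    have z: "AE t in ?M. l (f t) = 0"
      using fX by eventually_elim (use bdd_functionalD(4)[OF l] True in auto)
    then have "AE t in ?M. \<bar>l (f t)\<bar> \<le> \<bar>0\<bar>" by eventually_elim simp
    from sq_int_bound[OF sq_int_zero meas this] show ?thesis using True by (simp add: sq_norm_def)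
  next
    case False
    \<comment> \<open>Dividing by \<open>C\<close> first avoids pulling it out of the integral of the possibly non-measurable \<open>snorm X (f t)\<close>.\<close>
    have le: "(\<integral>\<^sup>+ t. ennreal ((l (f t) / C)\<^sup>2) \<partial>?M) \<le> (\<integral>\<^sup>+ t. ennreal ((snorm X (f t))\<^sup>2) \<partial>?M)"
    proof (rule nn_integral_mono_AE)
      show "AE t in ?M. ennreal ((l (f t) / C)\<^sup>2) \<le> ennreal ((snorm X (f t))\<^sup>2)"
        using fX
      proof eventually_elim
        case (elim t)
        have "\<bar>l (f t)\<bar> \<le> C * snorm X (f t)" by (rule bdd_functionalD(4)[OF l elim])
        then have "\<bar>l (f t) / C\<bar> \<le> snorm X (f t)" using False C by (simp add: field_simps)
        then show ?case by (intro ennreal_leI) (metis abs_le_square_iff abs_ge_zero abs_of_nonneg order_trans)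
      qed
    qed
    have i: "integrable ?M (\<lambda>t. (l (f t) / C)\<^sup>2)"
      using le fin meas by (auto simp: integrable_iff_bounded)
    then have sq: "sq_int ?M (\<lambda>t. l (f t) / C)" using meas by (auto simp: sq_int_def)
    have "(\<integral>t. (l (f t) / C)\<^sup>2 \<partial>?M) = enn2real (\<integral>\<^sup>+ t. ennreal ((l (f t) / C)\<^sup>2) \<partial>?M)"
      by (intro integral_eq_nn_integral) (use meas in auto)
    also have "\<dots> \<le> enn2real (\<integral>\<^sup>+ t. ennreal ((snorm X (f t))\<^sup>2) \<partial>?M)"
      using le fin by (intro enn2real_mono) auto
    finally have "sq_norm ?M (\<lambda>t. l (f t) / C) \<le> snorm (bochner_L2 I X) f"
      by (simp add: sq_norm_def bochner_L2_def)
    then show ?thesis using sq_int_cmult[OF sq, of C] False C by (simp add: mult_left_mono)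
  qed
  then show "sq_int ?M (\<lambda>t. l (f t))" "sq_norm ?M (\<lambda>t. l (f t)) \<le> C * snorm (bochner_L2 I X) f" by auto
qed

lemma bdd_functional_bochner_H1:
  assumes "bdd_functional (bochner_L2 I X) l C"
  shows "bdd_functional (bochner_H1 I X) l C"
proof -
  have le: "snorm (bochner_L2 I X) f \<le> snorm (bochner_H1 I X) f" for f
    by (simp add: bochner_H1_def bochner_L2_def real_le_rsqrt)
  have "\<bar>l f\<bar> \<le> C * snorm (bochner_H1 I X) f" if "f \<in> vecs (bochner_L2 I X)" for f
    by (rule order_trans[OF bdd_functionalD(4)[OF assms that]])
      (intro mult_left_mono le bdd_functionalD(1)[OF assms])
  then show ?thesis using assms by (simp add: bdd_functional_def vecs_bochner_H1)
qed

text \<open>A functional on the values becomes a functional on the Bochner space by integration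
  against a fixed function, and the bounds multiply. This step takes the pairing in the space
  variable to the one in \<open>\<tau>\<close>.\<close>

lemma bdd_functional_bochner_L2:
  assumes I: "I \<in> sets lebesgue" and X: "subspace (vecs X)" and l: "bdd_functional X l C"
    and \<psi>: "sq_int (lebesgue_on I) \<psi>"
  shows "bdd_functional (bochner_L2 I X) (\<lambda>f. \<integral>t. \<psi> t * l (f t) \<partial>lebesgue_on I) (sq_norm (lebesgue_on I) \<psi> * C)"
proof -
  note lf = bochner_L2_functional[OF I X l]
  have int: "integrable (lebesgue_on I) (\<lambda>t. \<psi> t * l (f t))" if "f \<in> vecs (bochner_L2 I X)" for f
    by (rule sq_int_mult_integrable[OF \<psi> lf(1)[OF that]])
  have fX: "AE t in lebesgue_on I. f t \<in> vecs X" if "f \<in> vecs (bochner_L2 I X)" for f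
    using that by (auto simp: vecs_bochner_L2 strongly_measurable_def)
  show ?thesis unfolding bdd_functional_def
  proof (intro conjI ballI allI)
    show "0 \<le> sq_norm (lebesgue_on I) \<psi> * C" using bdd_functionalD(1)[OF l] by simp
    fix f assume f: "f \<in> vecs (bochner_L2 I X)"
    show "\<bar>\<integral>t. \<psi> t * l (f t) \<partial>lebesgue_on I\<bar> \<le> sq_norm (lebesgue_on I) \<psi> * C * snorm (bochner_L2 I X) f"
      using order_trans[OF sq_norm_cauchy_schwarz[OF \<psi> lf(1)[OF f]] mult_left_mono[OF lf(2)[OF f] sq_norm_nonneg]]
      by (simp add: mult.assoc)
    fix c
    have "(\<integral>t. \<psi> t * l ((c *\<^sub>R f) t) \<partial>lebesgue_on I) = (\<integral>t. c * (\<psi> t * l (f t)) \<partial>lebesgue_on I)"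
      unfolding scaleR_fun_def
    proof (rule integral_cong_AE)
      show "AE t in lebesgue_on I. \<psi> t * l (c *\<^sub>R f t) = c * (\<psi> t * l (f t))"
        using fX[OF f] by eventually_elim (simp add: bdd_functionalD(3)[OF l])
      show "(\<lambda>t. c * (\<psi> t * l (f t))) \<in> borel_measurable (lebesgue_on I)" using int[OF f] by auto
      have "strongly_measurable (lebesgue_on I) X f" using f by (simp add: vecs_bochner_L2)
      have "(\<lambda>t. l (c *\<^sub>R f t)) \<in> borel_measurable (lebesgue_on I)"
      \<comment> \<open>Linearity of \<open>l\<close> is known only on the carrier, hence for almost
        every \<open>t\<close>. The constant sequence turns the lemma on limits into the statement
        that a function equal almost everywhere to a measurable one is measurable.\<close>
      proof (rule complete_measure.borel_measurable_AE_limit[OF complete_measure_lebesgue_on[OF I]])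
        show "(\<lambda>t. c * l (f t)) \<in> borel_measurable (lebesgue_on I)" for i :: nat
          using lf(1)[OF f] by (auto simp: sq_int_def)
        show "AE t in lebesgue_on I. (\<lambda>i::nat. c * l (f t)) \<longlonglongrightarrow> l (c *\<^sub>R f t)"
          using fX[OF f] by eventually_elim (simp add: bdd_functionalD(3)[OF l])
      qed
      then show "(\<lambda>t. \<psi> t * l (c *\<^sub>R f t)) \<in> borel_measurable (lebesgue_on I)"
        using sq_intD(1)[OF \<psi>] by simp
    qed
    then show "(\<integral>t. \<psi> t * l ((c *\<^sub>R f) t) \<partial>lebesgue_on I) = c * (\<integral>t. \<psi> t * l (f t) \<partial>lebesgue_on I)" by simp
    fix g assume g: "g \<in> vecs (bochner_L2 I X)"
    have "(\<integral>t. \<psi> t * l ((f + g) t) \<partial>lebesgue_on I) = (\<integral>t. \<psi> t * l (f t) + \<psi> t * l (g t) \<partial>lebesgue_on I)"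
      unfolding plus_fun_def
    proof (rule integral_cong_AE)
      show "AE t in lebesgue_on I. \<psi> t * l (f t + g t) = \<psi> t * l (f t) + \<psi> t * l (g t)"
        using fX[OF f] fX[OF g] by eventually_elim (simp add: bdd_functionalD(2)[OF l] distrib_left)
      show "(\<lambda>t. \<psi> t * l (f t) + \<psi> t * l (g t)) \<in> borel_measurable (lebesgue_on I)" using int[OF f] int[OF g] by auto
      have "(\<lambda>t. l (f t + g t)) \<in> borel_measurable (lebesgue_on I)"
      proof (rule complete_measure.borel_measurable_AE_limit[OF complete_measure_lebesgue_on[OF I]])
        show "(\<lambda>t. l (f t) + l (g t)) \<in> borel_measurable (lebesgue_on I)" for i :: nat
          using lf(1)[OF f] lf(1)[OF g] by (auto simp: sq_int_def)
        show "AE t in lebesgue_on I. (\<lambda>i::nat. l (f t) + l (g t)) \<longlonglongrightarrow> l (f t + g t)"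
          using fX[OF f] fX[OF g] by eventually_elim (simp add: bdd_functionalD(2)[OF l])
      qed
      then show "(\<lambda>t. \<psi> t * l (f t + g t)) \<in> borel_measurable (lebesgue_on I)"
        using sq_intD(1)[OF \<psi>] by simp
    qed
    then show "(\<integral>t. \<psi> t * l ((f + g) t) \<partial>lebesgue_on I) = (\<integral>t. \<psi> t * l (f t) \<partial>lebesgue_on I) + (\<integral>t. \<psi> t * l (g t) \<partial>lebesgue_on I)"
      using int[OF f] int[OF g] by simp
  qed
qed

text \<open>The functional maps simple functions to simple functions and commutes with their
  integrals, which are finite sums. Its bound then carries both limits in the definition of the
  Bochner integral over to the real line.\<close>

lemma has_bochner_integral_functional:
  assumes M: "complete_measure M" and X: "subspace (vecs X)" and l: "bdd_functional X l C"
    and f: "has_bochner_integral_in M X f v"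
  shows "has_bochner_integral M (\<lambda>t. l (f t)) (l v)"
proof -
  let ?I = "Bochner_Integration.simple_bochner_integral M"
  obtain s where s: "\<And>i. Bochner_Integration.simple_bochner_integrable M (s i)" "\<And>i. s i ` space M \<subseteq> vecs X"
    and slim: "(\<lambda>i. \<integral>\<^sup>+ t. ennreal (snorm X (f t - s i t)) \<partial>M) \<longlonglongrightarrow> 0" "(\<lambda>i. snorm X (?I (s i) - v)) \<longlonglongrightarrow> 0"
    and fm: "strongly_measurable M X f" and v: "v \<in> vecs X"
    using f unfolding has_bochner_integral_in_def by blast
  have fX: "AE t in M. f t \<in> vecs X" using fm by (auto simp: strongly_measurable_def)
  \<comment> \<open>Division by \<open>D\<close> makes the functional bounded by the seminorm
    itself, so the error integrals can be compared without moving a constant out of an integral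
    whose integrand may not be measurable. The value 1 covers \<open>C = 0\<close>, where the
    functional vanishes on the carrier.\<close>
  define D where "D = (if C = 0 then 1 else C)"
  have D: "0 < D" using bdd_functionalD(1)[OF l] by (auto simp: D_def)
  have lD: "ennreal (\<bar>l x\<bar> / D) \<le> ennreal (snorm X x)" if "x \<in> vecs X" for x
    using bdd_functionalD(4)[OF l that] D
    by (cases "C = 0") (auto simp: D_def field_simps intro!: ennreal_leI)
  have ls0: "l 0 = 0" using bdd_functionalD(3)[OF l subspace_0[OF X], of 0] by simp
  have lI: "?I (\<lambda>t. l (s i t)) = l (?I (s i))" for i
  proof -
    have sf: "simple_function M (s i)" using s(1)[of i] by (auto elim: simple_bochner_integrable.cases)
    \<comment> \<open>The sum is taken over the level sets of \<open>s i\<close> and not over those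
      of its image under \<open>l\<close>, so that it matches the sum that defines the integral of
      \<open>s i\<close>.\<close>
    have "?I (\<lambda>t. l (s i t)) = (\<Sum>y\<in>s i ` space M. measure M {t \<in> space M. s i t = y} *\<^sub>R l y)"
      by (rule simple_bochner_integral_partition)
        (use simple_bochner_integrable_compose2[OF _ s(1) s(1), of "\<lambda>x y. l x"] sf ls0 in auto)
    also have "\<dots> = l (?I (s i))"
      unfolding simple_bochner_integral_def real_scaleR_def
      by (rule bdd_functional_sum[OF X l, symmetric])
        (use simple_functionD(1)[OF sf] s(2)[of i] in auto)
    finally show ?thesis .
  qed
  have Iin: "?I (s i) \<in> vecs X" for i
    unfolding simple_bochner_integral_def
    using s(2)[of i] by (intro subspace_sum[OF X] subspace_scale[OF X]) auto
  have meas: "(\<lambda>t. l (f t)) \<in> borel_measurable M" by (rule bdd_functional_measurable[OF M X l fm])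
  have i1: "(\<lambda>t. l (f t) / D) \<in> borel_measurable M" using meas by simp
  have i2: "Bochner_Integration.simple_bochner_integrable M (\<lambda>t. l (s i t) / D)" for i
    using simple_bochner_integrable_compose2[OF _ s(1) s(1), of "\<lambda>x y. l x / D"] ls0 by simp
  have i3: "(\<lambda>i. \<integral>\<^sup>+ t. ennreal (norm (l (f t) / D - l (s i t) / D)) \<partial>M) \<longlonglongrightarrow> 0"
  proof (rule tendsto_sandwich[OF always_eventually[OF allI[OF zero_le]] _ tendsto_const slim(1)])
    show "\<forall>\<^sub>F i in sequentially. (\<integral>\<^sup>+ t. ennreal (norm (l (f t) / D - l (s i t) / D)) \<partial>M)
        \<le> (\<integral>\<^sup>+ t. ennreal (snorm X (f t - s i t)) \<partial>M)"
    proof (rule always_eventually, rule allI, rule nn_integral_mono_AE)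
      fix i
      show "AE t in M. ennreal (norm (l (f t) / D - l (s i t) / D)) \<le> ennreal (snorm X (f t - s i t))"
        using fX AE_space
      proof eventually_elim
        case (elim t)
        have sX: "s i t \<in> vecs X" using s(2)[of i] elim(2) by auto
        have "norm (l (f t) / D - l (s i t) / D) = \<bar>l (f t - s i t)\<bar> / D"
          using D unfolding bdd_functional_diff[OF X l elim(1) sX] by (simp add: diff_divide_distrib[symmetric])
        then show ?case using lD[OF subspace_diff[OF X elim(1) sX]] by simp
      qed
    qed
  qed
  have i4: "(\<lambda>i. ?I (\<lambda>t. l (s i t) / D)) \<longlonglongrightarrow> l v / D"
  proof -
    have "(\<lambda>i. l (?I (s i)) - l v) \<longlonglongrightarrow> 0"
    proof (rule Lim_null_comparison[OF always_eventually])
      show "\<forall>i. norm (l (?I (s i)) - l v) \<le> C * snorm X (?I (s i) - v)"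
      proof
        fix i
        show "norm (l (?I (s i)) - l v) \<le> C * snorm X (?I (s i) - v)"
          using bdd_functionalD(4)[OF l subspace_diff[OF X Iin[of i] v]]
          unfolding bdd_functional_diff[OF X l Iin v] by simp
      qed
      show "(\<lambda>i. C * snorm X (?I (s i) - v)) \<longlonglongrightarrow> 0" by (rule tendsto_mult_right_zero[OF slim(2)])
    qed
    then have "(\<lambda>i. l (?I (s i))) \<longlonglongrightarrow> l v" by (simp add: LIM_zero_iff)
    then have "(\<lambda>i. l (?I (s i)) / D) \<longlonglongrightarrow> l v / D" using D by (intro tendsto_intros) auto
    moreover have "?I (\<lambda>t. l (s i t) / D) = l (?I (s i)) / D" for i
    proof -
      have lin: "linear (\<lambda>x::real. x / D)" by (simp add: linear_iff add_divide_distrib)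
      have "Bochner_Integration.simple_bochner_integrable M (\<lambda>t. l (s i t))"
        using simple_bochner_integrable_compose2[OF _ s(1) s(1), of "\<lambda>x y. l x"] ls0 by simp
      from simple_bochner_integral_linear[OF lin this] show ?thesis by (simp add: lI)
    qed
    ultimately show ?thesis by simp
  qed
  have "has_bochner_integral M (\<lambda>t. l (f t) / D) (l v / D)"
    by (rule has_bochner_integral.intros[OF i1 i2 i3 i4])
  then have "has_bochner_integral M (\<lambda>t. D * (l (f t) / D)) (D * (l v / D))"
    by (intro has_bochner_integral_mult_right) auto
  then show ?thesis using D by simp
qed

lemma seminormed_sobolev: "seminormed_space (sobolev k :: ('a::euclidean_space \<Rightarrow> real) seminormed)"
  unfolding seminormed_space_def
proof (intro conjI allI ballI)
  let ?X = "sobolev k :: ('a \<Rightarrow> real) seminormed"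
  have z: "(\<lambda>x. 0) \<in> (sobolev_set k :: ('a \<Rightarrow> real) set)"
  proof (induction k)
    case 0 show ?case by (simp add: L2_iff_sq_int)
  next
    case (Suc k)
    have "has_weak_partial b (\<lambda>x. 0) (\<lambda>x. 0)" for b :: 'a by (simp add: has_weak_partial_def)
    then show ?case using Suc by (auto simp: L2_iff_sq_int)
  qed
  show "subspace (vecs ?X)"
  proof (rule subspaceI_lincomb)
    show "0 \<in> vecs ?X" using z by (simp add: sobolev_def zero_fun_def)
    show "c *\<^sub>R v + d *\<^sub>R w \<in> vecs ?X" if "v \<in> vecs ?X" "w \<in> vecs ?X" for v w c d
      using sobolev_set_linear[of v k w c d] that by (simp add: sobolev_def lincomb_fun)
  qed
  show "0 \<le> snorm ?X v" for v by (simp add: sobolev_def sobolev_norm_nonneg)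
  show "snorm ?X (c *\<^sub>R v) = \<bar>c\<bar> * snorm ?X v" if "v \<in> vecs ?X" for c v
    using sobolev_norm_cmult[of v k c] that by (simp add: sobolev_def scaleR_fun_def)
  show "snorm ?X (v + w) \<le> snorm ?X v + snorm ?X w" if "v \<in> vecs ?X" "w \<in> vecs ?X" for v w
    using sobolev_norm_triangle[of v k w] that by (simp add: sobolev_def plus_fun_def)
qed

lemma bdd_functional_sobolev:
  assumes w: "sq_int lebesgue w"
  shows "bdd_functional (sobolev k) (\<lambda>f. \<integral>x. f x * w x \<partial>lebesgue) (sq_norm lebesgue w)"
proof -
  have sq: "sq_int lebesgue f" if "f \<in> vecs (sobolev k)" for f :: "'a \<Rightarrow> real"
    using that sobolev_set_subset_L2 by (auto simp: sobolev_def L2_iff_sq_int[symmetric])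
  show ?thesis unfolding bdd_functional_def
  proof (intro conjI ballI allI)
    fix f :: "'a \<Rightarrow> real" assume f: "f \<in> vecs (sobolev k)"
    show "(\<integral>x. (c *\<^sub>R f) x * w x \<partial>lebesgue) = c * (\<integral>x. f x * w x \<partial>lebesgue)" for c
      by (simp add: scaleR_fun_def mult.assoc)
    have "\<bar>\<integral>x. f x * w x \<partial>lebesgue\<bar> \<le> sq_norm lebesgue f * sq_norm lebesgue w"
      by (rule sq_norm_cauchy_schwarz[OF sq[OF f] w])
    also have "\<dots> \<le> sobolev_norm k f * sq_norm lebesgue w"
      using L2_norm_le_sobolev_norm[of f k] by (intro mult_right_mono) (auto simp: L2_norm_eq_sq_norm)
    finally show "\<bar>\<integral>x. f x * w x \<partial>lebesgue\<bar> \<le> sq_norm lebesgue w * snorm (sobolev k) f"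
      by (simp add: sobolev_def mult.commute)
    fix g :: "'a \<Rightarrow> real" assume g: "g \<in> vecs (sobolev k)"
    show "(\<integral>x. (f + g) x * w x \<partial>lebesgue) = (\<integral>x. f x * w x \<partial>lebesgue) + (\<integral>x. g x * w x \<partial>lebesgue)"
      using sq_int_mult_integrable[OF sq[OF f] w] sq_int_mult_integrable[OF sq[OF g] w]
      by (simp add: distrib_right)
  qed simp
qed

lemma test_function_smooth: "\<phi> \<in> test_functions \<Omega> \<Longrightarrow> Ck k \<phi>"
  by (simp add: test_functions_def)

lemma test_function_sq_int:
  fixes \<phi> :: "real \<Rightarrow> real"
  assumes \<phi>: "\<phi> \<in> test_functions \<Omega>"
  shows "sq_int lebesgue \<phi>" "sq_int lebesgue (deriv \<phi>)"
proof -
  have "compact (closure {x. \<phi> x \<noteq> 0})" using \<phi> by (auto simp: test_functions_def)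
  then have "bounded {x. \<phi> x \<noteq> 0}" using bounded_subset[OF compact_imp_bounded closure_subset] by blast
  then obtain l u where lu: "{x. \<phi> x \<noteq> 0} \<subseteq> cbox l u" by (meson bounded_subset_cbox_symmetric)
  then have z: "\<phi> x = 0" if "x \<notin> cbox l u" for x using that by auto
  show "sq_int lebesgue \<phi>"
    by (rule sq_int_continuous_compact_support[OF Ck_continuous[OF test_function_smooth[OF \<phi>]] z])
  show "sq_int lebesgue (deriv \<phi>)"
  proof (rule sq_int_continuous_compact_support)
    show "continuous_on UNIV (deriv \<phi>)"
      using Ck_real_deriv(2)[OF test_function_smooth[OF \<phi>, of "Suc 0"]] by simp
    show "deriv \<phi> x = 0" if "x \<notin> cbox l u" for x
      using Ck_real_deriv(3)[OF test_function_smooth[OF \<phi>, of "Suc 0"], of x]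
        frechet_derivative_zero_outside[of l u \<phi>, OF z that] by simp
  qed
qed

lemma sq_int_restrict:
  fixes f :: "'a::euclidean_space \<Rightarrow> real"
  assumes f: "sq_int lebesgue f" and S: "S \<in> sets lebesgue"
  shows "sq_int (lebesgue_on S) f" "sq_norm (lebesgue_on S) f \<le> sq_norm lebesgue f"
proof -
  have i: "integrable (lebesgue_on S) (\<lambda>x. (f x)\<^sup>2)"
    using integrable_mult_indicator[OF S sq_intD(2)[OF f]] S
    by (subst integrable_restrict_space) auto
  show "sq_int (lebesgue_on S) f"
    using i measurable_restrict_space1[OF sq_intD(1)[OF f]] by (simp add: sq_int_def)
  have "(\<integral>x. (f x)\<^sup>2 \<partial>lebesgue_on S) = (\<integral>x. indicator S x *\<^sub>R (f x)\<^sup>2 \<partial>lebesgue)"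
    using S by (simp add: integral_restrict_space)
  also have "\<dots> \<le> (\<integral>x. (f x)\<^sup>2 \<partial>lebesgue)"
    by (intro integral_mono integrable_mult_indicator S sq_intD(2)[OF f]) (auto simp: indicator_def)
  finally show "sq_norm (lebesgue_on S) f \<le> sq_norm lebesgue f" by (simp add: sq_norm_def)
qed

text \<open>Applying \<open>l\<close> to the two Bochner integrals in the definition of the weak
  derivative turns that identity between vectors into an integration by parts for real
  functions.\<close>

lemma weak_deriv_functional:
  assumes I: "I \<in> sets lebesgue" and X: "subspace (vecs X)" and l: "bdd_functional X l C"
    and f: "f \<in> vecs (bochner_H1 I X)" and \<phi>: "\<phi> \<in> test_functions I"
  shows "(\<integral>t. deriv \<phi> t * l (f t) \<partial>lebesgue_on I) = - (\<integral>t. \<phi> t * l (weak_deriv I X f t) \<partial>lebesgue_on I)"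
proof -
  note C = complete_measure_lebesgue_on[OF I]
  \<comment> \<open>The scalar factor can be moved out of \<open>l\<close> only where
    \<open>h t\<close> lies in the carrier, that is, for almost every \<open>t\<close>.\<close>
  have *: "(\<integral>t. \<theta> t * l (h t) \<partial>lebesgue_on I) = l v"
    if h: "h \<in> vecs (bochner_L2 I X)" and \<theta>: "sq_int lebesgue \<theta>"
      and b: "has_bochner_integral_in (lebesgue_on I) X (\<lambda>t. \<theta> t *\<^sub>R h t) v" for \<theta> h v
  proof -
    have hb: "has_bochner_integral (lebesgue_on I) (\<lambda>t. l (\<theta> t *\<^sub>R h t)) (l v)"
      by (rule has_bochner_integral_functional[OF C X l b])
    have "AE t in lebesgue_on I. h t \<in> vecs X" using h by (auto simp: vecs_bochner_L2 strongly_measurable_def)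
    then have "AE t in lebesgue_on I. \<theta> t * l (h t) = l (\<theta> t *\<^sub>R h t)"
      by eventually_elim (simp add: bdd_functionalD(3)[OF l])
    then have "(\<integral>t. \<theta> t * l (h t) \<partial>lebesgue_on I) = (\<integral>t. l (\<theta> t *\<^sub>R h t) \<partial>lebesgue_on I)"
    proof (rule integral_cong_AE[rotated 2])
      show "(\<lambda>t. \<theta> t * l (h t)) \<in> borel_measurable (lebesgue_on I)"
        by (intro borel_measurable_times sq_intD(1)[OF bochner_L2_functional(1)[OF I X l h]] sq_intD(1)[OF sq_int_restrict(1)[OF \<theta> I]])
      show "(\<lambda>t. l (\<theta> t *\<^sub>R h t)) \<in> borel_measurable (lebesgue_on I)"
        using hb by (auto dest: borel_measurable_has_bochner_integral)
    qed
    also have "\<dots> = l v" by (rule has_bochner_integral_integral_eq[OF hb])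
    finally show ?thesis .
  qed
  obtain v where v: "has_bochner_integral_in (lebesgue_on I) X (\<lambda>t. deriv \<phi> t *\<^sub>R f t) v"
     "has_bochner_integral_in (lebesgue_on I) X (\<lambda>t. \<phi> t *\<^sub>R weak_deriv I X f t) (- v)"
    using weak_deriv_works(2)[OF f] \<phi> unfolding has_weak_deriv_def by blast
  have "v \<in> vecs X" using v(1) by (simp add: has_bochner_integral_in_def)
  from bdd_functionalD(3)[OF l this, of "- 1"] have "l (- v) = - l v" by simp
  then show ?thesis
    using *[OF _ test_function_sq_int(2)[OF \<phi>] v(1)] *[OF weak_deriv_works(1)[OF f] test_function_sq_int(1)[OF \<phi>] v(2)] f
    by (simp add: vecs_bochner_H1)
qed


section \<open>Testing the solution against products\<close>

text \<open>The pairing is an iterated integral with \<open>x\<close> innermost, following the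
  nesting of the spaces. The two inner levels are bounded functionals on the spaces of their
  arguments, which makes the next integrand measurable.\<close>

definition pair_x :: "('a::euclidean_space \<Rightarrow> real) \<Rightarrow> ('a \<Rightarrow> real) \<Rightarrow> real" where
  "pair_x w f = (\<integral>x. f x * w x \<partial>lebesgue)"

definition pair_tau :: "(real \<Rightarrow> real) \<Rightarrow> ('a::euclidean_space \<Rightarrow> real) \<Rightarrow> (real \<Rightarrow> 'a \<Rightarrow> real) \<Rightarrow> real" where
  "pair_tau \<psi> w f = (\<integral>\<tau>. \<psi> \<tau> * pair_x w (f \<tau>) \<partial>lebesgue_on {0<..})"

definition pair :: "(real \<Rightarrow> real \<Rightarrow> 'a::euclidean_space \<Rightarrow> real) \<Rightarrow> (real \<Rightarrow> real) \<Rightarrow> (real \<Rightarrow> real) \<Rightarrow> ('a \<Rightarrow> real) \<Rightarrow> real" where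
  "pair u \<phi> \<psi> w = (\<integral>t. \<phi> t * pair_tau \<psi> w (u t) \<partial>lebesgue)"

lemma sets_pos_half_line [simp]: "{0::real<..} \<in> sets lebesgue"
  by auto

lemmas subspace_H2 = seminormed_spaceD(1)[OF seminormed_sobolev[of 2]]
lemmas subspace_H1_H2 = subspace_bochner_H1[OF seminormed_sobolev[of 2] sets_pos_half_line]

lemma bdd_functional_pair_x:
  "sq_int lebesgue w \<Longrightarrow> bdd_functional (sobolev k) (pair_x w) (sq_norm lebesgue w)"
  unfolding pair_x_def[abs_def] by (rule bdd_functional_sobolev)

lemma bdd_functional_pair_tau:
  assumes w: "sq_int lebesgue w" and \<psi>: "sq_int lebesgue \<psi>"
  shows "bdd_functional (bochner_L2 {0<..} (sobolev 2)) (pair_tau \<psi> w) (sq_norm (lebesgue_on {0<..}) \<psi> * sq_norm lebesgue w)"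
    "bdd_functional (bochner_H1 {0<..} (sobolev 2)) (pair_tau \<psi> w) (sq_norm (lebesgue_on {0<..}) \<psi> * sq_norm lebesgue w)"
proof -
  show "bdd_functional (bochner_L2 {0<..} (sobolev 2)) (pair_tau \<psi> w) (sq_norm (lebesgue_on {0<..}) \<psi> * sq_norm lebesgue w)"
    unfolding pair_tau_def[abs_def]
    by (rule bdd_functional_bochner_L2[OF sets_pos_half_line subspace_H2 bdd_functional_pair_x[OF w]
        sq_int_restrict(1)[OF \<psi> sets_pos_half_line]])
  then show "bdd_functional (bochner_H1 {0<..} (sobolev 2)) (pair_tau \<psi> w) (sq_norm (lebesgue_on {0<..}) \<psi> * sq_norm lebesgue w)"
    by (rule bdd_functional_bochner_H1)
qed

lemma vecs_H2_sq_int: "f \<in> vecs (sobolev 2) \<Longrightarrow> sq_int lebesgue f"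
  using sobolev_set_subset_L2 by (auto simp: sobolev_def L2_iff_sq_int[symmetric])

lemma bochner_L2_AE: "f \<in> vecs (bochner_L2 I X) \<Longrightarrow> AE t in lebesgue_on I. f t \<in> vecs X"
  by (auto simp: vecs_bochner_L2 strongly_measurable_def)

lemma sq_int_pair_x:
  assumes "f \<in> vecs (bochner_L2 {0<..} (sobolev 2))" "sq_int lebesgue w"
  shows "sq_int (lebesgue_on {0<..}) (\<lambda>\<tau>. pair_x w (f \<tau>))"
  by (rule bochner_L2_functional(1)[OF sets_pos_half_line subspace_H2 bdd_functional_pair_x[OF assms(2)] assms(1)])

lemma integrable_pair_tau:
  assumes "f \<in> vecs (bochner_L2 {0<..} (sobolev 2))" "sq_int lebesgue w" "sq_int lebesgue \<psi>"
  shows "integrable (lebesgue_on {0<..}) (\<lambda>\<tau>. \<psi> \<tau> * pair_x w (f \<tau>))"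
  by (rule sq_int_mult_integrable[OF sq_int_restrict(1)[OF assms(3) sets_pos_half_line] sq_int_pair_x[OF assms(1,2)]])

lemma pair_x_linear:
  assumes "sq_int lebesgue f" "sq_int lebesgue w" "sq_int lebesgue w'"
  shows "pair_x (\<lambda>x. a * w x + b * w' x) f = a * pair_x w f + b * pair_x w' f"
proof -
  have "pair_x (\<lambda>x. a * w x + b * w' x) f = (\<integral>x. a * (f x * w x) + b * (f x * w' x) \<partial>lebesgue)"
    unfolding pair_x_def by (intro Bochner_Integration.integral_cong) (auto simp: algebra_simps)
  then show ?thesis
    using sq_int_mult_integrable[OF assms(1,2)] sq_int_mult_integrable[OF assms(1,3)] by (simp add: pair_x_def)
qed

lemma pair_tau_linear_x:
  assumes f: "f \<in> vecs (bochner_L2 {0<..} (sobolev 2))" and w: "sq_int lebesgue w" "sq_int lebesgue w'"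
    and \<psi>: "sq_int lebesgue \<psi>"
  shows "pair_tau \<psi> (\<lambda>x. a * w x + b * w' x) f = a * pair_tau \<psi> w f + b * pair_tau \<psi> w' f"
proof -
  have ww: "sq_int lebesgue (\<lambda>x. a * w x + b * w' x)" using w by (intro sq_int_add sq_int_cmult(1))
  have AE: "AE \<tau> in lebesgue_on {0<..}. \<psi> \<tau> * pair_x (\<lambda>x. a * w x + b * w' x) (f \<tau>)
      = a * (\<psi> \<tau> * pair_x w (f \<tau>)) + b * (\<psi> \<tau> * pair_x w' (f \<tau>))"
    using bochner_L2_AE[OF f]
    by eventually_elim (simp add: pair_x_linear[OF vecs_H2_sq_int w] algebra_simps)
  have "pair_tau \<psi> (\<lambda>x. a * w x + b * w' x) f
    = (\<integral>\<tau>. a * (\<psi> \<tau> * pair_x w (f \<tau>)) + b * (\<psi> \<tau> * pair_x w' (f \<tau>)) \<partial>lebesgue_on {0<..})"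
    unfolding pair_tau_def
    by (rule integral_cong_AE[OF _ _ AE])
      (use integrable_pair_tau[OF f ww \<psi>] integrable_pair_tau[OF f w(1) \<psi>] integrable_pair_tau[OF f w(2) \<psi>] in auto)
  then show ?thesis
    using integrable_pair_tau[OF f w(1) \<psi>] integrable_pair_tau[OF f w(2) \<psi>] by (simp add: pair_tau_def)
qed

lemma pair_tau_linear_tau:
  assumes f: "f \<in> vecs (bochner_L2 {0<..} (sobolev 2))" and w: "sq_int lebesgue w"
    and \<psi>: "sq_int lebesgue \<psi>" "sq_int lebesgue \<psi>'"
  shows "pair_tau (\<lambda>\<tau>. a * \<psi> \<tau> + b * \<psi>' \<tau>) w f = a * pair_tau \<psi> w f + b * pair_tau \<psi>' w f"
proof -
  have "pair_tau (\<lambda>\<tau>. a * \<psi> \<tau> + b * \<psi>' \<tau>) w f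
    = (\<integral>\<tau>. a * (\<psi> \<tau> * pair_x w (f \<tau>)) + b * (\<psi>' \<tau> * pair_x w (f \<tau>)) \<partial>lebesgue_on {0<..})"
    unfolding pair_tau_def by (intro Bochner_Integration.integral_cong) (auto simp: algebra_simps)
  then show ?thesis
    using integrable_pair_tau[OF f w \<psi>(1)] integrable_pair_tau[OF f w \<psi>(2)] by (simp add: pair_tau_def)
qed

section \<open>The trilinear pairing with a fixed function of two times\<close>

locale two_time_function =
  fixes u :: "real \<Rightarrow> real \<Rightarrow> 'a::euclidean_space \<Rightarrow> real"
  assumes u: "u \<in> vecs (bochner_H1 UNIV (bochner_H1 {0<..} (sobolev 2)))"
begin

lemma u_L2: "u \<in> vecs (bochner_L2 UNIV (bochner_H1 {0<..} (sobolev 2)))"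
  using u by (simp add: vecs_bochner_H1[of UNIV])

lemma u_AE: "AE t in lebesgue. u t \<in> vecs (bochner_H1 {0<..} (sobolev 2))"
  using bochner_L2_AE[OF u_L2] unfolding lebesgue_on_UNIV_eq .

lemma u_AE_L2: "AE t in lebesgue. u t \<in> vecs (bochner_L2 {0<..} (sobolev 2))"
  using u_AE by eventually_elim (simp add: vecs_bochner_H1)

definition size_u :: real where
  "size_u = snorm (bochner_L2 UNIV (bochner_H1 {0<..} (sobolev 2))) u"

lemma size_u_nonneg: "0 \<le> size_u"
  by (simp add: size_u_def bochner_L2_def)

lemma sq_int_pair_tau:
  assumes w: "sq_int lebesgue w" and \<psi>: "sq_int lebesgue \<psi>"
  shows "sq_int lebesgue (\<lambda>t. pair_tau \<psi> w (u t))"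
    "sq_norm lebesgue (\<lambda>t. pair_tau \<psi> w (u t)) \<le> sq_norm lebesgue \<psi> * sq_norm lebesgue w * size_u"
proof -
  note * = bochner_L2_functional[OF _ subspace_H1_H2 bdd_functional_pair_tau(2)[OF w \<psi>] u_L2, unfolded lebesgue_on_UNIV_eq]
  show "sq_int lebesgue (\<lambda>t. pair_tau \<psi> w (u t))" using *(1) by simp
  have "sq_norm (lebesgue_on {0<..}) \<psi> * sq_norm lebesgue w * size_u \<le> sq_norm lebesgue \<psi> * sq_norm lebesgue w * size_u"
    by (intro mult_right_mono sq_int_restrict \<psi> size_u_nonneg) auto
  with *(2) show "sq_norm lebesgue (\<lambda>t. pair_tau \<psi> w (u t)) \<le> sq_norm lebesgue \<psi> * sq_norm lebesgue w * size_u"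
    by (simp add: size_u_def)
qed

lemma pair_bound:
  assumes "sq_int lebesgue \<phi>" "sq_int lebesgue \<psi>" "sq_int lebesgue w"
  shows "\<bar>pair u \<phi> \<psi> w\<bar> \<le> sq_norm lebesgue \<phi> * sq_norm lebesgue \<psi> * sq_norm lebesgue w * size_u"
proof -
  have "\<bar>pair u \<phi> \<psi> w\<bar> \<le> sq_norm lebesgue \<phi> * sq_norm lebesgue (\<lambda>t. pair_tau \<psi> w (u t))"
    unfolding pair_def by (rule sq_norm_cauchy_schwarz[OF assms(1) sq_int_pair_tau(1)[OF assms(3,2)]])
  also have "\<dots> \<le> sq_norm lebesgue \<phi> * (sq_norm lebesgue \<psi> * sq_norm lebesgue w * size_u)"
    by (intro mult_left_mono sq_int_pair_tau(2) assms) auto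
  finally show ?thesis by (simp add: mult.assoc)
qed

lemma integrable_pair:
  assumes "sq_int lebesgue \<phi>" "sq_int lebesgue \<psi>" "sq_int lebesgue w"
  shows "integrable lebesgue (\<lambda>t. \<phi> t * pair_tau \<psi> w (u t))"
  by (rule sq_int_mult_integrable[OF assms(1) sq_int_pair_tau(1)[OF assms(3,2)]])

lemma pair_linear_t:
  assumes \<phi>: "sq_int lebesgue \<phi>" "sq_int lebesgue \<phi>'" and \<psi>: "sq_int lebesgue \<psi>" and w: "sq_int lebesgue w"
  shows "pair u (\<lambda>t. a * \<phi> t + b * \<phi>' t) \<psi> w = a * pair u \<phi> \<psi> w + b * pair u \<phi>' \<psi> w"
proof -
  have "pair u (\<lambda>t. a * \<phi> t + b * \<phi>' t) \<psi> w
      = (\<integral>t. a * (\<phi> t * pair_tau \<psi> w (u t)) + b * (\<phi>' t * pair_tau \<psi> w (u t)) \<partial>lebesgue)"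
    unfolding pair_def by (intro Bochner_Integration.integral_cong) (auto simp: algebra_simps)
  then show ?thesis
    using integrable_pair[OF \<phi>(1) \<psi> w] integrable_pair[OF \<phi>(2) \<psi> w] by (simp add: pair_def)
qed

lemma pair_linear_tau:
  assumes \<phi>: "sq_int lebesgue \<phi>" and \<psi>: "sq_int lebesgue \<psi>" "sq_int lebesgue \<psi>'" and w: "sq_int lebesgue w"
  shows "pair u \<phi> (\<lambda>t. a * \<psi> t + b * \<psi>' t) w = a * pair u \<phi> \<psi> w + b * pair u \<phi> \<psi>' w"
proof -
  have \<psi>\<psi>: "sq_int lebesgue (\<lambda>t. a * \<psi> t + b * \<psi>' t)" using \<psi> by (intro sq_int_add sq_int_cmult(1))
  have AE: "AE t in lebesgue. \<phi> t * pair_tau (\<lambda>t. a * \<psi> t + b * \<psi>' t) w (u t)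
     = a * (\<phi> t * pair_tau \<psi> w (u t)) + b * (\<phi> t * pair_tau \<psi>' w (u t))"
    using u_AE_L2 by eventually_elim (simp add: pair_tau_linear_tau[OF _ w \<psi>] algebra_simps)
  have "pair u \<phi> (\<lambda>t. a * \<psi> t + b * \<psi>' t) w
      = (\<integral>t. a * (\<phi> t * pair_tau \<psi> w (u t)) + b * (\<phi> t * pair_tau \<psi>' w (u t)) \<partial>lebesgue)"
    unfolding pair_def
    by (rule integral_cong_AE[OF _ _ AE])
      (use integrable_pair[OF \<phi> \<psi>\<psi> w] integrable_pair[OF \<phi> \<psi>(1) w] integrable_pair[OF \<phi> \<psi>(2) w] in auto)
  then show ?thesis
    using integrable_pair[OF \<phi> \<psi>(1) w] integrable_pair[OF \<phi> \<psi>(2) w] by (simp add: pair_def)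
qed

lemma pair_linear_x:
  assumes \<phi>: "sq_int lebesgue \<phi>" and \<psi>: "sq_int lebesgue \<psi>" and w: "sq_int lebesgue w" "sq_int lebesgue w'"
  shows "pair u \<phi> \<psi> (\<lambda>x. a * w x + b * w' x) = a * pair u \<phi> \<psi> w + b * pair u \<phi> \<psi> w'"
proof -
  have ww: "sq_int lebesgue (\<lambda>x. a * w x + b * w' x)" using w by (intro sq_int_add sq_int_cmult(1))
  have AE: "AE t in lebesgue. \<phi> t * pair_tau \<psi> (\<lambda>x. a * w x + b * w' x) (u t)
     = a * (\<phi> t * pair_tau \<psi> w (u t)) + b * (\<phi> t * pair_tau \<psi> w' (u t))"
    using u_AE_L2 by eventually_elim (simp add: pair_tau_linear_x[OF _ w \<psi>] algebra_simps)
  have "pair u \<phi> \<psi> (\<lambda>x. a * w x + b * w' x)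
      = (\<integral>t. a * (\<phi> t * pair_tau \<psi> w (u t)) + b * (\<phi> t * pair_tau \<psi> w' (u t)) \<partial>lebesgue)"
    unfolding pair_def
    by (rule integral_cong_AE[OF _ _ AE])
      (use integrable_pair[OF \<phi> \<psi> ww] integrable_pair[OF \<phi> \<psi> w(1)] integrable_pair[OF \<phi> \<psi> w(2)] in auto)
  then show ?thesis
    using integrable_pair[OF \<phi> \<psi> w(1)] integrable_pair[OF \<phi> \<psi> w(2)] by (simp add: pair_def)
qed

text \<open>Each of the three integrations by parts is carried out at the level of its own variable,
  so no interchange of integrals is needed. The support of \<psi> lies in the open half line, so
  there is no boundary term at \<open>\<tau> = 0\<close>.\<close>

lemma weak_equation:
  assumes eq: "AE t in lebesgue. AE \<tau> in lebesgue_on {0<..}. AE x in lebesgue.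
        weak_deriv UNIV (bochner_H1 {0<..} (sobolev 2)) u t \<tau> x + weak_deriv {0<..} (sobolev 2) (u t) \<tau> x
          - weak_laplacian (u t \<tau>) x = 0"
    and \<phi>: "\<phi> \<in> test_functions UNIV" and \<psi>: "\<psi> \<in> test_functions {0<..}"
    and w: "\<And>k. Ck k w" "sq_int lebesgue w"
    and w1: "\<And>b. b \<in> Basis \<Longrightarrow> sq_int lebesgue (grad_entry w b)"
    and w2: "\<And>b. b \<in> Basis \<Longrightarrow> sq_int lebesgue (grad_entry (grad_entry w b) b)"
  shows "pair u (deriv \<phi>) \<psi> w + pair u \<phi> (deriv \<psi>) w
    + pair u \<phi> \<psi> (\<lambda>x. \<Sum>b\<in>Basis. grad_entry (grad_entry w b) b x) = 0"
proof -
  define g where "g = weak_deriv UNIV (bochner_H1 {0<..} (sobolev 2)) u"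
  define Lw where "Lw x = (\<Sum>b\<in>Basis. grad_entry (grad_entry w b) b x)" for x
  have sLw: "sq_int lebesgue Lw" unfolding Lw_def[abs_def] by (intro sq_int_sum w2) auto
  note s\<phi> = test_function_sq_int[OF \<phi>] and s\<psi> = test_function_sq_int[OF \<psi>]
  have gL2: "g \<in> vecs (bochner_L2 UNIV (bochner_H1 {0<..} (sobolev 2)))"
    unfolding g_def by (rule weak_deriv_works(1)[OF u])
  have g_AE: "AE t in lebesgue. g t \<in> vecs (bochner_H1 {0<..} (sobolev 2))"
    using bochner_L2_AE[OF gL2] unfolding lebesgue_on_UNIV_eq .
  \<comment> \<open>For fixed \<open>t\<close> the equation expresses the weak
    \<open>t\<close>-derivative \<open>g t\<close> by the other two terms, whose derivatives are
    moved to \<psi> and \<open>w\<close>. The integration by parts in \<open>t\<close> comes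
    afterwards.\<close>
  have key: "pair_tau \<psi> w (g t) = pair_tau (deriv \<psi>) w (u t) + pair_tau \<psi> Lw (u t)"
    if gt: "g t \<in> vecs (bochner_H1 {0<..} (sobolev 2))" and ut: "u t \<in> vecs (bochner_H1 {0<..} (sobolev 2))"
      and e: "AE \<tau> in lebesgue_on {0<..}. AE x in lebesgue.
        g t \<tau> x + weak_deriv {0<..} (sobolev 2) (u t) \<tau> x - weak_laplacian (u t \<tau>) x = 0" for t
  proof -
    define h where "h = weak_deriv {0<..} (sobolev 2) (u t)"
    have hL2: "h \<in> vecs (bochner_L2 {0<..} (sobolev 2))" unfolding h_def by (rule weak_deriv_works(1)[OF ut])
    have gL: "g t \<in> vecs (bochner_L2 {0<..} (sobolev 2))" and uL: "u t \<in> vecs (bochner_L2 {0<..} (sobolev 2))"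
      using gt ut by (auto simp: vecs_bochner_H1)
    have d: "pair_tau (deriv \<psi>) w (u t) = - pair_tau \<psi> w h"
      unfolding pair_tau_def h_def
      by (rule weak_deriv_functional[OF sets_pos_half_line subspace_H2 bdd_functional_pair_x[OF w(2)] ut \<psi>])
    have "AE \<tau> in lebesgue_on {0<..}. \<psi> \<tau> * pair_x w (g t \<tau>) = \<psi> \<tau> * pair_x Lw (u t \<tau>) - \<psi> \<tau> * pair_x w (h \<tau>)"
      using e bochner_L2_AE[OF hL2] bochner_L2_AE[OF gL] bochner_L2_AE[OF uL]
    proof eventually_elim
      case (elim \<tau>)
      have sg: "sq_int lebesgue (g t \<tau>)" and sh: "sq_int lebesgue (h \<tau>)"
        using elim vecs_H2_sq_int by auto
      have fu: "u t \<tau> \<in> sobolev_set 2" using elim(4) by (simp add: sobolev_def)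
      note lap = weak_laplacian_by_parts[OF fu w w1 w2]
      have "pair_x w (g t \<tau>) = (\<integral>x. weak_laplacian (u t \<tau>) x * w x - h \<tau> x * w x \<partial>lebesgue)"
        unfolding pair_x_def
      proof (rule integral_cong_AE)
        show "AE x in lebesgue. g t \<tau> x * w x = weak_laplacian (u t \<tau>) x * w x - h \<tau> x * w x"
          using elim(1)
        proof eventually_elim
          case (elim x)
          then have "g t \<tau> x = weak_laplacian (u t \<tau>) x - h \<tau> x" by (simp add: h_def)
          then show ?case by (simp add: left_diff_distrib)
        qed
        show "(\<lambda>x. g t \<tau> x * w x) \<in> borel_measurable lebesgue"
          using sq_int_mult_integrable[OF sg w(2)] by auto
        show "(\<lambda>x. weak_laplacian (u t \<tau>) x * w x - h \<tau> x * w x) \<in> borel_measurable lebesgue"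
          using sq_int_mult_integrable[OF sh w(2)] sq_int_mult_integrable[OF lap(1) w(2)] by auto
      qed
      also have "\<dots> = pair_x Lw (u t \<tau>) - pair_x w (h \<tau>)"
        using sq_int_mult_integrable[OF sh w(2)] sq_int_mult_integrable[OF lap(1) w(2)] lap(2)
        by (simp add: pair_x_def Lw_def)
      finally show ?case by (simp only: right_diff_distrib)
    qed
    then have "pair_tau \<psi> w (g t) = (\<integral>\<tau>. \<psi> \<tau> * pair_x Lw (u t \<tau>) - \<psi> \<tau> * pair_x w (h \<tau>) \<partial>lebesgue_on {0<..})"
      unfolding pair_tau_def
      by (rule integral_cong_AE[rotated 2])
        (use integrable_pair_tau[OF gL w(2) s\<psi>(1)] integrable_pair_tau[OF uL sLw s\<psi>(1)] integrable_pair_tau[OF hL2 w(2) s\<psi>(1)] in auto)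
    also have "\<dots> = pair_tau \<psi> Lw (u t) - pair_tau \<psi> w h"
      using integrable_pair_tau[OF uL sLw s\<psi>(1)] integrable_pair_tau[OF hL2 w(2) s\<psi>(1)] by (simp add: pair_tau_def)
    finally show ?thesis using d by simp
  qed
  have "pair u (deriv \<phi>) \<psi> w = - (\<integral>t. \<phi> t * pair_tau \<psi> w (g t) \<partial>lebesgue)"
    using weak_deriv_functional[OF _ subspace_H1_H2 bdd_functional_pair_tau(2)[OF w(2) s\<psi>(1)] u \<phi>]
    by (simp add: pair_def g_def lebesgue_on_UNIV_eq)
  also have "(\<integral>t. \<phi> t * pair_tau \<psi> w (g t) \<partial>lebesgue)
     = (\<integral>t. \<phi> t * pair_tau (deriv \<psi>) w (u t) + \<phi> t * pair_tau \<psi> Lw (u t) \<partial>lebesgue)"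
  proof (rule integral_cong_AE)
    show "AE t in lebesgue. \<phi> t * pair_tau \<psi> w (g t) = \<phi> t * pair_tau (deriv \<psi>) w (u t) + \<phi> t * pair_tau \<psi> Lw (u t)"
      using g_AE u_AE eq unfolding g_def[symmetric] by eventually_elim (simp add: key distrib_left)
    have "sq_int lebesgue (\<lambda>t. pair_tau \<psi> w (g t))"
      using bochner_L2_functional(1)[OF _ subspace_H1_H2 bdd_functional_pair_tau(2)[OF w(2) s\<psi>(1)] gL2]
      by (simp add: lebesgue_on_UNIV_eq)
    from sq_int_mult_integrable[OF s\<phi>(1) this] show "(\<lambda>t. \<phi> t * pair_tau \<psi> w (g t)) \<in> borel_measurable lebesgue" by auto
    show "(\<lambda>t. \<phi> t * pair_tau (deriv \<psi>) w (u t) + \<phi> t * pair_tau \<psi> Lw (u t)) \<in> borel_measurable lebesgue"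
      using integrable_pair[OF s\<phi>(1) s\<psi>(2) w(2)] integrable_pair[OF s\<phi>(1) s\<psi>(1) sLw] by auto
  qed
  also have "\<dots> = pair u \<phi> (deriv \<psi>) w + pair u \<phi> \<psi> Lw"
    using integrable_pair[OF s\<phi>(1) s\<psi>(2) w(2)] integrable_pair[OF s\<phi>(1) s\<psi>(1) sLw] by (simp add: pair_def)
  finally show ?thesis by (simp add: Lw_def[abs_def])
qed

end

section \<open>Gaussian functions\<close>

text \<open>The amplitude is kept as a summand \<beta> of the exponent, so that products of Gaussian
  functions and the power of time in the heat kernel stay within this form.\<close>

definition gauss :: "real \<Rightarrow> real \<Rightarrow> 'a::euclidean_space \<Rightarrow> 'a \<Rightarrow> real" where
  "gauss a \<beta> y x = exp (\<beta> - a * (norm (x - y))\<^sup>2)"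

lemma norm_diff_sq_eq_sum:
  fixes x y :: "'a::euclidean_space"
  shows "(norm (x - y))\<^sup>2 = (\<Sum>b\<in>Basis. ((x - y) \<bullet> b)\<^sup>2)"
  using euclidean_inner[of "x - y" "x - y"] by (simp only: power2_norm_eq_inner power2_eq_square[of "_ \<bullet> _"])

lemma gauss_pos: "0 < gauss a \<beta> y x"
  by (simp add: gauss_def)

lemma continuous_gauss: "continuous_on UNIV (gauss a \<beta> y)"
  unfolding gauss_def[abs_def] by (intro continuous_intros)

lemma gauss_measurable: "gauss a \<beta> y \<in> borel_measurable lebesgue"
  by (intro borel_imp_lebesgue_measurable borel_measurable_continuous_onI continuous_gauss)

text \<open>The function is a product of one-dimensional Gaussian functions of the coordinates, each
  a multiple of a normal density.\<close>

lemma integrable_gauss: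
  assumes a: "0 < a"
  shows "integrable lebesgue (gauss a 0 y)"
proof -
  \<comment> \<open>Chosen so that \<open>1 / (2 * \<sigma>\<^sup>2) = a\<close>.\<close>
  define \<sigma> where "\<sigma> = sqrt (1 / (2 * a))"
  have \<sigma>: "0 < \<sigma>" "\<sigma>\<^sup>2 = 1 / (2 * a)" using a by (auto simp: \<sigma>_def)
  have one: "(\<integral>\<^sup>+x. ennreal (exp (- a * (x - m)\<^sup>2)) \<partial>lborel) < \<infinity>" for m :: real
  proof -
    have "exp (- a * (x - m)\<^sup>2) = sqrt (2 * pi * \<sigma>\<^sup>2) * normal_density m \<sigma> x" for x
      using \<sigma> a by (simp add: normal_density_def)
    then have "integrable lborel (\<lambda>x. exp (- a * (x - m)\<^sup>2))"
      using integrable_normal_density[OF \<sigma>(1), of m] by simp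
    then show ?thesis by (simp add: integrable_iff_bounded)
  qed
  have "(\<integral>\<^sup>+x. ennreal (gauss a 0 y x) \<partial>lborel) = (\<integral>\<^sup>+x. (\<Prod>b\<in>Basis. ennreal (exp (- a * (x \<bullet> b - y \<bullet> b)\<^sup>2))) \<partial>lborel)"
    by (intro nn_integral_cong)
      (simp add: gauss_def norm_diff_sq_eq_sum sum_distrib_left exp_sum prod_ennreal inner_diff_left sum_negf[symmetric] exp_minus[symmetric]
        del: sum_negf)
  also have "\<dots> = (\<Prod>b\<in>Basis. \<integral>\<^sup>+x. ennreal (exp (- a * (x - y \<bullet> b)\<^sup>2)) \<partial>lborel)"
    by (rule nn_integral_lborel_prod) auto
  also have "\<dots> < \<infinity>"
  proof -
    have "(\<Prod>b\<in>B. g b) < \<infinity>" if "\<And>b. g b < \<infinity>" for g :: "'a \<Rightarrow> ennreal" and B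
      by (induction B rule: infinite_finite_induct) (use that in \<open>auto simp: ennreal_mult_less_top\<close>)
    from this[OF one] show ?thesis .
  qed
  finally have "(\<integral>\<^sup>+x. ennreal (gauss a 0 y x) \<partial>lborel) < \<infinity>" .
  moreover have "gauss a 0 y \<in> borel_measurable borel"
    by (intro borel_measurable_continuous_onI continuous_gauss)
  ultimately have "integrable lborel (gauss a 0 y)"
    using gauss_pos[of a 0 y] by (simp add: integrable_iff_bounded less_imp_le)
  moreover have "gauss a 0 y \<in> borel_measurable lborel"
    using borel_measurable_continuous_onI[OF continuous_gauss] by simp
  ultimately show ?thesis by (subst integrable_completion) auto
qed

text \<open>Half of the Gaussian decay absorbs the polynomial weight, and the square of what remains
  is an integrable Gaussian of rate \<open>a\<close>. The weight has degree 4 because the second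
  time derivative of the heat kernel contains the square of a polynomial of degree 2.\<close>

lemma sq_int_gauss_poly:
  assumes a: "0 < a" and f: "continuous_on UNIV f"
    and le: "\<And>x. \<bar>f x\<bar> \<le> C * (1 + (norm (x - y))\<^sup>2)\<^sup>2 * gauss a 0 y x"
  shows "sq_int lebesgue f"
proof -
  have C: "0 \<le> C"
  proof -
    have "0 \<le> \<bar>f y\<bar>" by simp
    also have "\<dots> \<le> C" using le[of y] by (simp add: gauss_def)
    finally show ?thesis .
  qed
  have "sq_int lebesgue (gauss (a / 2) 0 y)"
  proof -
    have "(gauss (a / 2) 0 y x)\<^sup>2 = gauss a 0 y x" for x
      by (simp add: gauss_def power2_eq_square exp_add[symmetric])
    then show ?thesis using integrable_gauss[OF a, of y] gauss_measurable by (simp add: sq_int_def)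
  qed
  from sq_int_cmult(1)[OF this, of "C * (1 + 4 / a)\<^sup>2"] show ?thesis
  proof (rule sq_int_bound(1))
    show "f \<in> borel_measurable lebesgue"
      by (intro borel_imp_lebesgue_measurable borel_measurable_continuous_onI f)
    show "AE x in lebesgue. \<bar>f x\<bar> \<le> \<bar>C * (1 + 4 / a)\<^sup>2 * gauss (a / 2) 0 y x\<bar>"
    proof (rule AE_I2)
      fix x
      define r where "r = (norm (x - y))\<^sup>2"
      have r: "0 \<le> r" by (simp add: r_def)
      have e1: "1 \<le> exp (a * r / 4)" using a r by simp
      \<comment> \<open>The quarter is chosen because the estimate of \<open>1 + r\<close> is
        squared afterwards, which costs \<open>exp (a * r / 2)\<close>.\<close>
      have "a * r / 4 \<le> exp (a * r / 4)" using exp_ge_add_one_self[of "a * r / 4"] by linarith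
      then have "r \<le> 4 / a * exp (a * r / 4)" using a by (simp add: field_simps)
      then have "1 + r \<le> (1 + 4 / a) * exp (a * r / 4)" using e1 unfolding distrib_right by linarith
      then have "(1 + r)\<^sup>2 \<le> ((1 + 4 / a) * exp (a * r / 4))\<^sup>2" using r by (intro power_mono) auto
      also have "\<dots> = (1 + 4 / a)\<^sup>2 * exp (a * r / 2)"
        by (simp add: power_mult_distrib power2_eq_square exp_add[symmetric])
      finally have "(1 + r)\<^sup>2 * exp (- a * r) \<le> (1 + 4 / a)\<^sup>2 * exp (a * r / 2) * exp (- a * r)"
        by (rule mult_right_mono) simp
      also have "\<dots> = (1 + 4 / a)\<^sup>2 * exp (- a / 2 * r)"
        by (simp add: mult.assoc exp_add[symmetric])
      finally have "C * ((1 + r)\<^sup>2 * exp (- a * r)) \<le> C * ((1 + 4 / a)\<^sup>2 * exp (- a / 2 * r))"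
        by (rule mult_left_mono[OF _ C])
      moreover have "\<bar>f x\<bar> \<le> C * ((1 + r)\<^sup>2 * exp (- a * r))"
        using le[of x] by (simp add: gauss_def r_def mult.assoc)
      ultimately have "\<bar>f x\<bar> \<le> C * (1 + 4 / a)\<^sup>2 * gauss (a / 2) 0 y x"
        by (simp add: gauss_def r_def mult.assoc)
      then show "\<bar>f x\<bar> \<le> \<bar>C * (1 + 4 / a)\<^sup>2 * gauss (a / 2) 0 y x\<bar>" by linarith
    qed
  qed
qed

lemma gauss_has_derivative:
  "(gauss a \<beta> y has_derivative (\<lambda>h. - 2 * a * ((x - y) \<bullet> h) * gauss a \<beta> y x)) (at x)"
  unfolding gauss_def[abs_def] power2_norm_eq_inner
  by (auto intro!: derivative_eq_intros simp: algebra_simps inner_commute)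

lemma Ck_gauss: "Ck k (gauss a \<beta> y)"
proof -
  have "Ck k (\<lambda>x. \<beta> - a * (\<Sum>b\<in>Basis. (x \<bullet> b - y \<bullet> b) * (x \<bullet> b - y \<bullet> b)))"
    by (intro Ck_diff Ck_const Ck_cmult Ck_sum Ck_mult Ck_bounded_linear bounded_linear_inner_left)
  moreover have "gauss a \<beta> y = (\<lambda>x. exp (\<beta> - a * (\<Sum>b\<in>Basis. (x \<bullet> b - y \<bullet> b) * (x \<bullet> b - y \<bullet> b))))"
    unfolding gauss_def[abs_def] norm_diff_sq_eq_sum inner_diff_left
    by (simp only: power2_eq_square[of "_ \<bullet> _ - _ \<bullet> _"])
  ultimately show ?thesis using Ck_compose[OF Ck_exp] by simp
qed

lemma grad_entry_gauss: "grad_entry (gauss a \<beta> y) b = (\<lambda>x. - 2 * a * ((x - y) \<bullet> b) * gauss a \<beta> y x)"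
  unfolding grad_entry_def[abs_def] by (simp add: frechet_derivative_eqI[OF gauss_has_derivative])

lemma grad_entry2_gauss:
  assumes "b \<in> Basis"
  shows "grad_entry (grad_entry (gauss a \<beta> y) b) b
    = (\<lambda>x. (4 * a\<^sup>2 * ((x - y) \<bullet> b)\<^sup>2 - 2 * a) * gauss a \<beta> y x)"
proof
  fix x
  have "((\<lambda>x. - 2 * a * ((x - y) \<bullet> b) * gauss a \<beta> y x) has_derivative
    (\<lambda>h. - 2 * a * ((x - y) \<bullet> b) * (- 2 * a * ((x - y) \<bullet> h) * gauss a \<beta> y x) + (- 2 * a * (h \<bullet> b)) * gauss a \<beta> y x)) (at x)"
    by (rule has_derivative_mult[OF _ gauss_has_derivative]) (auto intro!: derivative_eq_intros)
  from frechet_derivative_eqI[OF this] show "grad_entry (grad_entry (gauss a \<beta> y) b) b x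
    = (4 * a\<^sup>2 * ((x - y) \<bullet> b)\<^sup>2 - 2 * a) * gauss a \<beta> y x"
    unfolding grad_entry_gauss unfolding grad_entry_def
    using assms by (simp add: inner_Basis power2_eq_square algebra_simps)
qed

lemma laplacian_gauss:
  fixes y :: "'a::euclidean_space"
  shows "(\<lambda>x. \<Sum>b\<in>Basis. grad_entry (grad_entry (gauss a \<beta> y) b) b x)
    = (\<lambda>x. (4 * a\<^sup>2 * (norm (x - y))\<^sup>2 - 2 * a * DIM('a)) * gauss a \<beta> y x)"
proof
  fix x
  have "(\<Sum>b\<in>Basis. grad_entry (grad_entry (gauss a \<beta> y) b) b x)
     = (\<Sum>b\<in>Basis. (4 * a\<^sup>2 * ((x - y) \<bullet> b)\<^sup>2 - 2 * a)) * gauss a \<beta> y x"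
    unfolding sum_distrib_right by (intro sum.cong refl) (simp add: grad_entry2_gauss)
  then show "(\<Sum>b\<in>Basis. grad_entry (grad_entry (gauss a \<beta> y) b) b x)
     = (4 * a\<^sup>2 * (norm (x - y))\<^sup>2 - 2 * a * DIM('a)) * gauss a \<beta> y x"
    by (simp add: sum_subtractf norm_diff_sq_eq_sum[of x y] sum_distrib_left)
qed

lemma gauss_shift_const: "gauss a \<beta> y x = exp \<beta> * gauss a 0 y x"
  by (simp add: gauss_def exp_add[symmetric])

lemma abs_inner_Basis_le: "b \<in> Basis \<Longrightarrow> \<bar>(x - y) \<bullet> b\<bar> \<le> 1 + (norm (x - y))\<^sup>2"
proof -
  assume "b \<in> Basis"
  then have "\<bar>(x - y) \<bullet> b\<bar> \<le> norm (x - y)" by (rule Basis_le_norm)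
  moreover have "2 * norm (x - y) \<le> 1 + (norm (x - y))\<^sup>2"
    using sum_squares_bound[of 1 "norm (x - y)"] by simp
  moreover have "0 \<le> norm (x - y)" by simp
  ultimately show ?thesis by linarith
qed

lemma sq_int_gauss:
  assumes a: "0 < a"
  shows "sq_int lebesgue (gauss a \<beta> y)"
    "b \<in> Basis \<Longrightarrow> sq_int lebesgue (grad_entry (gauss a \<beta> y) b)"
    "b \<in> Basis \<Longrightarrow> sq_int lebesgue (grad_entry (grad_entry (gauss a \<beta> y) b) b)"
proof -
  have one: "1 \<le> (1 + r)\<^sup>2" "1 + r \<le> (1 + r)\<^sup>2" if "0 \<le> r" for r :: real
    using that by (auto simp: power2_eq_square algebra_simps)
  show "sq_int lebesgue (gauss a \<beta> y)"
  proof (rule sq_int_gauss_poly[OF a continuous_gauss])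
    show "\<bar>gauss a \<beta> y x\<bar> \<le> exp \<beta> * (1 + (norm (x - y))\<^sup>2)\<^sup>2 * gauss a 0 y x" for x
      using one(1)[of "(norm (x - y))\<^sup>2"] gauss_pos[of a 0 y x]
      by (simp add: gauss_shift_const[of a \<beta>] abs_mult)
  qed
  assume b: "b \<in> Basis"
  show "sq_int lebesgue (grad_entry (gauss a \<beta> y) b)"
  proof (rule sq_int_gauss_poly[OF a])
    show "continuous_on UNIV (grad_entry (gauss a \<beta> y) b)"
      unfolding grad_entry_gauss by (intro continuous_intros continuous_gauss)
    fix x
    have "\<bar>(x - y) \<bullet> b\<bar> \<le> (1 + (norm (x - y))\<^sup>2)\<^sup>2"
      using abs_inner_Basis_le[OF b, of x y] one(2)[of "(norm (x - y))\<^sup>2"] by simp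
    then have "2 * a * exp \<beta> * gauss a 0 y x * \<bar>(x - y) \<bullet> b\<bar> \<le> 2 * a * exp \<beta> * gauss a 0 y x * (1 + (norm (x - y))\<^sup>2)\<^sup>2"
      using a gauss_pos[of a 0 y x] by (intro mult_left_mono) auto
    then show "\<bar>grad_entry (gauss a \<beta> y) b x\<bar> \<le> (2 * a * exp \<beta>) * (1 + (norm (x - y))\<^sup>2)\<^sup>2 * gauss a 0 y x"
      using a gauss_pos[of a 0 y x] by (simp add: grad_entry_gauss gauss_shift_const[of a \<beta>] abs_mult mult_ac)
  qed
  show "sq_int lebesgue (grad_entry (grad_entry (gauss a \<beta> y) b) b)"
  proof (rule sq_int_gauss_poly[OF a])
    show "continuous_on UNIV (grad_entry (grad_entry (gauss a \<beta> y) b) b)"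
      unfolding grad_entry2_gauss[OF b] by (intro continuous_intros continuous_gauss)
    fix x
    define t where "t = (1 + (norm (x - y))\<^sup>2)\<^sup>2"
    have "\<bar>(x - y) \<bullet> b\<bar>\<^sup>2 \<le> t" unfolding t_def using abs_inner_Basis_le[OF b, of x y] by (intro power_mono) auto
    then have 1: "4 * a\<^sup>2 * ((x - y) \<bullet> b)\<^sup>2 \<le> 4 * a\<^sup>2 * t" by (intro mult_left_mono) auto
    have 2: "2 * a * 1 \<le> 2 * a * t" unfolding t_def using a one(1)[of "(norm (x - y))\<^sup>2"] by (intro mult_left_mono) auto
    have 3: "0 \<le> 4 * a\<^sup>2 * ((x - y) \<bullet> b)\<^sup>2" by simp
    have "\<bar>4 * a\<^sup>2 * ((x - y) \<bullet> b)\<^sup>2 - 2 * a\<bar> \<le> (4 * a\<^sup>2 + 2 * a) * t"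
      using 1 2 3 a unfolding distrib_right by linarith
    then have "\<bar>4 * a\<^sup>2 * ((x - y) \<bullet> b)\<^sup>2 - 2 * a\<bar> * (exp \<beta> * gauss a 0 y x) \<le> (4 * a\<^sup>2 + 2 * a) * t * (exp \<beta> * gauss a 0 y x)"
      using gauss_pos[of a 0 y x] by (intro mult_right_mono) auto
    then show "\<bar>grad_entry (grad_entry (gauss a \<beta> y) b) b x\<bar>
       \<le> ((4 * a\<^sup>2 + 2 * a) * exp \<beta>) * (1 + (norm (x - y))\<^sup>2)\<^sup>2 * gauss a 0 y x"
      using gauss_pos[of a 0 y x] by (simp add: grad_entry2_gauss[OF b] gauss_shift_const[of a \<beta>] abs_mult t_def mult_ac)
  qed
qed


section \<open>Differentiable curves of square integrable functions\<close>

text \<open>Differentiability of a curve in the L2 seminorm, encoded by explicit Lipschitz and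
  second-order Taylor bounds with one constant. These are exactly the quantities that the trilinear
  estimate of the pairing consumes.\<close>

definition L2_curve :: "real set \<Rightarrow> (real \<Rightarrow> 'a::euclidean_space \<Rightarrow> real) \<Rightarrow> (real \<Rightarrow> 'a \<Rightarrow> real) \<Rightarrow> real \<Rightarrow> bool" where
  "L2_curve S c c' K \<longleftrightarrow> 0 \<le> K \<and>
     (\<forall>s\<in>S. sq_int lebesgue (c s) \<and> sq_int lebesgue (c' s) \<and>
        sq_norm lebesgue (c s) \<le> K \<and> sq_norm lebesgue (c' s) \<le> K) \<and>
     (\<forall>s\<in>S. \<forall>r\<in>S. sq_norm lebesgue (\<lambda>x. c r x - c s x) \<le> K * \<bar>r - s\<bar> \<and>
        sq_norm lebesgue (\<lambda>x. c r x - c s x - (r - s) * c' s x) \<le> K * (r - s)\<^sup>2)"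

lemma L2_curveD:
  assumes "L2_curve S c c' K" "s \<in> S"
  shows "0 \<le> K" "sq_int lebesgue (c s)" "sq_int lebesgue (c' s)" "sq_norm lebesgue (c s) \<le> K" "sq_norm lebesgue (c' s) \<le> K"
    "r \<in> S \<Longrightarrow> sq_norm lebesgue (\<lambda>x. c r x - c s x) \<le> K * \<bar>r - s\<bar>"
    "r \<in> S \<Longrightarrow> sq_norm lebesgue (\<lambda>x. c r x - c s x - (r - s) * c' s x) \<le> K * (r - s)\<^sup>2"
  using assms by (auto simp: L2_curve_def)

lemma L2_curve_mono:
  assumes "L2_curve S c c' K" "K \<le> K'"
  shows "L2_curve S c c' K'"
proof -
  have "K * \<bar>r - s\<bar> \<le> K' * \<bar>r - s\<bar>" "K * (r - s)\<^sup>2 \<le> K' * (r - s)\<^sup>2" for r s :: real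
    using assms(2) by (auto intro: mult_right_mono)
  then show ?thesis using assms unfolding L2_curve_def by (meson order_trans)
qed

text \<open>The mean value inequality gives the bounds at each point \<open>x\<close> separately. A
  common square integrable majorant of the curve and its first two derivatives then gives them in
  L2.\<close>

lemma L2_curveI:
  fixes c :: "real \<Rightarrow> 'a::euclidean_space \<Rightarrow> real"
  assumes G: "sq_int lebesgue G"
    and m: "\<And>s. s \<in> {a..b} \<Longrightarrow> c s \<in> borel_measurable lebesgue" "\<And>s. s \<in> {a..b} \<Longrightarrow> c' s \<in> borel_measurable lebesgue"
    and d: "\<And>s x. s \<in> {a..b} \<Longrightarrow> ((\<lambda>s. c s x) has_real_derivative c' s x) (at s)"
    and d': "\<And>s x. s \<in> {a..b} \<Longrightarrow> ((\<lambda>s. c' s x) has_real_derivative c'' s x) (at s)"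
    and le: "\<And>s x. s \<in> {a..b} \<Longrightarrow> \<bar>c s x\<bar> \<le> G x" "\<And>s x. s \<in> {a..b} \<Longrightarrow> \<bar>c' s x\<bar> \<le> G x"
      "\<And>s x. s \<in> {a..b} \<Longrightarrow> \<bar>c'' s x\<bar> \<le> G x"
  shows "L2_curve {a..b} c c' (sq_norm lebesgue G)"
proof -
  have lip: "\<bar>c r x - c s x\<bar> \<le> G x * \<bar>r - s\<bar>" if "r \<in> {a..b}" "s \<in> {a..b}" for r s x
    using field_differentiable_bound[of "{a..b}" "\<lambda>s. c s x" "\<lambda>s. c' s x" "G x" r s] that d le(2)
    by (auto intro: has_field_derivative_at_within)
  have lip': "\<bar>c' r x - c' s x\<bar> \<le> G x * \<bar>r - s\<bar>" if "r \<in> {a..b}" "s \<in> {a..b}" for r s x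
    using field_differentiable_bound[of "{a..b}" "\<lambda>s. c' s x" "\<lambda>s. c'' s x" "G x" r s] that d' le(3)
    by (auto intro: has_field_derivative_at_within)
  have taylor: "\<bar>c r x - c s x - (r - s) * c' s x\<bar> \<le> G x * (r - s)\<^sup>2" if rs: "r \<in> {a..b}" "s \<in> {a..b}" for r s x
  proof -
    have G0: "0 \<le> G x" using le(1)[OF rs(1), of x] by linarith
    let ?S = "{min r s..max r s}"
    \<comment> \<open>The mean value inequality for the curve minus its linear part, whose
      derivative is an increment of \<open>c'\<close> and hence itself of first order.\<close>
    have "norm ((c r x - r * c' s x) - (c s x - s * c' s x)) \<le> (G x * \<bar>r - s\<bar>) * norm (r - s)"
    proof (rule field_differentiable_bound[of ?S "\<lambda>\<rho>. c \<rho> x - \<rho> * c' s x" "\<lambda>\<rho>. c' \<rho> x - c' s x"])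
      fix \<rho> assume "\<rho> \<in> ?S"
      then have \<rho>: "\<rho> \<in> {a..b}" "\<bar>\<rho> - s\<bar> \<le> \<bar>r - s\<bar>" using rs by auto
      show "((\<lambda>\<rho>. c \<rho> x - \<rho> * c' s x) has_field_derivative c' \<rho> x - c' s x) (at \<rho> within ?S)"
        using d[OF \<rho>(1), of x] by (auto intro!: derivative_eq_intros intro: has_field_derivative_at_within)
      have "\<bar>c' \<rho> x - c' s x\<bar> \<le> G x * \<bar>\<rho> - s\<bar>" by (rule lip'[OF \<rho>(1) rs(2)])
      also have "\<dots> \<le> G x * \<bar>r - s\<bar>" by (rule mult_left_mono[OF \<rho>(2) G0])
      finally show "norm (c' \<rho> x - c' s x) \<le> G x * \<bar>r - s\<bar>" by simp
    qed auto
    then show ?thesis by (simp add: algebra_simps power2_eq_square)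
  qed
  have sq: "sq_int lebesgue (c s)" "sq_norm lebesgue (c s) \<le> sq_norm lebesgue G"
    "sq_int lebesgue (c' s)" "sq_norm lebesgue (c' s) \<le> sq_norm lebesgue G" if s: "s \<in> {a..b}" for s
  proof -
    have *: "AE x in lebesgue. \<bar>c s x\<bar> \<le> \<bar>G x\<bar>" "AE x in lebesgue. \<bar>c' s x\<bar> \<le> \<bar>G x\<bar>"
      using le(1,2)[OF s] by (auto intro!: AE_I2 intro: order_trans[OF _ abs_ge_self])
    show "sq_int lebesgue (c s)" "sq_norm lebesgue (c s) \<le> sq_norm lebesgue G"
      by (rule sq_int_bound[OF G m(1)[OF s] *(1)])+
    show "sq_int lebesgue (c' s)" "sq_norm lebesgue (c' s) \<le> sq_norm lebesgue G"
      by (rule sq_int_bound[OF G m(2)[OF s] *(2)])+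
  qed
  have bd: "sq_norm lebesgue h \<le> sq_norm lebesgue G * e"
    if "h \<in> borel_measurable lebesgue" "\<And>x. \<bar>h x\<bar> \<le> G x * e" "0 \<le> e" for h :: "'a \<Rightarrow> real" and e
  proof -
    have "AE x in lebesgue. \<bar>h x\<bar> \<le> \<bar>e * G x\<bar>"
      using that(2) by (auto intro!: AE_I2 intro: order_trans[OF _ abs_ge_self] simp: mult.commute)
    from sq_int_bound(2)[OF sq_int_cmult(1)[OF G] that(1) this] show ?thesis
      using sq_int_cmult(2)[OF G, of e] that(3) by (simp add: mult.commute)
  qed
  show ?thesis unfolding L2_curve_def
  proof (intro conjI ballI)
    fix s r assume sr: "s \<in> {a..b}" "r \<in> {a..b}"
    have mm: "(\<lambda>x. c r x - c s x) \<in> borel_measurable lebesgue"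
      using m(1)[OF sr(1)] m(1)[OF sr(2)] by (rule borel_measurable_diff[rotated])
    show "sq_norm lebesgue (\<lambda>x. c r x - c s x) \<le> sq_norm lebesgue G * \<bar>r - s\<bar>"
      by (rule bd[OF mm]) (use lip[OF sr(2,1)] in auto)
    have "(\<lambda>x. (r - s) * c' s x) \<in> borel_measurable lebesgue" using m(2)[OF sr(1)] by simp
    from borel_measurable_diff[OF mm this]
    show "sq_norm lebesgue (\<lambda>x. c r x - c s x - (r - s) * c' s x) \<le> sq_norm lebesgue G * (r - s)\<^sup>2"
      by (rule bd) (use taylor[OF sr(2,1)] in auto)
  qed (use sq in auto)
qed

context two_time_function
begin

text \<open>The product rule for a trilinear form, with explicit remainders. The first-order terms
  add up to 0 by assumption, so the increment is quadratic in the step and the derivative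
  vanishes.\<close>

lemma pair_curve_constant:
  assumes \<phi>: "L2_curve {a..b} \<phi> \<phi>' K" and \<psi>: "L2_curve {a..b} \<psi> \<psi>' K" and w: "L2_curve {a..b} w w' K"
    and zero: "\<And>s. s \<in> {a..b} \<Longrightarrow>
      pair u (\<phi>' s) (\<psi> s) (w s) + pair u (\<phi> s) (\<psi>' s) (w s) + pair u (\<phi> s) (\<psi> s) (w' s) = 0"
    and sr: "s \<in> {a..b}" "r \<in> {a..b}"
  shows "pair u (\<phi> s) (\<psi> s) (w s) = pair u (\<phi> r) (\<psi> r) (w r)"
proof -
  define z where "z s = pair u (\<phi> s) (\<psi> s) (w s)" for s
  \<comment> \<open>There are six remainder terms in the expansion below, each at most
    \<open>K * K * K * size_u * h\<^sup>2\<close>.\<close>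
  define C where "C = 6 * (K * K * K * size_u)"
  have quad: "\<bar>z r - z s\<bar> \<le> C * (r - s)\<^sup>2" if s: "s \<in> {a..b}" and r: "r \<in> {a..b}" for r s
  proof -
    define h where "h = r - s"
    note f = L2_curveD[OF \<phi> s] L2_curveD[OF \<phi> r] and p = L2_curveD[OF \<psi> s] L2_curveD[OF \<psi> r]
      and q = L2_curveD[OF w s] L2_curveD[OF w r]
    have K: "0 \<le> K" by (rule f(1))
    define D\<phi> where "D\<phi> x = \<phi> r x - \<phi> s x" for x
    define D\<psi> where "D\<psi> x = \<psi> r x - \<psi> s x" for x
    define Dw where "Dw x = w r x - w s x" for x
    define R\<phi> where "R\<phi> x = D\<phi> x - h * \<phi>' s x" for x
    define R\<psi> where "R\<psi> x = D\<psi> x - h * \<psi>' s x" for x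
    define Rw where "Rw x = Dw x - h * w' s x" for x
    have sD: "sq_int lebesgue D\<phi>" "sq_int lebesgue D\<psi>" "sq_int lebesgue Dw"
      unfolding D\<phi>_def[abs_def] D\<psi>_def[abs_def] Dw_def[abs_def] by (intro sq_int_diff f p q)+
    have sR: "sq_int lebesgue R\<phi>" "sq_int lebesgue R\<psi>" "sq_int lebesgue Rw"
      unfolding R\<phi>_def[abs_def] R\<psi>_def[abs_def] Rw_def[abs_def] by (intro sq_int_diff sq_int_cmult(1) sD f p q)+
    have nD: "sq_norm lebesgue D\<psi> \<le> K * \<bar>h\<bar>" "sq_norm lebesgue Dw \<le> K * \<bar>h\<bar>"
      unfolding D\<psi>_def[abs_def] Dw_def[abs_def] h_def using p(6)[OF r] q(6)[OF r] by auto
    have nR: "sq_norm lebesgue R\<phi> \<le> K * h\<^sup>2" "sq_norm lebesgue R\<psi> \<le> K * h\<^sup>2" "sq_norm lebesgue Rw \<le> K * h\<^sup>2"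
      unfolding R\<phi>_def[abs_def] R\<psi>_def[abs_def] Rw_def[abs_def] D\<phi>_def D\<psi>_def Dw_def h_def
      using f(7)[OF r] p(7)[OF r] q(7)[OF r] by auto
    have e\<phi>: "\<phi> r = (\<lambda>x. 1 * D\<phi> x + 1 * \<phi> s x)" "D\<phi> = (\<lambda>x. 1 * R\<phi> x + h * \<phi>' s x)"
      and e\<psi>: "\<psi> r = (\<lambda>x. 1 * D\<psi> x + 1 * \<psi> s x)" "D\<psi> = (\<lambda>x. 1 * R\<psi> x + h * \<psi>' s x)"
      and ew: "w r = (\<lambda>x. 1 * Dw x + 1 * w s x)" "Dw = (\<lambda>x. 1 * Rw x + h * w' s x)"
      by (auto simp: D\<phi>_def D\<psi>_def Dw_def R\<phi>_def R\<psi>_def Rw_def)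
    have l1: "pair u (\<phi> r) \<Psi> W = pair u D\<phi> \<Psi> W + pair u (\<phi> s) \<Psi> W"
      "pair u D\<phi> \<Psi> W = pair u R\<phi> \<Psi> W + h * pair u (\<phi>' s) \<Psi> W"
      if "sq_int lebesgue \<Psi>" "sq_int lebesgue W" for \<Psi> W
      using pair_linear_t[OF sD(1) f(2) that, of 1 1] pair_linear_t[OF sR(1) f(3) that, of 1 h]
      unfolding e\<phi>[symmetric] by simp_all
    have l2: "pair u \<Phi> (\<psi> r) W = pair u \<Phi> D\<psi> W + pair u \<Phi> (\<psi> s) W"
      "pair u \<Phi> D\<psi> W = pair u \<Phi> R\<psi> W + h * pair u \<Phi> (\<psi>' s) W"
      if "sq_int lebesgue \<Phi>" "sq_int lebesgue W" for \<Phi> W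
      using pair_linear_tau[OF that(1) sD(2) p(2) that(2), of 1 1] pair_linear_tau[OF that(1) sR(2) p(3) that(2), of 1 h]
      unfolding e\<psi>[symmetric] by simp_all
    have l3: "pair u \<Phi> \<Psi> (w r) = pair u \<Phi> \<Psi> Dw + pair u \<Phi> \<Psi> (w s)"
      "pair u \<Phi> \<Psi> Dw = pair u \<Phi> \<Psi> Rw + h * pair u \<Phi> \<Psi> (w' s)"
      if "sq_int lebesgue \<Phi>" "sq_int lebesgue \<Psi>" for \<Phi> \<Psi>
      using pair_linear_x[OF that sD(3) q(2), of 1 1] pair_linear_x[OF that sR(3) q(3), of 1 h]
      unfolding ew[symmetric] by simp_all
    \<comment> \<open>The factors are changed from \<open>r\<close> to \<open>s\<close> one at a
      time, and each increment is split into its linear part and a remainder. What multiplies a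
      linear part still contains factors at \<open>r\<close>; replacing these as well produces the
      terms with two increments.\<close>
    have "z r - z s = pair u R\<phi> (\<psi> r) (w r) + h * pair u (\<phi>' s) D\<psi> (w r) + h * pair u (\<phi>' s) (\<psi> s) Dw
        + pair u (\<phi> s) R\<psi> (w r) + h * pair u (\<phi> s) (\<psi>' s) Dw + pair u (\<phi> s) (\<psi> s) Rw
        + h * (pair u (\<phi>' s) (\<psi> s) (w s) + pair u (\<phi> s) (\<psi>' s) (w s) + pair u (\<phi> s) (\<psi> s) (w' s))"
      unfolding z_def l1(1)[OF p(9) q(9)] l1(2)[OF p(9) q(9)] l2(1)[OF f(3) q(9)] l2(1)[OF f(2) q(9)]
        l2(2)[OF f(2) q(9)] l3(1)[OF f(3) p(2)] l3(1)[OF f(2) p(3)] l3(1)[OF f(2) p(2)] l3(2)[OF f(2) p(2)]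
      by (simp add: algebra_simps)
    also have "\<dots> = pair u R\<phi> (\<psi> r) (w r) + h * pair u (\<phi>' s) D\<psi> (w r) + h * pair u (\<phi>' s) (\<psi> s) Dw
        + pair u (\<phi> s) R\<psi> (w r) + h * pair u (\<phi> s) (\<psi>' s) Dw + pair u (\<phi> s) (\<psi> s) Rw"
      by (simp add: zero[OF s])
    finally have eq: "z r - z s = \<dots>" .
    have B: "\<bar>pair u \<Phi> \<Psi> W\<bar> \<le> A1 * A2 * A3 * size_u"
      if "sq_int lebesgue \<Phi>" "sq_int lebesgue \<Psi>" "sq_int lebesgue W"
        "sq_norm lebesgue \<Phi> \<le> A1" "sq_norm lebesgue \<Psi> \<le> A2" "sq_norm lebesgue W \<le> A3" for \<Phi> \<Psi> W A1 A2 A3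
    proof -
      have A: "0 \<le> A1" "0 \<le> A2" using that(4,5) sq_norm_nonneg order_trans by blast+
      have "\<bar>pair u \<Phi> \<Psi> W\<bar> \<le> sq_norm lebesgue \<Phi> * sq_norm lebesgue \<Psi> * sq_norm lebesgue W * size_u"
        by (rule pair_bound[OF that(1-3)])
      also have "\<dots> \<le> A1 * A2 * A3 * size_u"
        by (intro mult_right_mono mult_mono that(4-6) mult_nonneg_nonneg sq_norm_nonneg size_u_nonneg A)
      finally show ?thesis .
    qed
    have hh: "\<bar>h\<bar> * \<bar>h\<bar> = h\<^sup>2" by (simp add: power2_eq_square abs_mult_self_eq)
    have k1: "\<bar>h * t\<bar> \<le> K * K * K * size_u * h\<^sup>2" if "\<bar>t\<bar> \<le> K * (K * \<bar>h\<bar>) * K * size_u \<or> \<bar>t\<bar> \<le> K * K * (K * \<bar>h\<bar>) * size_u" for t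
    proof -
      have "\<bar>t\<bar> \<le> K * K * K * size_u * \<bar>h\<bar>" using that by (auto simp: mult_ac)
      then have "\<bar>h\<bar> * \<bar>t\<bar> \<le> \<bar>h\<bar> * (K * K * K * size_u * \<bar>h\<bar>)" by (rule mult_left_mono) simp
      also have "\<dots> = K * K * K * size_u * (\<bar>h\<bar> * \<bar>h\<bar>)" by (simp only: mult_ac)
      finally show ?thesis unfolding hh by (simp add: abs_mult)
    qed
    have b1: "\<bar>pair u R\<phi> (\<psi> r) (w r)\<bar> \<le> K * K * K * size_u * h\<^sup>2"
      using B[OF sR(1) p(9) q(9) nR(1) p(11) q(11)] by (simp add: mult_ac)
    have b4: "\<bar>pair u (\<phi> s) R\<psi> (w r)\<bar> \<le> K * K * K * size_u * h\<^sup>2"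
      using B[OF f(2) sR(2) q(9) f(4) nR(2) q(11)] by (simp add: mult_ac)
    have b6: "\<bar>pair u (\<phi> s) (\<psi> s) Rw\<bar> \<le> K * K * K * size_u * h\<^sup>2"
      using B[OF f(2) p(2) sR(3) f(4) p(4) nR(3)] by (simp add: mult_ac)
    have b2: "\<bar>h * pair u (\<phi>' s) D\<psi> (w r)\<bar> \<le> K * K * K * size_u * h\<^sup>2"
      by (rule k1) (use B[OF f(3) sD(2) q(9) f(5) nD(1) q(11)] in simp)
    have b3: "\<bar>h * pair u (\<phi>' s) (\<psi> s) Dw\<bar> \<le> K * K * K * size_u * h\<^sup>2"
      by (rule k1) (use B[OF f(3) p(2) sD(3) f(5) p(4) nD(2)] in simp)
    have b5: "\<bar>h * pair u (\<phi> s) (\<psi>' s) Dw\<bar> \<le> K * K * K * size_u * h\<^sup>2"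
      by (rule k1) (use B[OF f(2) p(3) sD(3) f(4) p(5) nD(2)] in simp)
    have "\<bar>z r - z s\<bar> \<le> 6 * (K * K * K * size_u * h\<^sup>2)"
      unfolding eq using b1 b2 b3 b4 b5 b6 by linarith
    then show ?thesis by (simp add: C_def h_def)
  qed
  have "(z has_real_derivative 0) (at s within {a..b})" if s: "s \<in> {a..b}" for s
    unfolding has_field_derivative_iff
  proof (rule Lim_null_comparison[where g = "\<lambda>r. C * \<bar>r - s\<bar>"])
    show "\<forall>\<^sub>F r in at s within {a..b}. norm ((z r - z s) / (r - s)) \<le> C * \<bar>r - s\<bar>"
      unfolding eventually_at_filter
    proof (intro always_eventually allI impI)
      fix r assume r: "r \<noteq> s" "r \<in> {a..b}"
      have "\<bar>z r - z s\<bar> \<le> C * \<bar>r - s\<bar> * \<bar>r - s\<bar>"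
        using quad[OF s r(2)] by (simp add: power2_eq_square abs_mult_self_eq mult.assoc)
      then show "norm ((z r - z s) / (r - s)) \<le> C * \<bar>r - s\<bar>" using r by (simp add: field_simps)
    qed
    have "((\<lambda>r. C * \<bar>r - s\<bar>) \<longlongrightarrow> C * \<bar>s - s\<bar>) (at s within {a..b})" by (intro tendsto_intros)
    then show "((\<lambda>r. C * \<bar>r - s\<bar>) \<longlongrightarrow> 0) (at s within {a..b})" by simp
  qed
  then obtain k where "\<And>s. s \<in> {a..b} \<Longrightarrow> z s = k"
    using has_field_derivative_zero_constant[of "{a..b}" z] by auto
  then show ?thesis using sr by (simp add: z_def)
qed

end

section \<open>Backward heat kernels as test functions\<close>

text \<open>The backward heat kernel without its factor (4 pi)^(-n/2), with the power (c - s)^(-n/2)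
  written into the exponent.\<close>

definition heat_kernel :: "real \<Rightarrow> 'a::euclidean_space \<Rightarrow> real \<Rightarrow> 'a \<Rightarrow> real" where
  "heat_kernel c y s = gauss (1 / (4 * (c - s))) (DIM('a) / 2 * ln (1 / (c - s))) y"

text \<open>The derivative of \<open>heat_kernel\<close> with respect to \<open>s\<close>, as
  \<open>heat_kernel_curve\<close> confirms. It is a polynomial in 1/(c - s), whose own derivative
  in \<open>s\<close> is its square.\<close>

definition heat_kernel' :: "real \<Rightarrow> 'a::euclidean_space \<Rightarrow> real \<Rightarrow> 'a \<Rightarrow> real" where
  "heat_kernel' c y s x = (DIM('a) / 2 * (1 / (c - s)) - (norm (x - y))\<^sup>2 / 4 * (1 / (c - s))\<^sup>2) * heat_kernel c y s x"

text \<open>This is the backward heat equation for the kernel.\<close>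

lemma laplacian_heat_kernel:
  "(\<lambda>x. \<Sum>b\<in>Basis. grad_entry (grad_entry (heat_kernel c y s) b) b x) = (\<lambda>x. - heat_kernel' c y s x)"
proof -
  have 1: "1 / (4 * (c - s)) = 1 / (c - s) / 4" by simp
  have 2: "4 * (q / 4)\<^sup>2 * r - 2 * (q / 4) * n = - (n / 2 * q - r / 4 * q\<^sup>2)" for q r n :: real
    by (simp add: power2_eq_square algebra_simps)
  show ?thesis unfolding heat_kernel'_def heat_kernel_def laplacian_gauss 1 2 mult_minus_left ..
qed

text \<open>On an interval that stays away from \<open>c\<close> the parameter q = 1/(c - s) lies
  between \<open>1 / c\<close> and \<open>Q\<close>, so one Gaussian with polynomial weight
  dominates the kernel and its first two time derivatives. The constant depends on \<open>b\<close>;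
  this is harmless because the curve only serves to show constancy up to each time before
  \<open>c\<close>.\<close>

lemma heat_kernel_curve:
  fixes y :: "'a::euclidean_space"
  assumes b: "0 \<le> b" "b < c"
  obtains K where "L2_curve {0..b} (heat_kernel c y) (heat_kernel' c y) K"
proof -
  define n where "n = real DIM('a)"
  define Q where "Q = 1 / (c - b)"
  \<comment> \<open>A common bound for the coefficients of \<open>p\<close> and \<open>p'\<close>.
    The summand 1 ensures \<open>1 \<le> A\<close>, so that the kernel itself is covered
    too.\<close>
  define A where "A = n * Q + Q\<^sup>2 + n * Q\<^sup>2 + Q ^ 3 + 1"
  define L where "L = n / 2 * ln Q"
  define p where "p q x = n / 2 * q - (norm (x - y))\<^sup>2 / 4 * q\<^sup>2" for q and x :: 'a
  \<comment> \<open>This is the derivative of \<open>p (q s) x\<close> in \<open>s\<close>, not in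
    \<open>q\<close>: it contains the factor \<open>q\<^sup>2\<close> from the derivative of
    \<open>q s\<close>.\<close>
  define p' where "p' q x = n / 2 * q\<^sup>2 - (norm (x - y))\<^sup>2 / 2 * q ^ 3" for q and x :: 'a
  define q where "q s = 1 / (c - s)" for s
  \<comment> \<open>\<open>exp L\<close> is the largest amplitude, attained at \<open>b\<close>, and
    \<open>1 / (4 * c)\<close> the slowest decay, attained at time 0. In the second derivative
    \<open>A\<close> bounds the contribution of \<open>p'\<close> and \<open>A\<^sup>2\<close> that
    of the square of \<open>p\<close>.\<close>
  define G where "G x = (A + A\<^sup>2) * exp L * (1 + (norm (x - y))\<^sup>2)\<^sup>2 * gauss (1 / (4 * c)) 0 y x" for x
  have n0: "0 \<le> n" by (simp add: n_def)
  have Q0: "0 < Q" using b by (simp add: Q_def)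
  have A1: "1 \<le> A" using n0 Q0 by (simp add: A_def)
  have qb: "0 < q s" "q s \<le> Q" "1 / c \<le> q s" if "s \<in> {0..b}" for s
    using that b by (auto simp: q_def Q_def frac_le)
  have hk: "heat_kernel c y s x = exp (n / 2 * ln (q s) - q s * ((norm (x - y))\<^sup>2 / 4))" for s x
    by (simp add: heat_kernel_def gauss_def n_def q_def)
  have hk': "heat_kernel' c y s x = p (q s) x * heat_kernel c y s x" for s x
    by (simp add: heat_kernel'_def p_def q_def n_def)
  have dq: "(q has_real_derivative (q s)\<^sup>2) (at s)" if "s \<in> {0..b}" for s
    unfolding q_def[abs_def] using that b
    by (auto intro!: derivative_eq_intros simp: power2_eq_square field_simps)
  have d1: "((\<lambda>s. heat_kernel c y s x) has_real_derivative heat_kernel' c y s x) (at s)" if s: "s \<in> {0..b}" for s x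
  proof -
    have "((\<lambda>s. exp (n / 2 * ln (q s) - q s * ((norm (x - y))\<^sup>2 / 4))) has_real_derivative
        exp (n / 2 * ln (q s) - q s * ((norm (x - y))\<^sup>2 / 4)) * (n / 2 * (1 / q s * (q s)\<^sup>2) - (q s)\<^sup>2 * ((norm (x - y))\<^sup>2 / 4))) (at s)"
      using qb(1)[OF s] dq[OF s] by (auto intro!: derivative_eq_intros)
    moreover have "n / 2 * (1 / q s * (q s)\<^sup>2) - (q s)\<^sup>2 * ((norm (x - y))\<^sup>2 / 4) = p (q s) x"
      using qb(1)[OF s] by (simp add: p_def power2_eq_square)
    ultimately show ?thesis by (simp add: hk' hk mult.commute)
  qed
  have d2: "((\<lambda>s. heat_kernel' c y s x) has_real_derivative (p' (q s) x + (p (q s) x)\<^sup>2) * heat_kernel c y s x) (at s)"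
    if s: "s \<in> {0..b}" for s x
  proof -
    have "((\<lambda>s. p (q s) x) has_real_derivative n / 2 * (q s)\<^sup>2 - (norm (x - y))\<^sup>2 / 4 * (2 * q s * (q s)\<^sup>2)) (at s)"
      unfolding p_def using dq[OF s] by (auto intro!: derivative_eq_intros)
    moreover have "n / 2 * (q s)\<^sup>2 - (norm (x - y))\<^sup>2 / 4 * (2 * q s * (q s)\<^sup>2) = p' (q s) x"
      by (simp add: p'_def power2_eq_square power3_eq_cube)
    ultimately have dp: "((\<lambda>s. p (q s) x) has_real_derivative p' (q s) x) (at s)" by simp
    have "((\<lambda>s. p (q s) x * heat_kernel c y s x) has_real_derivative
       p' (q s) x * heat_kernel c y s x + heat_kernel' c y s x * p (q s) x) (at s)"
      by (rule DERIV_mult[OF dp d1[OF s]])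
    then show ?thesis unfolding hk' by (simp add: algebra_simps power2_eq_square)
  qed
  have e: "heat_kernel c y s x \<le> exp L * gauss (1 / (4 * c)) 0 y x" if s: "s \<in> {0..b}" for s x
  proof -
    have "n / 2 * ln (q s) \<le> L" unfolding L_def using qb[OF s] n0 by (intro mult_left_mono) auto
    moreover have "1 / c * ((norm (x - y))\<^sup>2 / 4) \<le> q s * ((norm (x - y))\<^sup>2 / 4)"
      using qb(3)[OF s] by (intro mult_right_mono) auto
    ultimately have "n / 2 * ln (q s) - q s * ((norm (x - y))\<^sup>2 / 4) \<le> L + (0 - 1 / (4 * c) * (norm (x - y))\<^sup>2)" by simp
    then show ?thesis unfolding hk gauss_def exp_add[symmetric] by simp
  qed
  have bnd: "\<bar>z * heat_kernel c y s x\<bar> \<le> G x"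
    if s: "s \<in> {0..b}" and z: "\<bar>z\<bar> \<le> (A + A\<^sup>2) * (1 + (norm (x - y))\<^sup>2)\<^sup>2" for s x z
  proof -
    have "\<bar>z\<bar> * heat_kernel c y s x \<le> ((A + A\<^sup>2) * (1 + (norm (x - y))\<^sup>2)\<^sup>2) * (exp L * gauss (1 / (4 * c)) 0 y x)"
      using z e[OF s] A1 by (intro mult_mono) (auto simp: hk)
    then show ?thesis by (simp add: G_def abs_mult hk mult_ac)
  qed
  have pb: "\<bar>p (q s) x\<bar> \<le> A * (1 + (norm (x - y))\<^sup>2)" "\<bar>p' (q s) x\<bar> \<le> A * (1 + (norm (x - y))\<^sup>2)" if s: "s \<in> {0..b}" for s x
  proof -
    define r where "r = (norm (x - y))\<^sup>2"
    have r: "0 \<le> r" by (simp add: r_def)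
    have q0: "0 \<le> q s" using qb(1)[OF s] by simp
    have a1: "n / 2 * q s \<le> A" "n / 2 * (q s)\<^sup>2 \<le> A" "(q s)\<^sup>2 / 4 \<le> A" "(q s) ^ 3 / 2 \<le> A"
    proof -
      have "n * q s \<le> n * Q" "n * (q s)\<^sup>2 \<le> n * Q\<^sup>2" "(q s)\<^sup>2 \<le> Q\<^sup>2" "(q s) ^ 3 \<le> Q ^ 3"
        using qb[OF s] n0 by (auto intro!: mult_left_mono power_mono)
      moreover have "0 \<le> n * q s" "0 \<le> n * (q s)\<^sup>2" "0 \<le> (q s)\<^sup>2" "0 \<le> (q s) ^ 3" using q0 n0 by auto
      ultimately show "n / 2 * q s \<le> A" "n / 2 * (q s)\<^sup>2 \<le> A" "(q s)\<^sup>2 / 4 \<le> A" "(q s) ^ 3 / 2 \<le> A"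
        unfolding A_def times_divide_eq_left by linarith+
    qed
    have a2: "r * ((q s)\<^sup>2 / 4) \<le> r * A" "r * ((q s) ^ 3 / 2) \<le> r * A" by (rule mult_left_mono[OF a1(3) r] mult_left_mono[OF a1(4) r])+
    have a3: "0 \<le> n / 2 * q s" "0 \<le> n / 2 * (q s)\<^sup>2" "0 \<le> r * ((q s)\<^sup>2 / 4)" "0 \<le> r * ((q s) ^ 3 / 2)" using q0 n0 r by auto
    have "p (q s) x = n / 2 * q s - r * ((q s)\<^sup>2 / 4)" "p' (q s) x = n / 2 * (q s)\<^sup>2 - r * ((q s) ^ 3 / 2)"
      by (simp_all add: p_def p'_def r_def)
    moreover have "A * (1 + r) = A + r * A" by (simp add: algebra_simps)
    ultimately show "\<bar>p (q s) x\<bar> \<le> A * (1 + (norm (x - y))\<^sup>2)" "\<bar>p' (q s) x\<bar> \<le> A * (1 + (norm (x - y))\<^sup>2)"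
      unfolding r_def[symmetric] using a1(1,2) a2 a3 A1 by linarith+
  qed
  have sqr: "1 \<le> (1 + r)\<^sup>2" "1 + r \<le> (1 + r)\<^sup>2" if "0 \<le> r" for r :: real
    using that by (auto simp: power2_eq_square algebra_simps)
  have G: "sq_int lebesgue G"
  proof (rule sq_int_gauss_poly[of "1 / (4 * c)" _ "(A + A\<^sup>2) * exp L" y])
    show "continuous_on UNIV G" unfolding G_def[abs_def] by (intro continuous_intros continuous_gauss)
    show "\<bar>G x\<bar> \<le> (A + A\<^sup>2) * exp L * (1 + (norm (x - y))\<^sup>2)\<^sup>2 * gauss (1 / (4 * c)) 0 y x" for x
    proof -
      have "0 \<le> G x" unfolding G_def using A1 gauss_pos[of "1 / (4 * c)" 0 y x]
        by (intro mult_nonneg_nonneg add_nonneg_nonneg) auto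
      then show ?thesis by (simp add: G_def)
    qed
  qed (use b in auto)
  have "L2_curve {0..b} (heat_kernel c y) (heat_kernel' c y) (sq_norm lebesgue G)"
  proof (rule L2_curveI[OF G _ _ d1 d2])
    have cont: "continuous_on UNIV (heat_kernel c y s)" for s
      unfolding heat_kernel_def by (rule continuous_gauss)
    show "heat_kernel c y s \<in> borel_measurable lebesgue" for s
      unfolding heat_kernel_def by (rule gauss_measurable)
    show "heat_kernel' c y s \<in> borel_measurable lebesgue" for s
      unfolding heat_kernel'_def[abs_def]
      by (intro borel_imp_lebesgue_measurable borel_measurable_continuous_onI continuous_intros cont) auto
    fix s x assume s: "s \<in> {0..b}"
    define r where "r = (norm (x - y))\<^sup>2"
    have r: "0 \<le> r" by (simp add: r_def)
    have AA: "1 \<le> A + A\<^sup>2" "A \<le> A + A\<^sup>2" using A1 zero_le_power2[of A] by linarith+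
    have t1: "A * (1 + r) \<le> (A + A\<^sup>2) * (1 + r)\<^sup>2" using AA(2) sqr(2)[OF r] A1 r by (intro mult_mono) auto
    have "1 * 1 \<le> (A + A\<^sup>2) * (1 + r)\<^sup>2" using AA(1) sqr(1)[OF r] by (intro mult_mono) auto
    then show "\<bar>heat_kernel c y s x\<bar> \<le> G x" using bnd[OF s, of 1 x] by (simp add: r_def)
    show "\<bar>heat_kernel' c y s x\<bar> \<le> G x"
      unfolding hk' using pb(1)[OF s, of x] t1 by (intro bnd[OF s]) (simp add: r_def)
    have "(p (q s) x)\<^sup>2 \<le> (A * (1 + r))\<^sup>2"
      using power_mono[OF pb(1)[OF s, of x] abs_ge_zero, of 2] by (simp add: r_def)
    moreover have "A * (1 + r) \<le> A * (1 + r)\<^sup>2" using sqr(2)[OF r] A1 by (intro mult_left_mono) auto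
    moreover have "(A + A\<^sup>2) * (1 + r)\<^sup>2 = A * (1 + r)\<^sup>2 + (A * (1 + r))\<^sup>2" by (simp add: power_mult_distrib distrib_right)
    ultimately have "\<bar>p' (q s) x + (p (q s) x)\<^sup>2\<bar> \<le> (A + A\<^sup>2) * (1 + r)\<^sup>2"
      using pb(2)[OF s, of x] zero_le_power2[of "p (q s) x"] unfolding r_def[symmetric] by linarith
    then show "\<bar>(p' (q s) x + (p (q s) x)\<^sup>2) * heat_kernel c y s x\<bar> \<le> G x"
      unfolding r_def by (rule bnd[OF s])
  qed
  then show ?thesis by (rule that)
qed

section \<open>Translates of test functions in time\<close>

lemma deriv_shift:
  fixes \<phi> :: "real \<Rightarrow> real"
  assumes "\<And>k. Ck k \<phi>"
  shows "deriv (\<lambda>t. \<phi> (t - s)) = (\<lambda>t. deriv \<phi> (t - s))"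
    "((\<lambda>s. \<phi> (t - s)) has_real_derivative - deriv \<phi> (t - s)) (at s)"
proof -
  have d: "(\<phi> has_real_derivative deriv \<phi> t) (at t)" for t
    by (rule Ck_real_deriv(1)[OF assms[of "Suc 0"]])
  have "((\<lambda>t. \<phi> (t - s)) has_real_derivative deriv \<phi> (t - s) * 1) (at t)" for t
    by (rule DERIV_chain2[OF d]) (auto intro!: derivative_eq_intros)
  then show "deriv (\<lambda>t. \<phi> (t - s)) = (\<lambda>t. deriv \<phi> (t - s))"
    by (intro ext DERIV_imp_deriv) simp
  have "((\<lambda>s. \<phi> (t - s)) has_real_derivative deriv \<phi> (t - s) * (- 1)) (at s)"
    by (rule DERIV_chain2[OF d]) (auto intro!: derivative_eq_intros)
  then show "((\<lambda>s. \<phi> (t - s)) has_real_derivative - deriv \<phi> (t - s)) (at s)" by simp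
qed

lemma Ck_deriv:
  fixes \<phi> :: "real \<Rightarrow> real"
  shows "(\<And>k. Ck k \<phi>) \<Longrightarrow> Ck k (deriv \<phi>)"
  using Ck_real_deriv(2)[of k \<phi>] by blast

lemma deriv_zero_outside:
  fixes \<phi> :: "real \<Rightarrow> real"
  assumes "\<And>k. Ck k \<phi>" "\<And>t. t \<notin> {l..u} \<Longrightarrow> \<phi> t = 0" "t \<notin> {l..u}"
  shows "deriv \<phi> t = 0"
  using Ck_real_deriv(3)[OF assms(1)[of "Suc 0"], of t] frechet_derivative_zero_outside[of l u \<phi> t] assms(2,3)
  by (simp add: cbox_interval)

lemma shift_test_function:
  fixes \<phi> :: "real \<Rightarrow> real"
  assumes "\<And>k. Ck k \<phi>" "\<And>t. t \<notin> {l..u} \<Longrightarrow> \<phi> t = 0" "{l + s..u + s} \<subseteq> \<Omega>"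
  shows "(\<lambda>t. \<phi> (t - s)) \<in> test_functions \<Omega>"
proof (rule test_functionsI[of _ "l + s" "u + s"])
  show "Ck k (\<lambda>t. \<phi> (t - s))" for k
    by (rule Ck_compose[OF assms(1)]) (intro Ck_diff Ck_const Ck_bounded_linear bounded_linear_ident)
qed (use assms in \<open>auto simp: cbox_interval\<close>)

text \<open>All translates by at most \<open>b\<close> live in one bounded interval, so a multiple
  of its indicator dominates the function and its first two derivatives.\<close>

lemma shift_curve:
  fixes \<phi> :: "real \<Rightarrow> real"
  assumes \<phi>: "\<And>k. Ck k \<phi>" "\<And>t. t \<notin> {l..u} \<Longrightarrow> \<phi> t = 0"
  obtains K where "L2_curve {0..b} (\<lambda>s t. \<phi> (t - s)) (\<lambda>s t. - deriv \<phi> (t - s)) K"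
proof -
  have \<phi>': "Ck k (deriv \<phi>)" "t \<notin> {l..u} \<Longrightarrow> deriv \<phi> t = 0" for k t
    by (rule Ck_deriv[OF \<phi>(1)], rule deriv_zero_outside[of \<phi> l u, OF \<phi>(1) \<phi>(2)])
  have \<phi>'': "Ck k (deriv (deriv \<phi>))" "t \<notin> {l..u} \<Longrightarrow> deriv (deriv \<phi>) t = 0" for k t
    by (rule Ck_deriv[OF \<phi>'(1)], rule deriv_zero_outside[of "deriv \<phi>" l u, OF \<phi>'(1) \<phi>'(2)])
  have bd: "\<exists>M\<ge>0. \<forall>t. \<bar>f t\<bar> \<le> M" if f: "\<And>k. Ck k f" "\<And>t. t \<notin> {l..u} \<Longrightarrow> f t = 0" for f :: "real \<Rightarrow> real"
  proof -
    have "f t = 0" if "t \<notin> cbox l u" for t using f(2) that by (simp add: cbox_interval)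
    from bounded_if_continuous_compact_support[OF Ck_continuous[OF f(1)] this] show ?thesis by blast
  qed
  have "\<exists>M\<ge>0. \<forall>t. \<bar>\<phi> t\<bar> \<le> M" by (rule bd[OF \<phi>(1) \<phi>(2)])
  then obtain M1 where M1: "0 \<le> M1" "\<And>t. \<bar>\<phi> t\<bar> \<le> M1" by blast
  have "\<exists>M\<ge>0. \<forall>t. \<bar>deriv \<phi> t\<bar> \<le> M" by (rule bd[OF \<phi>'(1) \<phi>'(2)])
  then obtain M2 where M2: "0 \<le> M2" "\<And>t. \<bar>deriv \<phi> t\<bar> \<le> M2" by blast
  have "\<exists>M\<ge>0. \<forall>t. \<bar>deriv (deriv \<phi>) t\<bar> \<le> M" by (rule bd[OF \<phi>''(1) \<phi>''(2)])
  then obtain M3 where M3: "0 \<le> M3" "\<And>t. \<bar>deriv (deriv \<phi>) t\<bar> \<le> M3" by blast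
  note M = M1 M2 M3
  \<comment> \<open>The margin 1 puts the closed interval from \<open>l\<close> to
    \<open>u + b\<close> inside an open box.\<close>
  define G where "G t = (M1 + M2 + M3) * indicator (box (l - 1) (u + b + 1)) t" for t :: real
  have G: "sq_int lebesgue G" unfolding G_def[abs_def] by (intro sq_int_cmult(1) sq_int_indicator_box)
  have le: "\<bar>f (t - s)\<bar> \<le> G t"
    if "\<And>t. t \<notin> {l..u} \<Longrightarrow> f t = 0" "\<And>t. \<bar>f t\<bar> \<le> M1 + M2 + M3" "s \<in> {0..b}" for f :: "real \<Rightarrow> real" and s t
  proof (cases "t \<in> box (l - 1) (u + b + 1)")
    case True then show ?thesis using that(2) by (simp add: G_def)
  next
    case False
    then have "t - s \<notin> {l..u}" using that(3) by (auto simp: box_real)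
    then show ?thesis using that(1) False by (simp add: G_def)
  qed
  have m: "(\<lambda>t. f (t - s)) \<in> borel_measurable lebesgue" if "\<And>k. Ck k f" for f :: "real \<Rightarrow> real" and s
    by (rule Ck_measurable[of 0], rule Ck_compose[OF that])
      (intro Ck_diff Ck_const Ck_bounded_linear bounded_linear_ident)
  have "L2_curve {0..b} (\<lambda>s t. \<phi> (t - s)) (\<lambda>s t. - deriv \<phi> (t - s)) (sq_norm lebesgue G)"
  proof (rule L2_curveI[OF G])
    fix s t assume s: "s \<in> {0..b}"
    show "(\<lambda>t. \<phi> (t - s)) \<in> borel_measurable lebesgue" by (rule m[OF \<phi>(1)])
    show "(\<lambda>t. - deriv \<phi> (t - s)) \<in> borel_measurable lebesgue"
      by (intro borel_measurable_uminus m[OF \<phi>'(1)])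
    show "((\<lambda>s. \<phi> (t - s)) has_real_derivative - deriv \<phi> (t - s)) (at s)" by (rule deriv_shift(2)[OF \<phi>(1)])
    show "((\<lambda>s. - deriv \<phi> (t - s)) has_real_derivative deriv (deriv \<phi>) (t - s)) (at s)"
      using DERIV_minus[OF deriv_shift(2)[OF \<phi>'(1)]] by simp
    show "\<bar>\<phi> (t - s)\<bar> \<le> G t" by (rule le[OF \<phi>(2) _ s]) (use M in \<open>auto intro: order_trans[OF M(2)]\<close>)
    show "\<bar>- deriv \<phi> (t - s)\<bar> \<le> G t"
      unfolding abs_minus_cancel by (rule le[OF \<phi>'(2) _ s]) (use M in \<open>auto intro: order_trans[OF M(4)]\<close>)
    show "\<bar>deriv (deriv \<phi>) (t - s)\<bar> \<le> G t"
      by (rule le[OF \<phi>''(2) _ s]) (use M in \<open>auto intro: order_trans[OF M(6)]\<close>)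
  qed
  then show ?thesis by (rule that)
qed

section \<open>Solutions that vanish near the origin of space\<close>

locale vanishing_solution = two_time_function u for u :: "real \<Rightarrow> real \<Rightarrow> 'a::euclidean_space \<Rightarrow> real" +
  fixes T R \<tau>hat :: real
  assumes solution: "AE t in lebesgue. AE \<tau> in lebesgue_on {0<..}. AE x in lebesgue.
        weak_deriv UNIV (bochner_H1 {0<..} (sobolev 2)) u t \<tau> x + weak_deriv {0<..} (sobolev 2) (u t) \<tau> x
          - weak_laplacian (u t \<tau>) x = 0"
    and vanishing: "AE t in lebesgue. AE \<tau> in lebesgue_on {0<..}. AE x in lebesgue.
        norm x < R \<and> 0 < \<tau> \<and> \<tau> < \<tau>hat \<and> \<bar>t\<bar> < T \<longrightarrow> u t \<tau> x = 0"
begin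

text \<open>Where both time factors are nonzero, the solution is 0 for \<open>norm x < R\<close>, so
  the space factor may be altered there freely. This is how the peak of the kernel is
  removed.\<close>

lemma pair_cutoff:
  assumes \<phi>: "sq_int lebesgue \<phi>" "\<And>t. \<not> \<bar>t\<bar> < T \<Longrightarrow> \<phi> t = 0"
    and \<psi>: "sq_int lebesgue \<psi>" "\<And>\<tau>. \<not> (0 < \<tau> \<and> \<tau> < \<tau>hat) \<Longrightarrow> \<psi> \<tau> = 0"
    and w: "sq_int lebesgue w" and w': "sq_int lebesgue w'" and eq: "\<And>x. R \<le> norm x \<Longrightarrow> w x = w' x"
  shows "pair u \<phi> \<psi> w = pair u \<phi> \<psi> w'"
  unfolding pair_def
proof (rule integral_cong_AE)
  show "AE t in lebesgue. \<phi> t * pair_tau \<psi> w (u t) = \<phi> t * pair_tau \<psi> w' (u t)"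
    using vanishing u_AE_L2
  proof eventually_elim
    case (elim t)
    show ?case
    proof (cases "\<bar>t\<bar> < T")
      case True
      have "pair_tau \<psi> w (u t) = pair_tau \<psi> w' (u t)"
        unfolding pair_tau_def
      proof (rule integral_cong_AE)
        show "AE \<tau> in lebesgue_on {0<..}. \<psi> \<tau> * pair_x w (u t \<tau>) = \<psi> \<tau> * pair_x w' (u t \<tau>)"
          using elim(1) bochner_L2_AE[OF elim(2)]
        proof eventually_elim
          case (elim \<tau>)
          show ?case
          proof (cases "0 < \<tau> \<and> \<tau> < \<tau>hat")
            case True
            have "pair_x w (u t \<tau>) = pair_x w' (u t \<tau>)"
              unfolding pair_x_def
            proof (rule integral_cong_AE)
              show "AE x in lebesgue. u t \<tau> x * w x = u t \<tau> x * w' x"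
                using elim(1)
              proof eventually_elim
                case (elim x)
                then show ?case using True \<open>\<bar>t\<bar> < T\<close> eq[of x] by (cases "norm x < R") auto
              qed
              have "sq_int lebesgue (u t \<tau>)" by (rule vecs_H2_sq_int[OF elim(2)])
              then show "(\<lambda>x. u t \<tau> x * w x) \<in> borel_measurable lebesgue" "(\<lambda>x. u t \<tau> x * w' x) \<in> borel_measurable lebesgue"
                using sq_int_mult_integrable w w' by blast+
            qed
            then show ?thesis by simp
          qed (simp add: \<psi>(2))
        qed
      qed (rule borel_measurable_integrable[OF integrable_pair_tau[OF elim(2) w \<psi>(1)]]
          borel_measurable_integrable[OF integrable_pair_tau[OF elim(2) w' \<psi>(1)]])+
      then show ?thesis by simp
    qed (simp add: \<phi>(2))
  qed
qed (rule borel_measurable_integrable[OF integrable_pair[OF \<phi>(1) \<psi>(1) w]]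
    borel_measurable_integrable[OF integrable_pair[OF \<phi>(1) \<psi>(1) w']])+

text \<open>The pairing with the solution shifted along the characteristic direction and with a backward heat
  kernel is constant in \<open>s\<close>, and as \<open>s\<close> tends to \<open>c\<close> the kernel concentrates at \<open>y\<close>, near which the
  solution vanishes.\<close>

lemma pair_heat_kernel_eq_0:
  assumes \<phi>: "\<And>k. Ck k \<phi>" "\<And>t. t \<notin> {l1..u1} \<Longrightarrow> \<phi> t = 0" "- T < l1" "u1 + c < T"
    and \<psi>: "\<And>k. Ck k \<psi>" "\<And>t. t \<notin> {l2..u2} \<Longrightarrow> \<psi> t = 0" "0 < l2" "u2 + c < \<tau>hat"
    and c: "0 < c" and y: "norm y < R"
  shows "pair u \<phi> \<psi> (gauss (1 / (4 * c)) 0 y) = 0"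
proof -
  define n where "n = real DIM('a)"
  define \<Phi> where "\<Phi> s t = \<phi> (t - s)" for s t
  define \<Psi> where "\<Psi> s t = \<psi> (t - s)" for s t
  define z where "z s = pair u (\<Phi> s) (\<Psi> s) (heat_kernel c y s)" for s
  have \<Phi>test: "\<Phi> s \<in> test_functions UNIV" for s
    unfolding \<Phi>_def[abs_def] by (rule shift_test_function[OF \<phi>(1,2)]) auto
  have \<Psi>test: "\<Psi> s \<in> test_functions {0<..}" if "0 \<le> s" for s
    unfolding \<Psi>_def[abs_def] by (rule shift_test_function[OF \<psi>(1,2)]) (use \<psi>(3) that in auto)
  have dd: "deriv (\<Phi> s) = (\<lambda>t. deriv \<phi> (t - s))" "deriv (\<Psi> s) = (\<lambda>t. deriv \<psi> (t - s))" for s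
    unfolding \<Phi>_def[abs_def] \<Psi>_def[abs_def] by (intro deriv_shift(1) \<phi> \<psi>)+
  have hk: "sq_int lebesgue (heat_kernel c y s)" if "s < c" for s
    unfolding heat_kernel_def using that by (intro sq_int_gauss) auto
  have const: "z s = z 0" if s: "0 \<le> s" "s < c" for s
  proof -
    obtain K1 where K1: "L2_curve {0..s} (\<lambda>s t. \<phi> (t - s)) (\<lambda>s t. - deriv \<phi> (t - s)) K1"
      using shift_curve[OF \<phi>(1,2)] .
    obtain K2 where K2: "L2_curve {0..s} (\<lambda>s t. \<psi> (t - s)) (\<lambda>s t. - deriv \<psi> (t - s)) K2"
      using shift_curve[OF \<psi>(1,2)] .
    obtain K3 where K3: "L2_curve {0..s} (heat_kernel c y) (heat_kernel' c y) K3"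
      using heat_kernel_curve[OF s] .
    define K where "K = max K1 (max K2 K3)"
    have "L2_curve {0..s} \<Phi> (\<lambda>s t. - deriv \<phi> (t - s)) K" "L2_curve {0..s} \<Psi> (\<lambda>s t. - deriv \<psi> (t - s)) K"
      "L2_curve {0..s} (heat_kernel c y) (heat_kernel' c y) K"
      using L2_curve_mono[OF K1, of K] L2_curve_mono[OF K2, of K] L2_curve_mono[OF K3, of K]
      by (auto simp: K_def \<Phi>_def[abs_def] \<Psi>_def[abs_def])
    then show ?thesis unfolding z_def
    proof (rule pair_curve_constant)
      fix r assume "r \<in> {0..s}"
      then have r: "0 \<le> r" "r < c" using s by auto
      note s\<phi> = test_function_sq_int[OF \<Phi>test[of r]] and s\<psi> = test_function_sq_int[OF \<Psi>test[OF r(1)]]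
      have a: "0 < 1 / (4 * (c - r))" using r by simp
      \<comment> \<open>By the backward heat equation the negated time derivative of the kernel is
        its Laplacian. Together with the minus signs of the translated time factors this identifies
        the derivative along the curve with the negative of the weak equation.\<close>
      have w: "pair u (deriv (\<Phi> r)) (\<Psi> r) (heat_kernel c y r) + pair u (\<Phi> r) (deriv (\<Psi> r)) (heat_kernel c y r)
          + pair u (\<Phi> r) (\<Psi> r) (\<lambda>x. - heat_kernel' c y r x) = 0"
        unfolding laplacian_heat_kernel[symmetric] unfolding heat_kernel_def
        by (intro weak_equation[OF solution \<Phi>test \<Psi>test[OF r(1)]] Ck_gauss sq_int_gauss[OF a])
      have hk'r: "sq_int lebesgue (heat_kernel' c y r)"
        using L2_curveD(3)[OF K3, of r] \<open>r \<in> {0..s}\<close> by blast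
      have "pair u (\<lambda>t. - deriv (\<Phi> r) t) (\<Psi> r) (heat_kernel c y r) = - pair u (deriv (\<Phi> r)) (\<Psi> r) (heat_kernel c y r)"
        using pair_linear_t[OF s\<phi>(2) s\<phi>(2) s\<psi>(1) hk[OF r(2)], of "-1" 0] by simp
      moreover have "pair u (\<Phi> r) (\<lambda>t. - deriv (\<Psi> r) t) (heat_kernel c y r) = - pair u (\<Phi> r) (deriv (\<Psi> r)) (heat_kernel c y r)"
        using pair_linear_tau[OF s\<phi>(1) s\<psi>(2) s\<psi>(2) hk[OF r(2)], of "-1" 0] by simp
      moreover have "pair u (\<Phi> r) (\<Psi> r) (\<lambda>x. - heat_kernel' c y r x) = - pair u (\<Phi> r) (\<Psi> r) (heat_kernel' c y r)"
        using pair_linear_x[OF s\<phi>(1) s\<psi>(1) hk'r hk'r, of "-1" 0] by simp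
      ultimately show "pair u (\<lambda>t. - deriv \<phi> (t - r)) (\<Psi> r) (heat_kernel c y r) + pair u (\<Phi> r) (\<lambda>t. - deriv \<psi> (t - r)) (heat_kernel c y r)
          + pair u (\<Phi> r) (\<Psi> r) (heat_kernel' c y r) = 0"
        using w by (simp add: dd)
    qed (use s in auto)
  qed
  \<comment> \<open>These bounds are taken on the interval up to \<open>c\<close>, so they stay
    fixed while \<open>s\<close> tends to \<open>c\<close>; only the kernel has to be estimated anew
    for each \<open>s\<close>.\<close>
  obtain K1 where K1: "L2_curve {0..c} (\<lambda>s t. \<phi> (t - s)) (\<lambda>s t. - deriv \<phi> (t - s)) K1"
    using shift_curve[OF \<phi>(1,2)] .
  obtain K2 where K2: "L2_curve {0..c} (\<lambda>s t. \<psi> (t - s)) (\<lambda>s t. - deriv \<psi> (t - s)) K2"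
    using shift_curve[OF \<psi>(1,2)] .
  define d where "d = R - norm y"
  have d: "0 < d" using y by (simp add: d_def)
  define N where "N = sq_norm lebesgue (gauss (1 / (8 * c)) 0 y)"
  define C where "C = K1 * K2 * N * size_u"
  \<comment> \<open>The parameter q = 1/(c - s) replaces \<open>s\<close>, so the limit becomes one
    at infinity; \<open>1 / c < q\<close> corresponds to positive \<open>s\<close>.\<close>
  have bound: "\<bar>z 0\<bar> \<le> C * exp (n / 2 * ln q - q * (d\<^sup>2 / 8))" if q: "1 / c < q" for q
  proof -
    define s where "s = c - 1 / q"
    have q0: "0 < q" using q c by (meson less_trans zero_less_divide_1_iff)
    have s: "0 \<le> s" "s < c" and cs: "1 / (c - s) = q"
      using q q0 c by (auto simp: s_def field_simps)
    define e where "e = exp (n / 2 * ln q - q * (d\<^sup>2 / 8))"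
    \<comment> \<open>The kernel without its part in the ball where the solution vanishes.\<close>
    define w' where "w' x = heat_kernel c y s x * indicator {x. R \<le> norm x} x" for x
    have clR: "closed {x::'a. R \<le> norm x}" by (intro closed_Collect_le continuous_intros)
    have mw': "w' \<in> borel_measurable lebesgue"
      unfolding w'_def[abs_def] using sq_intD(1)[OF hk[OF s(2)]] clR
      by (intro borel_measurable_times borel_measurable_indicator) auto
    have g8: "sq_int lebesgue (gauss (1 / (8 * c)) 0 y)" using c by (intro sq_int_gauss) auto
    have w'le: "\<bar>w' x\<bar> \<le> e * gauss (1 / (8 * c)) 0 y x" for x
    proof (cases "R \<le> norm x")
      case True
      have "d \<le> norm (x - y)" using True norm_triangle_ineq2[of x y] by (simp add: d_def)
      then have "d\<^sup>2 \<le> (norm (x - y))\<^sup>2" using d by (intro power_mono) auto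
      \<comment> \<open>The exponent is split in two halves: one yields the small factor through
        \<open>d\<close>, the distance from \<open>y\<close> to the complement of the ball, and the
        other, reduced to the rate at time 0, keeps a fixed square integrable Gaussian.\<close>
      then have 1: "q * (d\<^sup>2 / 8) \<le> q * ((norm (x - y))\<^sup>2 / 8)" using q0 by (intro mult_left_mono) auto
      have 2: "1 / c * ((norm (x - y))\<^sup>2 / 8) \<le> q * ((norm (x - y))\<^sup>2 / 8)" using q by (intro mult_right_mono) auto
      have "heat_kernel c y s x = exp (n / 2 * ln q - q * ((norm (x - y))\<^sup>2 / 4))"
      proof -
        have "1 / (4 * (c - s)) = q / 4" unfolding cs[symmetric] by simp
        then have "heat_kernel c y s = gauss (q / 4) (n / 2 * ln q) y" unfolding heat_kernel_def n_def cs by (rule arg_cong)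
        then show ?thesis by (simp add: gauss_def)
      qed
      also have "\<dots> \<le> exp ((n / 2 * ln q - q * (d\<^sup>2 / 8)) + (0 - 1 / (8 * c) * (norm (x - y))\<^sup>2))"
        using 1 2 by simp
      also have "\<dots> = e * gauss (1 / (8 * c)) 0 y x" unfolding e_def gauss_def by (rule exp_add)
      finally show ?thesis using True gauss_pos[of _ _ y x] unfolding w'_def by (simp add: heat_kernel_def abs_of_pos)
    next
      case False
      then show ?thesis using gauss_pos[of "1 / (8 * c)" 0 y x] by (simp add: w'_def e_def less_imp_le)
    qed
    have e0: "0 < e" by (simp add: e_def)
    have AEw': "AE x in lebesgue. \<bar>w' x\<bar> \<le> \<bar>e * gauss (1 / (8 * c)) 0 y x\<bar>"
      using w'le by (auto intro!: AE_I2 intro: order_trans[OF _ abs_ge_self])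
    have sw': "sq_int lebesgue w'" "sq_norm lebesgue w' \<le> e * N"
      using sq_int_bound[OF sq_int_cmult(1)[OF g8, of e] mw' AEw'] sq_int_cmult(2)[OF g8, of e] e0
      by (auto simp: N_def)
    note s\<phi> = test_function_sq_int(1)[OF \<Phi>test[of s]] and s\<psi> = test_function_sq_int(1)[OF \<Psi>test[OF s(1)]]
    have "z 0 = z s" using const[OF s] by simp
    also have "z s = pair u (\<Phi> s) (\<Psi> s) w'"
      unfolding z_def
    proof (rule pair_cutoff[OF s\<phi> _ s\<psi> _ hk[OF s(2)] sw'(1)])
      show "\<Phi> s t = 0" if "\<not> \<bar>t\<bar> < T" for t
        unfolding \<Phi>_def using that \<phi>(3,4) s by (intro \<phi>(2)) auto
      show "\<Psi> s t = 0" if "\<not> (0 < t \<and> t < \<tau>hat)" for t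
        unfolding \<Psi>_def using that \<psi>(3,4) s by (intro \<psi>(2)) auto
      show "heat_kernel c y s x = w' x" if "R \<le> norm x" for x using that by (simp add: w'_def)
    qed
    also have "\<bar>\<dots>\<bar> \<le> sq_norm lebesgue (\<Phi> s) * sq_norm lebesgue (\<Psi> s) * sq_norm lebesgue w' * size_u"
      by (rule pair_bound[OF s\<phi> s\<psi> sw'(1)])
    also have "\<dots> \<le> K1 * K2 * (e * N) * size_u"
    proof -
      have K: "sq_norm lebesgue (\<Phi> s) \<le> K1" "sq_norm lebesgue (\<Psi> s) \<le> K2" "0 \<le> K1" "0 \<le> K2"
        using L2_curveD(1,4)[OF K1, of s] L2_curveD(1,4)[OF K2, of s] s
        by (auto simp: \<Phi>_def[abs_def] \<Psi>_def[abs_def])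
      show ?thesis by (intro mult_right_mono mult_mono K sw' mult_nonneg_nonneg sq_norm_nonneg size_u_nonneg)
    qed
    finally show ?thesis by (simp add: C_def e_def mult_ac)
  qed
  have "((\<lambda>q. exp (n / 2 * ln q - q * (d\<^sup>2 / 8))) \<longlongrightarrow> 0) at_top"
  proof -
    define m where "m = n / 2"
    define e where "e = d\<^sup>2 / 8"
    have e: "0 < e" using d by (simp add: e_def)
    have "((\<lambda>q. exp (m * ln q - q * e)) \<longlongrightarrow> 0) at_top" using e by real_asymp
    then show ?thesis by (simp add: m_def e_def)
  qed
  from tendsto_mult_right_zero[OF this, of C]
  have "((\<lambda>q. C * exp (n / 2 * ln q - q * (d\<^sup>2 / 8))) \<longlongrightarrow> 0) at_top" .
  moreover have "\<forall>\<^sub>F q in at_top. \<bar>z 0\<bar> \<le> C * exp (n / 2 * ln q - q * (d\<^sup>2 / 8))"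
    using eventually_gt_at_top[of "1 / c"] by eventually_elim (rule bound)
  ultimately have "\<bar>z 0\<bar> \<le> 0"
    by (intro tendsto_le[OF trivial_limit_at_top_linorder _ tendsto_const]) auto
  then have "pair u \<phi> \<psi> (gauss (1 / (4 * c)) (n / 2 * ln (1 / c)) y) = 0"
    by (simp add: z_def \<Phi>_def[abs_def] \<Psi>_def[abs_def] heat_kernel_def n_def)
  \<comment> \<open>At time 0 the kernel is a constant nonzero multiple of the Gaussian in the
    claim.\<close>
  moreover have "gauss (1 / (4 * c)) (n / 2 * ln (1 / c)) y
      = (\<lambda>x. exp (n / 2 * ln (1 / c)) * gauss (1 / (4 * c)) 0 y x + 0 * gauss (1 / (4 * c)) 0 y x)"
    by (rule ext) (simp only: mult_zero_left add_0_right gauss_shift_const[of _ "n / 2 * ln (1 / c)"])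
  ultimately have eq0: "pair u \<phi> \<psi> (\<lambda>x. exp (n / 2 * ln (1 / c)) * gauss (1 / (4 * c)) 0 y x + 0 * gauss (1 / (4 * c)) 0 y x) = 0"
    by (simp only:)
  have sq: "sq_int lebesgue \<phi>" "sq_int lebesgue \<psi>"
    using test_function_sq_int(1)[OF \<Phi>test[of 0]] test_function_sq_int(1)[OF \<Psi>test[of 0]]
    by (auto simp: \<Phi>_def[abs_def] \<Psi>_def[abs_def])
  have sg: "sq_int lebesgue (gauss (1 / (4 * c)) 0 y)" using c by (intro sq_int_gauss) auto
  show ?thesis using eq0 unfolding pair_linear_x[OF sq sg sg] by simp
qed

end

section \<open>Density of products of Gaussian functions\<close>

text \<open>Completing the square: the new centre is the mean of the old ones weighted by their
  rates, and the distance between them goes into the amplitude.\<close>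

lemma gauss_mult:
  assumes ab: "0 < a + b"
  shows "gauss a 0 y x * gauss b 0 z x =
    gauss (a + b) (- (a * b / (a + b)) * (norm (y - z))\<^sup>2) ((1 / (a + b)) *\<^sub>R (a *\<^sub>R y + b *\<^sub>R z)) x"
proof -
  define p where "p = x - y"
  define q where "q = x - z"
  have 1: "y - z = q - p" by (simp add: p_def q_def)
  have 2: "x - (1 / (a + b)) *\<^sub>R (a *\<^sub>R y + b *\<^sub>R z) = (1 / (a + b)) *\<^sub>R (a *\<^sub>R p + b *\<^sub>R q)"
  proof -
    have "(a + b) *\<^sub>R (x - (1 / (a + b)) *\<^sub>R (a *\<^sub>R y + b *\<^sub>R z)) = (a + b) *\<^sub>R x - (a *\<^sub>R y + b *\<^sub>R z)"
      using ab by (simp add: scaleR_diff_right)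
    also have "\<dots> = a *\<^sub>R p + b *\<^sub>R q" by (simp add: p_def q_def algebra_simps)
    finally have "(1 / (a + b)) *\<^sub>R ((a + b) *\<^sub>R (x - (1 / (a + b)) *\<^sub>R (a *\<^sub>R y + b *\<^sub>R z))) = (1 / (a + b)) *\<^sub>R (a *\<^sub>R p + b *\<^sub>R q)"
      by (rule arg_cong)
    then show ?thesis using ab by simp
  qed
  have "(a + b) * (norm ((1 / (a + b)) *\<^sub>R (a *\<^sub>R p + b *\<^sub>R q)))\<^sup>2 = (norm (a *\<^sub>R p + b *\<^sub>R q))\<^sup>2 / (a + b)"
    using ab by (simp add: power_mult_distrib power2_eq_square)
  also have "(norm (a *\<^sub>R p + b *\<^sub>R q))\<^sup>2 = a\<^sup>2 * (norm p)\<^sup>2 + 2 * a * b * (p \<bullet> q) + b\<^sup>2 * (norm q)\<^sup>2"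
    unfolding power2_norm_eq_inner by (simp add: inner_add_left inner_add_right inner_commute power2_eq_square algebra_simps)
  finally have e1: "(a + b) * (norm ((1 / (a + b)) *\<^sub>R (a *\<^sub>R p + b *\<^sub>R q)))\<^sup>2
      = (a\<^sup>2 * (norm p)\<^sup>2 + 2 * a * b * (p \<bullet> q) + b\<^sup>2 * (norm q)\<^sup>2) / (a + b)" .
  have e2: "(norm (q - p))\<^sup>2 = (norm q)\<^sup>2 - 2 * (p \<bullet> q) + (norm p)\<^sup>2"
    unfolding power2_norm_eq_inner by (simp add: inner_diff_left inner_diff_right inner_commute)
  have "(a * (norm p)\<^sup>2 + b * (norm q)\<^sup>2) * (a + b) =
      a * b * ((norm q)\<^sup>2 - 2 * (p \<bullet> q) + (norm p)\<^sup>2) + (a\<^sup>2 * (norm p)\<^sup>2 + 2 * a * b * (p \<bullet> q) + b\<^sup>2 * (norm q)\<^sup>2)"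
    by (simp add: power2_eq_square algebra_simps)
  then have "a * (norm p)\<^sup>2 + b * (norm q)\<^sup>2 =
      (a * b * ((norm q)\<^sup>2 - 2 * (p \<bullet> q) + (norm p)\<^sup>2) + (a\<^sup>2 * (norm p)\<^sup>2 + 2 * a * b * (p \<bullet> q) + b\<^sup>2 * (norm q)\<^sup>2)) / (a + b)"
    using ab by (subst eq_divide_eq) simp
  also have "\<dots> = a * b / (a + b) * (norm (q - p))\<^sup>2 + (a + b) * (norm ((1 / (a + b)) *\<^sub>R (a *\<^sub>R p + b *\<^sub>R q)))\<^sup>2"
    unfolding e1 e2 by (simp add: add_divide_distrib)
  finally have "a * (norm p)\<^sup>2 + b * (norm q)\<^sup>2 = a * b / (a + b) * (norm (q - p))\<^sup>2 + (a + b) * (norm ((1 / (a + b)) *\<^sub>R (a *\<^sub>R p + b *\<^sub>R q)))\<^sup>2" .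
  then show ?thesis
    unfolding gauss_def exp_add[symmetric] 1 2 p_def[symmetric] q_def[symmetric] by simp
qed

definition gauss_family :: "real \<Rightarrow> ('a::euclidean_space \<Rightarrow> real) set" where
  "gauss_family R = {gauss a 0 y | a y. 0 \<le> a \<and> norm y < R}"

lemma gauss_in_family: "0 \<le> a \<Longrightarrow> norm y < R \<Longrightarrow> gauss a 0 y \<in> gauss_family R"
  unfolding gauss_family_def by blast

text \<open>The product of two generators is a multiple of a generator because the new centre is a
  convex combination of the old ones and thus stays in the ball. Bilinearity extends this to the
  span, one factor at a time.\<close>

lemma span_gauss_family_mult:
  fixes f g :: "'a::euclidean_space \<Rightarrow> real"
  assumes "f \<in> span (gauss_family R)" "g \<in> span (gauss_family R)"
  shows "(\<lambda>x. f x * g x) \<in> span (gauss_family R)"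
proof -
  let ?S = "span (gauss_family R)"
  have gens: "(\<lambda>x. f x * g x) \<in> ?S" if fg: "f \<in> gauss_family R" "g \<in> gauss_family R" for f g :: "'a \<Rightarrow> real"
  proof -
    obtain a y b z where f: "f = gauss a 0 y" "0 \<le> a" "norm y < R" and g: "g = gauss b 0 z" "0 \<le> b" "norm z < R"
      using fg by (auto simp: gauss_family_def)
    show ?thesis
    \<comment> \<open>The formula for the centre divides by \<open>a + b\<close>; if this is 0, both
      factors are the constant 1.\<close>
    proof (cases "a + b = 0")
      case True
      then have "a = 0" "b = 0" using f g by auto
      then have "(\<lambda>x. f x * g x) = f" using f g by (auto simp: gauss_def)
      then show ?thesis using fg by (simp add: span_base)
    next
      case False
      then have ab: "0 < a + b" using f g by auto
      define y' where "y' = (1 / (a + b)) *\<^sub>R (a *\<^sub>R y + b *\<^sub>R z)"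
      define \<beta> where "\<beta> = - (a * b / (a + b)) * (norm (y - z))\<^sup>2"
      have "norm y' < R"
      proof -
        have "y' = (a / (a + b)) *\<^sub>R y + (b / (a + b)) *\<^sub>R z" by (simp add: y'_def scaleR_add_right)
        moreover have "a / (a + b) + b / (a + b) = 1" using ab by (simp add: add_divide_distrib[symmetric])
        moreover have "convex (ball (0::'a) R)" by (rule convex_ball)
        ultimately have "y' \<in> ball 0 R" using f g ab unfolding convex_def by auto
        then show ?thesis by simp
      qed
      then have "gauss (a + b) 0 y' \<in> gauss_family R" using ab by (intro gauss_in_family) auto
      then have "exp \<beta> *\<^sub>R gauss (a + b) 0 y' \<in> ?S" by (intro span_scale span_base)
      moreover have "(\<lambda>x. f x * g x) = exp \<beta> *\<^sub>R gauss (a + b) 0 y'"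
        unfolding f g gauss_mult[OF ab] y'_def[symmetric] \<beta>_def[symmetric]
        by (rule ext) (simp add: scaleR_fun_def gauss_shift_const[of "a + b" \<beta>])
      ultimately show ?thesis by simp
    qed
  qed
  have "\<forall>g\<in>gauss_family R. (\<lambda>x. f x * g x) \<in> ?S"
    using assms(1)
  proof (induction f rule: span_induct_alt)
    case base
    have "(\<lambda>x. 0 * g x) = 0" for g :: "'a \<Rightarrow> real" by (simp add: zero_fun_def)
    then show ?case by (simp add: span_zero)
  next
    case (step c h f)
    show ?case
    proof
      fix g :: "'a \<Rightarrow> real" assume g: "g \<in> gauss_family R"
      have "(\<lambda>x. (c *\<^sub>R h + f) x * g x) = c *\<^sub>R (\<lambda>x. h x * g x) + (\<lambda>x. f x * g x)"
        by (simp add: scaleR_fun_def plus_fun_def distrib_right mult.assoc)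
      then show "(\<lambda>x. (c *\<^sub>R h + f) x * g x) \<in> ?S"
        using gens[OF step(1) g] step(2) g by (simp add: span_add span_scale)
    qed
  qed
  then have *: "(\<lambda>x. f x * g x) \<in> ?S" if "g \<in> gauss_family R" for g using that by blast
  show ?thesis
    using assms(2)
  proof (induction g rule: span_induct_alt)
    case base
    have "(\<lambda>x. f x * 0) = 0" by (simp add: zero_fun_def)
    then show ?case by (simp add: span_zero)
  next
    case (step c h g)
    have "(\<lambda>x. f x * (c *\<^sub>R h + g) x) = c *\<^sub>R (\<lambda>x. f x * h x) + (\<lambda>x. f x * g x)"
      by (simp add: scaleR_fun_def plus_fun_def algebra_simps)
    then show ?case using *[OF step(1)] step(2) by (simp add: span_add span_scale)
  qed
qed

text \<open>The Gaussians centred at \<open>0\<close> and at \<open>\<epsilon> b\<close> for the basis vectors \<open>b\<close> map the space injectively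
  into a bounded set, and the first component tends to \<open>0\<close> at infinity. This turns approximation on the whole space into approximation on a compact set.\<close>

definition gauss_map :: "real \<Rightarrow> 'a::euclidean_space \<Rightarrow> real \<times> 'a" where
  "gauss_map \<epsilon> x = (gauss 1 0 0 x, \<Sum>b\<in>Basis. gauss 1 0 (\<epsilon> *\<^sub>R b) x *\<^sub>R b)"

lemma continuous_gauss_map: "continuous_on S (gauss_map \<epsilon>)"
  unfolding gauss_map_def[abs_def] gauss_def[abs_def] by (intro continuous_intros)

text \<open>The first component determines the norm of \<open>x\<close>. The component at
  \<open>b\<close> determines the distance to \<open>\<epsilon> *\<^sub>R b\<close>, and expanding
  the square then gives the coordinate in direction \<open>b\<close>.\<close>

lemma gauss_map_inj:
  assumes \<epsilon>: "0 < \<epsilon>" and eq: "gauss_map \<epsilon> x = gauss_map \<epsilon> x'"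
  shows "x = x'"
proof (rule euclidean_eqI)
  fix b :: 'a assume b: "b \<in> Basis"
  have e0: "(norm x)\<^sup>2 = (norm x')\<^sup>2" using eq by (auto simp: gauss_map_def gauss_def)
  have "(\<Sum>b\<in>Basis. gauss 1 0 (\<epsilon> *\<^sub>R b) x *\<^sub>R b) \<bullet> b = (\<Sum>b\<in>Basis. gauss 1 0 (\<epsilon> *\<^sub>R b) x' *\<^sub>R b) \<bullet> b"
    using eq by (simp add: gauss_map_def)
  then have "gauss 1 0 (\<epsilon> *\<^sub>R b) x = gauss 1 0 (\<epsilon> *\<^sub>R b) x'" using b by simp
  then have "(norm (x - \<epsilon> *\<^sub>R b))\<^sup>2 = (norm (x' - \<epsilon> *\<^sub>R b))\<^sup>2" by (simp add: gauss_def)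
  then have "\<epsilon> * (x \<bullet> b) = \<epsilon> * (x' \<bullet> b)"
    using e0 unfolding power2_norm_eq_inner by (simp add: inner_diff_left inner_diff_right inner_commute)
  then show "x \<bullet> b = x' \<bullet> b" using \<epsilon> by simp
qed

lemma sum_fun_apply: "(\<Sum>a\<in>A. f a) x = (\<Sum>a\<in>A. f a x)" for f :: "'b \<Rightarrow> 'c \<Rightarrow> real"
  by (induction A rule: infinite_finite_induct) (auto simp: zero_fun_def plus_fun_def)

text \<open>The components of \<open>gauss_map\<close> belong to the family since
  \<open>\<epsilon> < R\<close>, and its span is an algebra with unit.\<close>

lemma gauss_span_polynomial:
  fixes P :: "real \<times> 'a::euclidean_space \<Rightarrow> real"
  assumes P: "real_polynomial_function P" and \<epsilon>: "0 < \<epsilon>" "\<epsilon> < R"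
  shows "(\<lambda>x. P (gauss_map \<epsilon> x)) \<in> span (gauss_family R)"
  using P
proof (induction P rule: real_polynomial_function.induct)
  case (linear h)
  have R: "0 < R" using \<epsilon> by simp
  have mem0: "gauss 1 0 0 \<in> span (gauss_family R)"
    using R by (intro span_base gauss_in_family) auto
  have memb: "gauss 1 0 (\<epsilon> *\<^sub>R b) \<in> span (gauss_family R)" if "b \<in> Basis" for b :: 'a
    using \<epsilon> that by (intro span_base gauss_in_family) auto
  have "h (gauss_map \<epsilon> x) = h (1, 0) * gauss 1 0 0 x + (\<Sum>b\<in>Basis. h (0, b) * gauss 1 0 (\<epsilon> *\<^sub>R b) x)" for x :: 'a
  proof -
    interpret h: bounded_linear h by fact
    have "gauss_map \<epsilon> x = gauss 1 0 0 x *\<^sub>R (1, 0) + (\<Sum>b\<in>Basis. gauss 1 0 (\<epsilon> *\<^sub>R b) x *\<^sub>R (0, b))"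
      by (simp add: gauss_map_def prod_eq_iff fst_sum snd_sum)
    then have "h (gauss_map \<epsilon> x) = gauss 1 0 0 x * h (1, 0) + (\<Sum>b\<in>Basis. gauss 1 0 (\<epsilon> *\<^sub>R b) x * h (0, b))"
      by (simp only: h.add h.sum h.scaleR real_scaleR_def)
    then show ?thesis by (simp only: mult.commute)
  qed
  then have "(\<lambda>x. h (gauss_map \<epsilon> x)) = h (1, 0) *\<^sub>R gauss 1 0 0 + (\<Sum>b\<in>Basis. h (0, b) *\<^sub>R gauss 1 0 (\<epsilon> *\<^sub>R b))"
    by (intro ext) (simp add: plus_fun_def scaleR_fun_def sum_fun_apply)
  then show ?case by (simp only:) (intro span_add span_scale span_sum mem0 memb)
next
  case (const c)
  have "gauss 0 0 0 \<in> gauss_family R" using \<epsilon> by (intro gauss_in_family) auto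
  then have "c *\<^sub>R gauss 0 0 (0::'a) \<in> span (gauss_family R)" by (intro span_scale span_base)
  then show ?case by (simp add: gauss_def[abs_def] scaleR_fun_def)
next
  case (add f g)
  from span_add[OF add.IH] show ?case by (simp add: plus_fun_def)
next
  case (mult f g)
  from span_gauss_family_mult[OF mult.IH] show ?case .
qed

text \<open>The function is transported by \<open>gauss_map\<close> to a compact set that contains
  the image of the whole space, and approximated there by polynomials. Pulled back, the
  approximation is uniform on the whole space.\<close>

lemma gauss_span_approximation:
  fixes g :: "'a::euclidean_space \<Rightarrow> real"
  assumes g: "continuous_on UNIV g" "\<And>x. r \<le> norm x \<Longrightarrow> g x = 0" and r: "0 \<le> r" and R: "0 < R" and e: "0 < e"
  obtains f where "f \<in> span (gauss_family R)" "\<And>x. \<bar>g x - f x\<bar> < e"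
proof -
  define \<epsilon> where "\<epsilon> = R / 2"
  have \<epsilon>: "0 < \<epsilon>" "\<epsilon> < R" using R by (auto simp: \<epsilon>_def)
  let ?F = "gauss_map \<epsilon> :: 'a \<Rightarrow> real \<times> 'a"
  \<comment> \<open>The value of the first component of \<open>gauss_map\<close> on the sphere of
    radius \<open>r\<close>.\<close>
  define m where "m = exp (- (r\<^sup>2))"
  define A where "A = ?F ` cball 0 r"
  \<comment> \<open>Outside the ball the first component is at most \<open>m\<close>, and all the
    others lie between 0 and 1, so this box contains the image of everything outside the
    ball.\<close>
  define B where "B = cbox (0, 0) (m, One :: 'a)"
  define G where "G q = (if q \<in> A then g (inv_into (cball 0 r) ?F q) else 0)" for q
  have inj: "inj_on ?F (cball 0 r)" using gauss_map_inj[OF \<epsilon>(1)] by (auto intro: inj_onI)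
  have cA: "compact A" unfolding A_def by (intro compact_continuous_image continuous_gauss_map compact_cball)
  have cB: "compact B" unfolding B_def by (rule compact_cbox)
  have contA: "continuous_on A (\<lambda>q. g (inv_into (cball 0 r) ?F q))"
  proof -
    have "continuous_on A (inv_into (cball 0 r) ?F)"
      unfolding A_def
      by (rule continuous_on_inv[OF continuous_gauss_map compact_cball]) (use inv_into_f_f[OF inj] in blast)
    then show ?thesis by (rule continuous_on_compose2[OF g(1)]) auto
  qed
  have inv: "inv_into (cball 0 r) ?F (?F x) = x" if "norm x \<le> r" for x
    using inv_into_f_f[OF inj] that by simp
  \<comment> \<open>On the overlap the bound on the first component forces \<open>norm x\<close> to
    be at least \<open>r\<close>, where \<open>g\<close> is 0. So the two definitions of
    \<open>G\<close> agree and glue continuously.\<close>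
  have AB: "g (inv_into (cball 0 r) ?F q) = 0" if "q \<in> A" "q \<in> B" for q
  proof -
    obtain x where x: "norm x \<le> r" "q = ?F x" using \<open>q \<in> A\<close> by (auto simp: A_def)
    have "fst q \<le> m" using \<open>q \<in> B\<close> by (cases q) (auto simp: B_def cbox_Pair_eq)
    then have "r\<^sup>2 \<le> (norm x)\<^sup>2" by (simp add: x(2) gauss_map_def gauss_def m_def)
    then have "\<bar>r\<bar> \<le> norm x" by (simp add: abs_le_square_iff[symmetric])
    then have "r \<le> norm x" by linarith
    then show ?thesis using g(2) inv[OF x(1)] x(2) by simp
  qed
  have cG: "continuous_on (A \<union> B) G"
  proof -
    have "continuous_on (A \<union> B) (\<lambda>q. if q \<in> A then g (inv_into (cball 0 r) ?F q) else 0)"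
      by (rule continuous_on_cases[OF compact_imp_closed[OF cA] compact_imp_closed[OF cB] contA])
        (use AB in \<open>auto intro: continuous_on_const\<close>)
    then show ?thesis by (simp add: G_def[abs_def])
  qed
  have le1: "0 \<le> gauss 1 0 y x" "gauss 1 0 y x \<le> 1" for x y :: 'a by (auto simp: gauss_def)
  have range: "?F x \<in> A \<union> B" for x
  proof (cases "norm x \<le> r")
    case False
    have "gauss 1 0 0 x \<le> m" 
    proof -
      have "r\<^sup>2 \<le> (norm x)\<^sup>2" using False r by (intro power_mono) auto
      then show ?thesis by (simp add: gauss_def m_def)
    qed
    then have "?F x \<in> B"
      using le1 by (auto simp: B_def gauss_map_def cbox_Pair_eq mem_box)
    then show ?thesis by simp
  qed (auto simp: A_def)
  have GF: "G (?F x) = g x" for x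
  proof (cases "norm x \<le> r")
    case True
    then show ?thesis using inv[OF True] by (auto simp: G_def A_def)
  next
    case False
    have "?F x \<notin> A"
    proof
      assume "?F x \<in> A"
      then obtain x' where "norm x' \<le> r" "?F x = ?F x'" by (auto simp: A_def)
      then show False using False gauss_map_inj[OF \<epsilon>(1)] by metis
    qed
    then show ?thesis using False g(2)[of x] by (simp add: G_def)
  qed
  obtain P where P: "real_polynomial_function P" "\<And>q. q \<in> A \<union> B \<Longrightarrow> \<bar>G q - P q\<bar> < e"
    using Stone_Weierstrass_real_polynomial_function[OF compact_Un[OF cA cB] cG e] by blast
  show ?thesis
  proof (rule that)
    show "(\<lambda>x. P (?F x)) \<in> span (gauss_family R)" by (rule gauss_span_polynomial[OF P(1) \<epsilon>])
    show "\<bar>g x - P (?F x)\<bar> < e" for x using P(2)[OF range[of x]] by (simp add: GF)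
  qed
qed

context vanishing_solution
begin

text \<open>Gaussians are only known to be annihilated from some rate \<open>a\<close> on. The bump
  is therefore written as \<open>gauss a 0 0\<close> times a function \<open>g\<close>, and
  \<open>g\<close> is approximated uniformly in the span of the family: all products with the fixed
  factor have a rate of at least \<open>a\<close>, and that factor makes the uniform error small in
  L2.\<close>

lemma pair_bump_eq_0:
  assumes \<phi>: "\<And>k. Ck k \<phi>" "\<And>t. t \<notin> {l1..u1} \<Longrightarrow> \<phi> t = 0" "- T < l1" "u1 < T"
    and \<psi>: "\<And>k. Ck k \<psi>" "\<And>t. t \<notin> {l2..u2} \<Longrightarrow> \<psi> t = 0" "0 < l2" "u2 < \<tau>hat"
    and R: "0 < R"
  shows "pair u \<phi> \<psi> (bump m l v) = 0"
proof -
  \<comment> \<open>The room that the supports have for moving forward, halved to keep the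
    inequalities strict. Kernels with final time \<open>c \<le> \<delta>\<close> are
    admissible.\<close>
  define \<delta> where "\<delta> = min (T - u1) (\<tau>hat - u2) / 2"
  have \<delta>: "0 < \<delta>" "u1 + \<delta> < T" "u2 + \<delta> < \<tau>hat" 
  proof -
    have "\<delta> \<le> (T - u1) / 2" "\<delta> \<le> (\<tau>hat - u2) / 2" by (auto simp: \<delta>_def)
    then show "u1 + \<delta> < T" and "u2 + \<delta> < \<tau>hat" using \<phi>(4) \<psi>(4) by auto
    show "0 < \<delta>" using \<phi>(4) \<psi>(4) by (auto simp: \<delta>_def)
  qed
  define a where "a = 1 / (4 * \<delta>)"
  have a: "0 < a" using \<delta> by (simp add: a_def)
  have s\<phi>: "sq_int lebesgue \<phi>" and s\<psi>: "sq_int lebesgue \<psi>"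
    using test_function_sq_int(1)[OF shift_test_function[OF \<phi>(1,2), where s = 0 and \<Omega> = UNIV]]
      test_function_sq_int(1)[OF shift_test_function[OF \<psi>(1,2), where s = 0 and \<Omega> = UNIV]] by auto
  have gauss0: "pair u \<phi> \<psi> (gauss b 0 y) = 0" if "a \<le> b" "norm y < R" for b y
  proof -
    have b: "0 < b" using a that by simp
    define c where "c = 1 / (4 * b)"
    have c: "0 < c" "c \<le> \<delta>" using b that(1) \<delta>(1) by (auto simp: c_def a_def field_simps)
    have "pair u \<phi> \<psi> (gauss (1 / (4 * c)) 0 y) = 0"
      by (rule pair_heat_kernel_eq_0[OF \<phi>(1-3) _ \<psi>(1-3) _ c(1) that(2)]) (use c \<delta> in auto)
    then show ?thesis using b by (simp add: c_def)
  qed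
  have sg: "sq_int lebesgue (gauss a 0 (0::'a))" by (rule sq_int_gauss(1)[OF a])
  \<comment> \<open>Square integrability is carried through the induction because linearity of
    \<open>pair\<close> in the space factor depends on it.\<close>
  have span: "sq_int lebesgue (\<lambda>x. gauss a 0 0 x * f x) \<and> pair u \<phi> \<psi> (\<lambda>x. gauss a 0 0 x * f x) = 0"
    if "f \<in> span (gauss_family R)" for f
    using that
  proof (induction f rule: span_induct_alt)
    case base
    show ?case using pair_linear_x[OF s\<phi> s\<psi> sg sg, of 0 0] by simp
  next
    case (step c h f)
    obtain b y where h: "h = gauss b 0 y" "0 \<le> b" "norm y < R" using step(1) by (auto simp: gauss_family_def)
    have ab: "0 < a + b" using a h by simp
    define y' where "y' = (1 / (a + b)) *\<^sub>R (a *\<^sub>R 0 + b *\<^sub>R y)"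
    define \<beta> where "\<beta> = - (a * b / (a + b)) * (norm (0 - y))\<^sup>2"
    have gh: "gauss a 0 0 x * h x = exp \<beta> * gauss (a + b) 0 y' x" for x
      unfolding h(1) gauss_mult[OF ab] y'_def \<beta>_def by (rule gauss_shift_const)
    \<comment> \<open>The centre of the product lies on the segment from 0 to \<open>y\<close> and
      so remains in the ball.\<close>
    have "norm y' = b / (a + b) * norm y" using ab h by (simp add: y'_def)
    also have "\<dots> \<le> 1 * norm y" using ab a h by (intro mult_right_mono) auto
    finally have y': "norm y' < R" using h by simp
    have s1: "sq_int lebesgue (gauss (a + b) 0 y')" by (rule sq_int_gauss(1)[OF ab])
    have eq: "(\<lambda>x. gauss a 0 0 x * (c *\<^sub>R h + f) x) = (\<lambda>x. (c * exp \<beta>) * gauss (a + b) 0 y' x + 1 * (gauss a 0 0 x * f x))"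
      by (rule ext) (simp add: distrib_left scaleR_fun_def mult.left_commute[of _ c] gh)
    have f: "sq_int lebesgue (\<lambda>x. gauss a 0 0 x * f x)" "pair u \<phi> \<psi> (\<lambda>x. gauss a 0 0 x * f x) = 0" using step(2) by auto
    show ?case unfolding eq
    proof
      show "sq_int lebesgue (\<lambda>x. c * exp \<beta> * gauss (a + b) 0 y' x + 1 * (gauss a 0 0 x * f x))"
        by (intro sq_int_add sq_int_cmult(1) s1 f)
      show "pair u \<phi> \<psi> (\<lambda>x. c * exp \<beta> * gauss (a + b) 0 y' x + 1 * (gauss a 0 0 x * f x)) = 0"
        using pair_linear_x[OF s\<phi> s\<psi> s1 f(1), of "c * exp \<beta>" 1] gauss0[OF _ y', of "a + b"] h(2) f(2) by simp
    qed
  qed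
  \<comment> \<open>Dividing by the Gaussian weight is harmless because the bump has bounded
    support.\<close>
  define g where "g x = bump m l v x * gauss (- a) 0 0 x" for x
  have gb: "gauss a 0 0 x * g x = bump m l v x" for x
    by (simp add: g_def gauss_def mult.left_commute exp_add[symmetric])
  obtain r where r: "\<And>x. x \<in> box l v \<Longrightarrow> norm x \<le> r" using bounded_box[of l v] by (auto simp: bounded_iff)
  have gc: "continuous_on UNIV g" unfolding g_def[abs_def]
    by (intro continuous_intros continuous_gauss Ck_continuous[OF Ck_bump[of 0]])
  \<comment> \<open>\<open>\<bar>r\<bar> + 1\<close> is a nonnegative radius and strictly larger
    than the norm of every point of the box.\<close>
  have g0: "g x = 0" if "\<bar>r\<bar> + 1 \<le> norm x" for x
  proof -
    have "x \<notin> box l v" using r[of x] that by auto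
    then show ?thesis by (simp add: g_def bump_eq_0_iff[THEN iffD2])
  qed
  define C where "C = sq_norm lebesgue \<phi> * sq_norm lebesgue \<psi> * sq_norm lebesgue (gauss a 0 (0::'a)) * size_u"
  have C: "0 \<le> C" unfolding C_def by (intro mult_nonneg_nonneg sq_norm_nonneg size_u_nonneg)
  have le: "\<bar>pair u \<phi> \<psi> (bump m l v)\<bar> \<le> C * e" if e: "0 < e" for e
  proof -
    obtain f where f: "f \<in> span (gauss_family R)" "\<And>x. \<bar>g x - f x\<bar> < e"
      using gauss_span_approximation[of g "\<bar>r\<bar> + 1" R e, OF gc g0 _ R e] by auto
    have sf: "sq_int lebesgue (\<lambda>x. gauss a 0 0 x * f x)" "pair u \<phi> \<psi> (\<lambda>x. gauss a 0 0 x * f x) = 0"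
      using span[OF f(1)] by auto
    have d: "sq_int lebesgue (\<lambda>x. bump m l v x - gauss a 0 0 x * f x)" by (intro sq_int_diff sq_int_bump sf)
    have "AE x in lebesgue. \<bar>bump m l v x - gauss a 0 0 x * f x\<bar> \<le> \<bar>e * gauss a 0 0 x\<bar>"
    proof (rule AE_I2)
      fix x
      have "bump m l v x - gauss a 0 0 x * f x = gauss a 0 0 x * (g x - f x)" by (simp add: gb[symmetric] right_diff_distrib)
      then have "\<bar>bump m l v x - gauss a 0 0 x * f x\<bar> = gauss a 0 0 x * \<bar>g x - f x\<bar>"
        using gauss_pos[of a 0 0 x] by (simp add: abs_mult)
      also have "\<dots> \<le> gauss a 0 0 x * e" using f(2)[of x] gauss_pos[of a 0 0 x] by (intro mult_left_mono) auto
      finally show "\<bar>bump m l v x - gauss a 0 0 x * f x\<bar> \<le> \<bar>e * gauss a 0 0 x\<bar>" by (simp add: mult.commute)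
    qed
    from sq_int_bound(2)[OF sq_int_cmult(1)[OF sg] sq_intD(1)[OF d] this]
    have n: "sq_norm lebesgue (\<lambda>x. bump m l v x - gauss a 0 0 x * f x) \<le> e * sq_norm lebesgue (gauss a 0 (0::'a))"
      using sq_int_cmult(2)[OF sg, of e] e by simp
    have "pair u \<phi> \<psi> (bump m l v) = pair u \<phi> \<psi> (\<lambda>x. bump m l v x - gauss a 0 0 x * f x)"
      using pair_linear_x[OF s\<phi> s\<psi> sq_int_bump sf(1), of 1 m l v "-1"] sf(2) by simp
    also have "\<bar>\<dots>\<bar> \<le> sq_norm lebesgue \<phi> * sq_norm lebesgue \<psi> * sq_norm lebesgue (\<lambda>x. bump m l v x - gauss a 0 0 x * f x) * size_u"
      by (rule pair_bound[OF s\<phi> s\<psi> d])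
    also have "\<dots> \<le> sq_norm lebesgue \<phi> * sq_norm lebesgue \<psi> * (e * sq_norm lebesgue (gauss a 0 (0::'a))) * size_u"
      by (intro mult_right_mono mult_left_mono n mult_nonneg_nonneg sq_norm_nonneg size_u_nonneg)
    finally show ?thesis by (simp add: C_def mult_ac)
  qed
  have "\<bar>pair u \<phi> \<psi> (bump m l v)\<bar> \<le> 0"
  proof (rule field_le_epsilon)
    fix e :: real assume e: "0 < e"
    \<comment> \<open>Dividing by \<open>C + 1\<close> instead of \<open>C\<close> avoids a separate
      case \<open>C = 0\<close>.\<close>
    have "\<bar>pair u \<phi> \<psi> (bump m l v)\<bar> \<le> C * (e / (C + 1))" using e C by (intro le) auto
    also have "\<dots> \<le> e" using e C by (simp add: field_simps)
    finally show "\<bar>pair u \<phi> \<psi> (bump m l v)\<bar> \<le> 0 + e" by simp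
  qed
  then show ?thesis by simp
qed

end

section \<open>Unique continuation\<close>

lemma countable_dense_subset: "\<exists>D::'a::euclidean_space set. countable D \<and> closure D = UNIV"
  using separable[of "UNIV :: 'a set"] by (metis top.extremum_uniqueI)

context vanishing_solution
begin

text \<open>The integrals are removed from the outside inwards: first the one over \<open>t\<close>,
  then over \<open>\<tau>\<close>, then over \<open>x\<close>. At each stage the exceptional null
  set must serve all bumps in the inner variables at once, so their corners are taken from countable
  dense sets.\<close>

lemma vanishing_everywhere:
  assumes R: "0 < R"
  shows "AE t in lebesgue. AE \<tau> in lebesgue_on {0<..}. AE x in lebesgue.
    0 < \<tau> \<and> \<tau> < \<tau>hat \<and> \<bar>t\<bar> < T \<longrightarrow> u t \<tau> x = 0"
proof -
  obtain D :: "'a set" where D: "countable D" "closure D = UNIV" using countable_dense_subset by blast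
  obtain E :: "real set" where E: "countable E" "closure E = UNIV" using countable_dense_subset by blast
  have bump0: "bump m p q s = 0" if "s \<notin> {p..q}" for m and p q s :: real
    using that bump_eq_0_iff[of m p q s] by (auto simp: box_real)
  have sub: "P < p \<and> q < S" if "p < q" "cbox p q \<subseteq> box P S" for p q P S :: real
    using subsetD[OF that(2), of p] subsetD[OF that(2), of q] that(1) by (simp add: box_real cbox_interval)
  have T: "AE t in lebesgue. t \<in> box (- T) T \<longrightarrow> pair_tau (bump j p q) (bump m l v) (u t) = 0"
    if pq: "cbox p q \<subseteq> box 0 \<tau>hat" for j p q m l v
  proof (cases "p < q")
    case True
    show ?thesis
    proof (rule AE_zero_if_bump_integrals_zero[OF sq_int_pair_tau(1)[OF sq_int_bump sq_int_bump] E(2)])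
      fix i a b assume ab: "cbox a b \<subseteq> box (- T) T"
      show "(\<integral>t. pair_tau (bump j p q) (bump m l v) (u t) * bump i a b t \<partial>lebesgue) = 0"
      proof (cases "a < b")
        case True
        have "pair u (bump i a b) (bump j p q) (bump m l v) = 0"
          by (rule pair_bump_eq_0[OF Ck_bump bump0 _ _ Ck_bump bump0 _ _ R])
            (use sub[OF True ab] sub[OF \<open>p < q\<close> pq] in auto)
        then show ?thesis by (simp add: pair_def mult.commute)
      next
        case False
        then have "bump i a b t = 0" for t by (simp add: bump_eq_0_iff box_real)
        then show ?thesis by simp
      qed
    qed
  \<comment> \<open>For \<open>p \<ge> q\<close> the open box is empty and the bump is identically
    0.\<close>
  next
    case False
    then have "bump j p q s = 0" for s by (simp add: bump_eq_0_iff box_real)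
    then show ?thesis by (simp add: pair_tau_def)
  qed
  have "AE t in lebesgue. \<forall>p\<in>E. \<forall>q\<in>E. \<forall>l\<in>D. \<forall>v\<in>D. \<forall>j m. cbox p q \<subseteq> box 0 \<tau>hat \<longrightarrow> t \<in> box (- T) T \<longrightarrow>
      pair_tau (bump j p q) (bump m l v) (u t) = 0"
    unfolding AE_ball_countable[OF E(1)] AE_ball_countable[OF D(1)] AE_all_countable
    using T by auto
  then show ?thesis
    using u_AE_L2
  proof eventually_elim
    case (elim t)
    show ?case
    proof (cases "\<bar>t\<bar> < T")
      case True
      then have tT: "t \<in> box (- T) T" by (auto simp: box_real)
      have *: "AE \<tau> in lebesgue_on {0<..}. \<tau> \<in> box 0 \<tau>hat \<longrightarrow> pair_x (bump m l v) (u t \<tau>) = 0"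
        if lv: "l \<in> D" "v \<in> D" for m l v
      proof -
        \<comment> \<open>Extension by 0 to the whole line, where the criterion with bumps applies;
          integrals over the half line do not change.\<close>
        define f where "f \<tau> = indicator {0<..} \<tau> * pair_x (bump m l v) (u t \<tau>)" for \<tau> :: real
        have si: "sq_int (lebesgue_on {0<..}) (\<lambda>\<tau>. pair_x (bump m l v) (u t \<tau>))"
          by (rule sq_int_pair_x[OF elim(2) sq_int_bump])
        have "f \<in> borel_measurable lebesgue"
          using sq_intD(1)[OF si] unfolding f_def[abs_def]
          by (subst (asm) borel_measurable_restrict_space_iff) (auto simp: mult.commute)
        moreover have "integrable lebesgue (\<lambda>\<tau>. (f \<tau>)\<^sup>2)"
        proof -
          have "integrable lebesgue (\<lambda>\<tau>. indicator {0<..} \<tau> *\<^sub>R (pair_x (bump m l v) (u t \<tau>))\<^sup>2)"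
            using sq_intD(2)[OF si] by (subst (asm) integrable_restrict_space) auto
          moreover have "indicator {0<..} \<tau> *\<^sub>R (pair_x (bump m l v) (u t \<tau>))\<^sup>2 = (f \<tau>)\<^sup>2" for \<tau>
            by (auto simp: f_def indicator_def)
          ultimately show ?thesis by simp
        qed
        ultimately have sf: "sq_int lebesgue f" by (simp add: sq_int_def)
        have "AE \<tau> in lebesgue. \<tau> \<in> box 0 \<tau>hat \<longrightarrow> f \<tau> = 0"
        proof (rule AE_zero_if_bump_integrals_zero[OF sf E(2)])
          fix j p q assume pq: "p \<in> E" "q \<in> E" "cbox p q \<subseteq> box 0 \<tau>hat"
          have "(\<integral>\<tau>. f \<tau> * bump j p q \<tau> \<partial>lebesgue) = (\<integral>\<tau>. indicator {0<..} \<tau> *\<^sub>R (bump j p q \<tau> * pair_x (bump m l v) (u t \<tau>)) \<partial>lebesgue)"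
            by (intro Bochner_Integration.integral_cong) (auto simp: f_def)
          also have "\<dots> = pair_tau (bump j p q) (bump m l v) (u t)"
            unfolding pair_tau_def by (subst integral_restrict_space) auto
          also have "\<dots> = 0" using elim(1) pq lv tT by blast
          finally show "(\<integral>\<tau>. f \<tau> * bump j p q \<tau> \<partial>lebesgue) = 0" .
        qed
        then show ?thesis
          by (subst AE_restrict_space_iff) (auto simp: f_def elim: eventually_mono)
      qed
      have "AE \<tau> in lebesgue_on {0<..}. \<forall>l\<in>D. \<forall>v\<in>D. \<forall>m. \<tau> \<in> box 0 \<tau>hat \<longrightarrow> pair_x (bump m l v) (u t \<tau>) = 0"
        unfolding AE_ball_countable[OF D(1)] AE_all_countable using * by blast
      then show ?thesis
        using bochner_L2_AE[OF elim(2)]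
      proof eventually_elim
        case (elim \<tau>)
        show ?case
        proof (cases "0 < \<tau> \<and> \<tau> < \<tau>hat")
          case True
          then have "\<tau> \<in> box 0 \<tau>hat" by (simp add: box_real)
          then have z: "pair_x (bump m l v) (u t \<tau>) = 0" if "l \<in> D" "v \<in> D" for m l v using elim(1) that by blast
          have "AE x in lebesgue. x \<in> box (- (real k *\<^sub>R One)) (real k *\<^sub>R One) \<longrightarrow> u t \<tau> x = 0" for k
            by (rule AE_zero_if_bump_integrals_zero[OF vecs_H2_sq_int[OF elim(2)] D(2)])
              (use z in \<open>simp add: pair_x_def\<close>)
          then have "AE x in lebesgue. u t \<tau> x = 0" by (rule AE_if_AE_on_boxes)
          then show ?thesis by eventually_elim simp
        qed auto
      qed
    qed auto
  qed
qed

end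

theorem theorem3p1:
  fixes u :: "real \<Rightarrow> real \<Rightarrow> real ^ 'n \<Rightarrow> real"
    and T R1 t0 \<tau>0 \<tau>hat :: real
  assumes "CARD('n) \<ge> 2"
    and "u \<in> vecs H1_H1_H2_space"
    and "\<not> vanishes_on u UNIV"
    and "solves_equation u"
    and "T > 0" and "R1 > 0"
    and "t0 > 0" and "\<tau>0 > 0" and "\<tau>hat > 0"
    and "t0 < T" and "\<tau>0 < \<tau>hat / 2"
    and "vanishes_on u {(t, \<tau>, x). norm x < R1 \<and> 0 < \<tau> \<and> \<tau> < \<tau>hat \<and> \<bar>t\<bar> < T}"
  shows "vanishes_on u {(t, \<tau>, x). 0 < \<tau> \<and> \<tau> < \<tau>hat \<and> \<bar>t\<bar> < T}"
proof -
  interpret vanishing_solution u T R1 \<tau>hat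
    using assms(2,4,12) by unfold_locales (simp_all add: solves_equation_def vanishes_on_def)
  show ?thesis using vanishing_everywhere[OF \<open>R1 > 0\<close>] by (simp add: vanishes_on_def)
qed

end
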